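(* Let $s>\frac32$, $M>0$ with $M\neq1$, $\epsilon>0$, $\sigma_2,\sigma_3\in\{1,-1\}$, $\delta,D\in\mathbb{R}$, $W>0$. Let $(\alpha_1,\alpha_2)\in\mathbb{R}^2$ be the unique solution of $$\tfrac1M\alpha_2+D=-\sigma_3\alpha_1,\qquad \tfrac1M\alpha_1+M=-\sigma_3\alpha_2,$$ and set $$L_1=-i\delta\alpha_1\left(\overline\psi\,\partial_x^2\psi-\psi\,\partial_x^2\overline\psi\right),\qquad L_2=-\tfrac{i}{M}\delta\alpha_2\left(\overline\psi\,\partial_x\psi-\psi\,\partial_x\overline\psi\right).$$ Consider the modified Zakharov–Rubenchik system $$\begin{cases}\partial_t\psi-\sigma_3\partial_x\psi-i\epsilon\delta\partial_x^2\psi+i\epsilon\left\{\sigma_2|\psi|^2+W(\rho+D\partial_x\phi)\right\}\psi=0,\\ \partial_t\rho+\partial_x^2\phi+D\partial_x(|\psi|^2)+\epsilon L_1=0,\\ \partial_t\phi+\frac1{M^2}\rho+|\psi|^2+\epsilon L_2=0,\end{cases}$$ with initial condition $(\psi,\rho,\phi)(0)=(\psi_0,\rho_0,\phi_0)$, where $\psi$ is complex-valued and $\rho,\phi$ are real-valued. Let $Z=H^s(\mathbb{T})\times H^s(\mathbb{T})\times H^{s+1}(\mathbb{T})$ and $\tilde Z=H^{s-2}(\mathbb{T})\times H^{s-2}(\mathbb{T})\times H^{s-1}(\mathbb{T})$, where in both spaces the first component is complex-valued and the second and third components are real-valued. Then this initial value problem is locally well-posed in $Z$: for every $\tilde\Psi_0=(\psi_0,\rho_0,\phi_0)\in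 Z$ there exist $T>0$ and a unique $$\tilde\Psi=(\psi,\rho,\phi)\in C([0,T];Z)\cap C^1([0,T];\tilde Z)$$ satisfying the system with $\tilde\Psi(0)=\tilde\Psi_0$. Moreover, the data-to-solution map is continuous in the following sense: if $\tilde\Psi_{0,n}\in Z$ and $\tilde\Psi_{0,n}\to\tilde\Psi_0$ in $Z$ as $n\to\infty$, then for every $T'\in(0,T)$ there is $N\in\mathbb{N}$ such that for $n>N$ the solution $\tilde\Psi_n$ with initial data $\tilde\Psi_{0,n}$ exists in $C([0,T'];Z)$, and $$\lim_{n\to\infty}\sup_{t\in[0,T']}\|\tilde\Psi_n(t)-\tilde\Psi(t)\|_Z=0.$$
   Context: $\mathbb{T}=\mathbb{R}/2\pi\mathbb{Z}$. For $r\in\mathbb{R}$, $H^r(\mathbb{T})$ is the Sobolev space of periodic distributions $f$ with $\|f\|_r=\big(2\pi\sum_{k\in\mathbb{Z}}(1+k^2)^r|\widehat f(k)|^2\big)^{1/2}<\infty$, where $\widehat f(k)=\frac1{2\pi}\langle f,e^{-ikx}\rangle$. Products of such spaces carry the sum of the component norms. Derivatives in $x$ are distributional; time derivatives are taken in $\tilde Z$ and the system is understood to hold in $\tilde Z$ for every $t\in[0,T]$. For $\psi\in H^s(\mathbb{T})$ with $s>3/2$, the expression $\overline\psi\,\partial_x^2\psi-\psi\,\partial_x^2\overline\psi$ is understood as $\partial_x\left(\overline\psi\,\partial_x\psi-\psi\,\partial_x\overline\psi\right)\in H^{s-2}(\mathbb{T})$. *)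

theory Defs
  imports "HOL-Analysis.Analysis"
begin

section \<open>Test functions on the torus\<close>

text \<open>
  Functions on \<open>\<real>/2\<pi>\<int>\<close> are represented by \<open>2\<pi>\<close>-periodic functions on \<open>\<real>\<close>.
\<close>

definition fun_deriv :: "(real \<Rightarrow> complex) \<Rightarrow> real \<Rightarrow> complex" where
  "fun_deriv \<phi> = (\<lambda>x. vector_derivative \<phi> (at x))"

definition periodic_2pi :: "(real \<Rightarrow> complex) \<Rightarrow> bool" where
  "periodic_2pi \<phi> \<longleftrightarrow> (\<forall>x. \<phi> (x + 2 * pi) = \<phi> x)"

definition test_functions :: "(real \<Rightarrow> complex) set" where
  "test_functions =
    {\<phi>. periodic_2pi \<phi> \<and> (\<forall>n x. (fun_deriv ^^ n) \<phi> differentiable (at x))}"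

definition test_seminorm :: "nat \<Rightarrow> (real \<Rightarrow> complex) \<Rightarrow> real" where
  "test_seminorm N \<phi> = (\<Sum>j\<le>N. SUP x. norm ((fun_deriv ^^ j) \<phi> x))"

lemma test_functionsD:
  assumes "\<phi> \<in> test_functions"
  shows "periodic_2pi \<phi>" "(fun_deriv ^^ n) \<phi> differentiable (at x)"
    "\<phi> differentiable (at x)"
  using assms by (auto simp: test_functions_def dest: spec[of _ "0::nat"])

lemma periodic_2pi_int:
  assumes "periodic_2pi \<phi>"
  shows "\<phi> (x + 2 * pi * of_int n) = \<phi> x"
proof -
  have nat: "\<phi> (x + 2 * pi * of_nat m) = \<phi> x" for x m
  proof (induction m)
    case (Suc m)
    have "\<phi> (x + 2 * pi * of_nat (Suc m)) = \<phi> ((x + 2 * pi * of_nat m) + 2 * pi)"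
      by (simp add: algebra_simps)
    then show ?case using Suc assms by (simp add: periodic_2pi_def)
  qed simp
  show ?thesis
  proof (cases "n \<ge> 0")
    case True
    then show ?thesis using nat[of x "nat n"] by simp
  next
    case False
    then show ?thesis using nat[of "x + 2 * pi * of_int n" "nat (- n)"]
      by (simp add: algebra_simps)
  qed
qed

lemma periodic_2pi_reduce:
  assumes "periodic_2pi \<phi>"
  obtains y where "y \<in> {0..2 * pi}" "\<phi> x = \<phi> y"
proof
  let ?n = "\<lfloor>x / (2 * pi)\<rfloor>"
  let ?y = "x + 2 * pi * of_int (- ?n)"
  have "of_int ?n \<le> x / (2 * pi)" "x / (2 * pi) < of_int ?n + 1"
    by linarith+
  then have "of_int ?n * (2 * pi) \<le> x" "x < (of_int ?n + 1) * (2 * pi)"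
    using pi_gt_zero by (simp_all only: pos_le_divide_eq pos_divide_less_eq
        zero_less_mult_iff zero_less_numeral simp_thms)
  then show "?y \<in> {0..2 * pi}"
    by (simp add: algebra_simps)
  show "\<phi> x = \<phi> ?y"
    using periodic_2pi_int[OF assms, of x "- ?n"] by simp
qed

lemma periodic_2pi_bounded:
  assumes "periodic_2pi \<phi>" "continuous_on UNIV \<phi>"
  obtains B where "\<And>x. norm (\<phi> x) \<le> B"
proof -
  have "bounded (\<phi> ` {0..2 * pi})"
    using assms(2) by (intro compact_imp_bounded compact_continuous_image)
      (auto intro: continuous_on_subset)
  then obtain B where "\<And>y. y \<in> {0..2 * pi} \<Longrightarrow> norm (\<phi> y) \<le> B"
    unfolding bounded_iff by blast
  then show ?thesis
    by (intro that[of B]) (metis periodic_2pi_reduce[OF assms(1)])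
qed

lemma fun_deriv_periodic:
  assumes "periodic_2pi \<phi>" "\<And>x. \<phi> differentiable (at x)"
  shows "periodic_2pi (fun_deriv \<phi>)"
  unfolding periodic_2pi_def
proof
  fix x
  have "(\<phi> has_vector_derivative vector_derivative \<phi> (at (x + 2 * pi))) (at (x + 2 * pi))"
    using assms(2) vector_derivative_works by blast
  then have "(\<phi> has_vector_derivative vector_derivative \<phi> (at (x + 2 * pi)))
      (at (2 * pi + x))"
    by (simp add: add.commute)
  then have "((\<lambda>y. \<phi> (2 * pi + y)) has_vector_derivative
      vector_derivative \<phi> (at (x + 2 * pi))) (at x)"
    using vector_diff_chain_at[of "\<lambda>y. 2 * pi + y" 1 x \<phi>]
    by (force simp: o_def intro!: derivative_eq_intros)
  moreover have "(\<lambda>y. \<phi> (2 * pi + y)) = \<phi>"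
    using assms(1) by (simp add: periodic_2pi_def add.commute)
  ultimately show "fun_deriv \<phi> (x + 2 * pi) = fun_deriv \<phi> x"
    by (simp add: fun_deriv_def vector_derivative_at)
qed

lemma test_functions_fun_deriv:
  assumes "\<phi> \<in> test_functions"
  shows "fun_deriv \<phi> \<in> test_functions"
proof -
  have "(fun_deriv ^^ n) (fun_deriv \<phi>) differentiable (at x)" for n x
    using test_functionsD(2)[OF assms, of "Suc n" x] by (simp add: funpow_swap1)
  then show ?thesis
    using fun_deriv_periodic[OF test_functionsD(1)[OF assms] test_functionsD(3)[OF assms]]
    by (simp add: test_functions_def)
qed

lemma test_functions_funpow:
  "\<phi> \<in> test_functions \<Longrightarrow> (fun_deriv ^^ n) \<phi> \<in> test_functions"
  by (induction n) (auto intro: test_functions_fun_deriv)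

lemma test_functions_continuous:
  "\<phi> \<in> test_functions \<Longrightarrow> continuous_on A \<phi>"
  by (meson continuous_at_imp_continuous_on differentiable_imp_continuous_within
      test_functionsD(3))

lemma test_functions_bdd:
  assumes "\<phi> \<in> test_functions"
  shows "bdd_above (range (\<lambda>x. norm ((fun_deriv ^^ j) \<phi> x)))"
proof -
  have *: "(fun_deriv ^^ j) \<phi> \<in> test_functions"
    by (rule test_functions_funpow[OF assms])
  obtain B where "\<And>x. norm ((fun_deriv ^^ j) \<phi> x) \<le> B"
    using periodic_2pi_bounded[OF test_functionsD(1)[OF *] test_functions_continuous[OF *]]
    by blast
  then show ?thesis by (intro bdd_aboveI[of _ B]) auto
qed

lemma test_sup_nonneg:
  assumes "\<phi> \<in> test_functions"
  shows "0 \<le> (SUP x. norm ((fun_deriv ^^ j) \<phi> x))"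
  by (rule order_trans[OF norm_ge_zero cSUP_upper[OF UNIV_I test_functions_bdd[OF assms]]])

lemma test_seminorm_nonneg: "\<phi> \<in> test_functions \<Longrightarrow> 0 \<le> test_seminorm N \<phi>"
  unfolding test_seminorm_def by (intro sum_nonneg test_sup_nonneg)

lemma test_seminorm_mono:
  "\<phi> \<in> test_functions \<Longrightarrow> M \<le> N \<Longrightarrow> test_seminorm M \<phi> \<le> test_seminorm N \<phi>"
  unfolding test_seminorm_def by (intro sum_mono2 test_sup_nonneg) auto

lemma test_seminorm_fun_deriv:
  assumes "\<phi> \<in> test_functions"
  shows "test_seminorm N (fun_deriv \<phi>) \<le> test_seminorm (Suc N) \<phi>"
proof -
  have "test_seminorm (Suc N) \<phi> = (SUP x. norm ((fun_deriv ^^ 0) \<phi> x)) +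
      (\<Sum>j\<le>N. SUP x. norm ((fun_deriv ^^ Suc j) \<phi> x))"
    unfolding test_seminorm_def by (rule sum.atMost_Suc_shift)
  also have "(\<Sum>j\<le>N. SUP x. norm ((fun_deriv ^^ Suc j) \<phi> x)) = test_seminorm N (fun_deriv \<phi>)"
    unfolding test_seminorm_def by (simp add: funpow_swap1)
  finally show ?thesis using test_sup_nonneg[OF assms, of 0] by linarith
qed

lemma fun_deriv_add:
  assumes "\<And>x. \<phi> differentiable (at x)" "\<And>x. \<eta> differentiable (at x)"
  shows "fun_deriv (\<lambda>x. \<phi> x + \<eta> x) = (\<lambda>x. fun_deriv \<phi> x + fun_deriv \<eta> x)"
  using assms unfolding fun_deriv_def by simp

lemma fun_deriv_mult_left:
  assumes "\<And>x. \<phi> differentiable (at x)"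
  shows "fun_deriv (\<lambda>x. c * \<phi> x) = (\<lambda>x. c * fun_deriv \<phi> x)"
  using assms unfolding fun_deriv_def by simp

lemma has_vector_derivative_cnj_iff_deriv:
  assumes "\<phi> differentiable (at x)"
  shows "((\<lambda>x. cnj (\<phi> x)) has_vector_derivative cnj (vector_derivative \<phi> (at x))) (at x)"
  using assms by (intro has_vector_derivative_cnj) (simp add: vector_derivative_works)

lemma fun_deriv_cnj:
  assumes "\<And>x. \<phi> differentiable (at x)"
  shows "fun_deriv (\<lambda>x. cnj (\<phi> x)) = (\<lambda>x. cnj (fun_deriv \<phi> x))"
  unfolding fun_deriv_def
  using has_vector_derivative_cnj_iff_deriv[OF assms] vector_derivative_at by blast

lemma test_functions_add:
  assumes "\<phi> \<in> test_functions" "\<eta> \<in> test_functions"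
  shows "(\<lambda>x. \<phi> x + \<eta> x) \<in> test_functions"
proof -
  have "(fun_deriv ^^ n) (\<lambda>x. \<phi> x + \<eta> x) =
      (\<lambda>x. (fun_deriv ^^ n) \<phi> x + (fun_deriv ^^ n) \<eta> x)" for n
    by (induction n) (simp_all add: fun_deriv_add test_functionsD(2)[OF assms(1)]
        test_functionsD(2)[OF assms(2)])
  then show ?thesis
    using assms by (auto simp: test_functions_def periodic_2pi_def)
qed

lemma test_functions_mult_left:
  assumes "\<phi> \<in> test_functions"
  shows "(\<lambda>x. c * \<phi> x) \<in> test_functions"
proof -
  have "(fun_deriv ^^ n) (\<lambda>x. c * \<phi> x) = (\<lambda>x. c * (fun_deriv ^^ n) \<phi> x)" for n
    by (induction n) (simp_all add: fun_deriv_mult_left test_functionsD(2)[OF assms])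
  then show ?thesis
    using assms by (auto simp: test_functions_def periodic_2pi_def)
qed

lemma funpow_fun_deriv_cnj:
  assumes "\<phi> \<in> test_functions"
  shows "(fun_deriv ^^ n) (\<lambda>x. cnj (\<phi> x)) = (\<lambda>x. cnj ((fun_deriv ^^ n) \<phi> x))"
  by (induction n) (simp_all add: fun_deriv_cnj test_functionsD(2)[OF assms])

lemma test_functions_cnj:
  assumes "\<phi> \<in> test_functions"
  shows "(\<lambda>x. cnj (\<phi> x)) \<in> test_functions"
proof -
  have "(\<lambda>x. cnj ((fun_deriv ^^ n) \<phi> x)) differentiable (at x)" for n x
    using has_vector_derivative_cnj_iff_deriv[OF test_functionsD(2)[OF assms]]
    by (rule differentiableI_vector)
  then show ?thesis
    using test_functionsD(1)[OF assms]
    by (simp add: test_functions_def funpow_fun_deriv_cnj[OF assms] periodic_2pi_def)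
qed

lemma test_functions_exp: "(\<lambda>x. exp (\<i> * of_int k * of_real x)) \<in> test_functions"
proof -
  let ?e = "\<lambda>x. exp (\<i> * of_int k * of_real x) :: complex"
  have d: "((\<lambda>x. c * ?e x) has_vector_derivative (c * (\<i> * of_int k)) * ?e x) (at x)" for c x
    by (rule has_vector_derivative_real_field)
      (auto intro!: derivative_eq_intros simp: mult_ac)
  have "(fun_deriv ^^ n) ?e = (\<lambda>x. (\<i> * of_int k) ^ n * ?e x)" for n
  proof (induction n)
    case (Suc n)
    then show ?case
      using d[of "(\<i> * of_int k) ^ n"]
      by (auto simp: fun_deriv_def vector_derivative_at mult_ac)
  qed simp
  moreover have e: "(\<lambda>x. c * ?e x) differentiable (at x)" for c x
    using d by (rule differentiableI_vector)
  moreover have "periodic_2pi ?e"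
  proof -
    have "exp (2 * of_int k * of_real pi * \<i>) = (1::complex)"
      using exp_integer_2pi[of "of_int k"] by simp
    then show ?thesis
      unfolding periodic_2pi_def by (simp add: distrib_left exp_add mult_ac)
  qed
  ultimately show ?thesis
    unfolding test_functions_def by (simp only: mem_Collect_eq e simp_thms)
qed


section \<open>Periodic distributions\<close>

text \<open>
  A periodic distribution is a continuous linear functional on the test functions; the value
  \<open>0\<close> outside \<open>test_functions\<close> makes equality of distributions equality of functionals.
\<close>

typedef pdist =
  "{u :: (real \<Rightarrow> complex) \<Rightarrow> complex.
     (\<forall>\<phi>\<in>test_functions. \<forall>\<eta>\<in>test_functions. u (\<lambda>x. \<phi> x + \<eta> x) = u \<phi> + u \<eta>) \<and>
     (\<forall>c. \<forall>\<phi>\<in>test_functions. u (\<lambda>x. c * \<phi> x) = c * u \<phi>) \<and>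
     (\<exists>C N. \<forall>\<phi>\<in>test_functions. norm (u \<phi>) \<le> C * test_seminorm N \<phi>) \<and>
     (\<forall>\<phi>. \<phi> \<notin> test_functions \<longrightarrow> u \<phi> = 0)}"
  morphisms pairing Abs_pdist
  by (rule exI[of _ "\<lambda>_. 0"]) (auto intro!: exI[of _ "0::real"])

setup_lifting type_definition_pdist

lemma pdist_eqI: "(\<And>\<phi>. \<phi> \<in> test_functions \<Longrightarrow> pairing u \<phi> = pairing v \<phi>) \<Longrightarrow> u = v"
  using pairing[of u] pairing[of v] by (auto simp: pairing_inject[symmetric] fun_eq_iff) metis

lift_definition cscale :: "complex \<Rightarrow> pdist \<Rightarrow> pdist"  (infixr \<open>*\<^sub>C\<close> 75)
  is "\<lambda>c u \<phi>. c * u \<phi>"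
proof (clarsimp simp: distrib_left mult_ac)
  fix c :: complex and u :: "(real \<Rightarrow> complex) \<Rightarrow> complex" and C N
  assume "\<forall>\<phi>\<in>test_functions. norm (u \<phi>) \<le> C * test_seminorm N \<phi>"
  then have "\<forall>\<phi>\<in>test_functions. norm c * norm (u \<phi>) \<le> (norm c * C) * test_seminorm N \<phi>"
    by (auto simp: mult.assoc intro: mult_left_mono)
  then show "\<exists>C N. \<forall>\<phi>\<in>test_functions. norm (c * u \<phi>) \<le> C * test_seminorm N \<phi>"
    by (auto simp: norm_mult)
qed

instantiation pdist :: real_vector
begin

lift_definition zero_pdist :: pdist is "\<lambda>_. 0"
  by (auto intro!: exI[of _ "0::real"])

lift_definition plus_pdist :: "pdist \<Rightarrow> pdist \<Rightarrow> pdist" is "\<lambda>u v \<phi>. u \<phi> + v \<phi>"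
proof (clarsimp simp: distrib_left)
  fix u v :: "(real \<Rightarrow> complex) \<Rightarrow> complex" and C N C' N'
  assume u: "\<forall>\<phi>\<in>test_functions. norm (u \<phi>) \<le> C * test_seminorm N \<phi>"
    and v: "\<forall>\<phi>\<in>test_functions. norm (v \<phi>) \<le> C' * test_seminorm N' \<phi>"
  have "norm (u \<phi> + v \<phi>) \<le> (\<bar>C\<bar> + \<bar>C'\<bar>) * test_seminorm (max N N') \<phi>"
    if \<phi>: "\<phi> \<in> test_functions" for \<phi>
  proof -
    have *: "K * test_seminorm n \<phi> \<le> \<bar>K\<bar> * test_seminorm (max N N') \<phi>"
      if "n \<le> max N N'" for K n
      using that \<phi> by (intro mult_mono test_seminorm_mono test_seminorm_nonneg) auto
    have "norm (u \<phi> + v \<phi>) \<le> norm (u \<phi>) + norm (v \<phi>)"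
      by (rule norm_triangle_ineq)
    also have "\<dots> \<le> \<bar>C\<bar> * test_seminorm (max N N') \<phi> + \<bar>C'\<bar> * test_seminorm (max N N') \<phi>"
      using u v \<phi> *[of N C] *[of N' C'] by (intro add_mono) fastforce+
    finally show ?thesis by (simp add: distrib_right)
  qed
  then show "\<exists>C N. \<forall>\<phi>\<in>test_functions. norm (u \<phi> + v \<phi>) \<le> C * test_seminorm N \<phi>"
    by blast
qed

definition "uminus_pdist (u::pdist) = (- 1) *\<^sub>C u"
definition "minus_pdist (u::pdist) v = u + (- v)"
definition "scaleR_pdist r (u::pdist) = complex_of_real r *\<^sub>C u"

instance
  by standard
    (simp_all add: uminus_pdist_def minus_pdist_def scaleR_pdist_def,
      (transfer; simp add: algebra_simps)+)

end

lift_definition pd_deriv :: "pdist \<Rightarrow> pdist"  (\<open>\<partial>\<^sub>x\<close>)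
  is "\<lambda>u \<phi>. if \<phi> \<in> test_functions then - u (fun_deriv \<phi>) else 0"
proof (clarsimp simp: test_functions_add test_functions_mult_left test_functions_fun_deriv
    fun_deriv_add fun_deriv_mult_left test_functionsD)
  fix u :: "(real \<Rightarrow> complex) \<Rightarrow> complex" and C N
  assume u: "\<forall>\<phi>\<in>test_functions. norm (u \<phi>) \<le> C * test_seminorm N \<phi>"
  have "norm (u (fun_deriv \<phi>)) \<le> \<bar>C\<bar> * test_seminorm (Suc N) \<phi>" if "\<phi> \<in> test_functions" for \<phi>
  proof -
    have "norm (u (fun_deriv \<phi>)) \<le> C * test_seminorm N (fun_deriv \<phi>)"
      using u that by (simp add: test_functions_fun_deriv)
    also have "\<dots> \<le> \<bar>C\<bar> * test_seminorm (Suc N) \<phi>"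
      using that by (intro mult_mono test_seminorm_fun_deriv test_seminorm_nonneg
          test_functions_fun_deriv) auto
    finally show ?thesis .
  qed
  then show "\<exists>C N. \<forall>\<phi>\<in>test_functions. norm (u (fun_deriv \<phi>)) \<le> C * test_seminorm N \<phi>"
    by blast
qed

lift_definition pd_cnj :: "pdist \<Rightarrow> pdist"
  is "\<lambda>u \<phi>. if \<phi> \<in> test_functions then cnj (u (\<lambda>x. cnj (\<phi> x))) else 0"
proof (clarsimp simp: test_functions_add test_functions_mult_left test_functions_cnj)
  fix u :: "(real \<Rightarrow> complex) \<Rightarrow> complex" and C N
  assume u: "\<forall>\<phi>\<in>test_functions. norm (u \<phi>) \<le> C * test_seminorm N \<phi>"
  have "norm (u (\<lambda>x. cnj (\<phi> x))) \<le> C * test_seminorm N \<phi>" if "\<phi> \<in> test_functions" for \<phi>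
    using u[rule_format, OF test_functions_cnj[OF that]]
    by (simp add: test_seminorm_def funpow_fun_deriv_cnj[OF that])
  then show "\<exists>C N. \<forall>\<phi>\<in>test_functions. norm (u (\<lambda>x. cnj (\<phi> x))) \<le> C * test_seminorm N \<phi>"
    by blast
qed

definition pd_real :: "pdist \<Rightarrow> bool" where
  "pd_real u \<longleftrightarrow> pd_cnj u = u"

definition cont_periodic :: "(real \<Rightarrow> complex) \<Rightarrow> bool" where
  "cont_periodic F \<longleftrightarrow> continuous_on UNIV F \<and> periodic_2pi F"

lift_definition pd_of_fun :: "(real \<Rightarrow> complex) \<Rightarrow> pdist"
  is "\<lambda>F \<phi>. if cont_periodic F \<and> \<phi> \<in> test_functions
            then integral {0..2 * pi} (\<lambda>x. F x * \<phi> x) else 0"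
proof -
  fix F :: "real \<Rightarrow> complex"
  show "?thesis F"
  proof (cases "cont_periodic F")
    case False
    then show ?thesis by (auto intro!: exI[of _ "0::real"])
  next
    case True
    then have F: "continuous_on A F" for A
      by (auto simp: cont_periodic_def intro: continuous_on_subset)
    have int: "(\<lambda>x. F x * \<phi> x) integrable_on {0..2 * pi}" if "\<phi> \<in> test_functions" for \<phi>
      using that by (intro integrable_continuous_real continuous_intros F
          test_functions_continuous)
    obtain B where B: "\<And>x. norm (F x) \<le> B"
      using True periodic_2pi_bounded by (metis cont_periodic_def)
    have "norm (integral {0..2 * pi} (\<lambda>x. F x * \<phi> x)) \<le> (2 * pi * B) * test_seminorm 0 \<phi>"
      if \<phi>: "\<phi> \<in> test_functions" for \<phi>
    proof -
      have "norm (F x * \<phi> x) \<le> B * test_seminorm 0 \<phi>" for x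
        using B[of x] B[of 0] norm_ge_zero[of "F 0"]
          cSUP_upper[OF UNIV_I test_functions_bdd[OF \<phi>, of 0], of x]
        by (auto simp: norm_mult test_seminorm_def intro!: mult_mono
            intro: order_trans[OF norm_ge_zero])
      then have "norm (integral {0..2 * pi} (\<lambda>x. F x * \<phi> x))
          \<le> B * test_seminorm 0 \<phi> * (2 * pi - 0)"
        using \<phi> by (intro integral_bound continuous_intros F test_functions_continuous) auto
      then show ?thesis by (simp add: mult_ac)
    qed
    then have "\<exists>C N. \<forall>\<phi>\<in>test_functions.
        norm (integral {0..2 * pi} (\<lambda>x. F x * \<phi> x)) \<le> C * test_seminorm N \<phi>"
      by blast
    moreover have "integral {0..2 * pi} (\<lambda>x. F x * (\<phi> x + \<eta> x)) =
        integral {0..2 * pi} (\<lambda>x. F x * \<phi> x) + integral {0..2 * pi} (\<lambda>x. F x * \<eta> x)"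
      if "\<phi> \<in> test_functions" "\<eta> \<in> test_functions" for \<phi> \<eta>
      using integral_add[OF int[OF that(1)] int[OF that(2)]] by (simp add: distrib_left)
    moreover have "integral {0..2 * pi} (\<lambda>x. F x * (c * \<phi> x)) =
        c * integral {0..2 * pi} (\<lambda>x. F x * \<phi> x)" for c \<phi>
      using integral_mult_right[of "{0..2 * pi}" c "\<lambda>x. F x * \<phi> x"]
      by (simp add: mult.left_commute)
    ultimately show ?thesis
      using True by (simp add: test_functions_add test_functions_mult_left)
  qed
qed

text \<open>
  The continuous representative is unique if it exists.  The product \<open>\<odot>\<close> below is
  meaningful only for distributions given by continuous functions, which by Sobolev embedding
  covers \<open>H\<^sup>r\<close> for \<open>r > 1/2\<close>.
\<close>

definition pd_fun :: "pdist \<Rightarrow> real \<Rightarrow> complex" where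
  "pd_fun u = (THE F. cont_periodic F \<and> pd_of_fun F = u)"

definition pd_mult :: "pdist \<Rightarrow> pdist \<Rightarrow> pdist"  (infixl \<open>\<odot>\<close> 76) where
  "u \<odot> v = pd_of_fun (\<lambda>x. pd_fun u x * pd_fun v x)"


section \<open>Sobolev spaces\<close>

definition fcoeff :: "pdist \<Rightarrow> int \<Rightarrow> complex" where
  "fcoeff u k = 1 / (2 * pi) * pairing u (\<lambda>x. exp (- (\<i> * of_int k * of_real x)))"

definition sobolev :: "real \<Rightarrow> pdist set" where
  "sobolev r = {u. (\<lambda>k. (1 + (of_int k)\<^sup>2) powr r * (cmod (fcoeff u k))\<^sup>2) summable_on UNIV}"

definition sobolev_norm :: "real \<Rightarrow> pdist \<Rightarrow> real" where
  "sobolev_norm r u =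
    sqrt (2 * pi * (\<Sum>\<^sub>\<infinity>k\<in>UNIV. (1 + (of_int k)\<^sup>2) powr r * (cmod (fcoeff u k))\<^sup>2))"

text \<open>
  \<open>Zspace r\<close> is \<open>H\<^sup>r \<times> H\<^sup>r \<times> H\<^sup>r\<^sup>+\<^sup>1\<close> with real second and third components: the space \<open>Z\<close> is
  \<open>Zspace s\<close> and the space in which time derivatives are taken is \<open>Zspace (s - 2)\<close>.
\<close>

definition Zspace :: "real \<Rightarrow> (pdist \<times> pdist \<times> pdist) set" where
  "Zspace r = {(\<psi>, \<rho>, \<phi>). \<psi> \<in> sobolev r \<and> \<rho> \<in> sobolev r \<and> pd_real \<rho> \<and>
                           \<phi> \<in> sobolev (r + 1) \<and> pd_real \<phi>}"

definition Znorm :: "real \<Rightarrow> pdist \<times> pdist \<times> pdist \<Rightarrow> real" where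
  "Znorm r = (\<lambda>(\<psi>, \<rho>, \<phi>). sobolev_norm r \<psi> + sobolev_norm r \<rho> + sobolev_norm (r + 1) \<phi>)"

definition C_Z :: "real \<Rightarrow> real \<Rightarrow> (real \<Rightarrow> pdist \<times> pdist \<times> pdist) set" where
  "C_Z r T = {\<Psi>. (\<forall>t\<in>{0..T}. \<Psi> t \<in> Zspace r) \<and>
     (\<forall>t\<in>{0..T}. ((\<lambda>\<tau>. Znorm r (\<Psi> \<tau> - \<Psi> t)) \<longlongrightarrow> 0) (at t within {0..T}))}"

definition has_Z_derivative ::
    "real \<Rightarrow> real \<Rightarrow> (real \<Rightarrow> pdist \<times> pdist \<times> pdist) \<Rightarrow>
      (real \<Rightarrow> pdist \<times> pdist \<times> pdist) \<Rightarrow> bool" where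
  "has_Z_derivative r T \<Psi> \<Psi>' \<longleftrightarrow>
     (\<forall>t\<in>{0..T}. ((\<lambda>\<tau>. Znorm r ((\<Psi> \<tau> - \<Psi> t) /\<^sub>R (\<tau> - t) - \<Psi>' t)) \<longlongrightarrow> 0) (at t within {0..T}))"


section \<open>The modified Zakharov--Rubenchik system\<close>

definition zr_coeffs :: "real \<Rightarrow> real \<Rightarrow> real \<Rightarrow> real \<Rightarrow> real \<Rightarrow> bool" where
  "zr_coeffs M D \<sigma>\<^sub>3 \<alpha>\<^sub>1 \<alpha>\<^sub>2 \<longleftrightarrow>
     1 / M * \<alpha>\<^sub>2 + D = - \<sigma>\<^sub>3 * \<alpha>\<^sub>1 \<and> 1 / M * \<alpha>\<^sub>1 + M = - \<sigma>\<^sub>3 * \<alpha>\<^sub>2"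

lemma zr_coeffs_ex1:
  assumes "M > 0" "M \<noteq> 1" "\<sigma>\<^sub>3 \<in> {1, -1}"
  shows "\<exists>!(\<alpha>\<^sub>1, \<alpha>\<^sub>2). zr_coeffs M D \<sigma>\<^sub>3 \<alpha>\<^sub>1 \<alpha>\<^sub>2"
proof -
  have M: "M\<^sup>2 - 1 \<noteq> 0" "M\<^sup>2 \<noteq> 1"
    using assms by (auto simp: power2_eq_1_iff)
  have iff: "zr_coeffs M D \<sigma>\<^sub>3 a b \<longleftrightarrow>
      a = (M\<^sup>2 - \<sigma>\<^sub>3 * D * M\<^sup>2) / (M\<^sup>2 - 1) \<and> b = (D * M - \<sigma>\<^sub>3 * M ^ 3) / (M\<^sup>2 - 1)"
    for a b
  proof -
    have "zr_coeffs M D \<sigma>\<^sub>3 a b \<longleftrightarrow> b + D * M = - \<sigma>\<^sub>3 * a * M \<and> a + M * M = - \<sigma>\<^sub>3 * b * M"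
      using assms(1) by (simp add: zr_coeffs_def field_simps)
    also have "\<dots> \<longleftrightarrow> a * (M\<^sup>2 - 1) = M\<^sup>2 - \<sigma>\<^sub>3 * D * M\<^sup>2 \<and> b * (M\<^sup>2 - 1) = D * M - \<sigma>\<^sub>3 * M ^ 3"
    proof
      assume A: "b + D * M = - \<sigma>\<^sub>3 * a * M \<and> a + M * M = - \<sigma>\<^sub>3 * b * M"
      show "a * (M\<^sup>2 - 1) = M\<^sup>2 - \<sigma>\<^sub>3 * D * M\<^sup>2 \<and> b * (M\<^sup>2 - 1) = D * M - \<sigma>\<^sub>3 * M ^ 3"
        using assms(3) A by (auto; algebra)
    next
      assume A: "a * (M\<^sup>2 - 1) = M\<^sup>2 - \<sigma>\<^sub>3 * D * M\<^sup>2 \<and> b * (M\<^sup>2 - 1) = D * M - \<sigma>\<^sub>3 * M ^ 3"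
      have "(b + D * M + \<sigma>\<^sub>3 * a * M) * (M\<^sup>2 - 1) = 0"
           "(a + M * M + \<sigma>\<^sub>3 * b * M) * (M\<^sup>2 - 1) = 0"
        using assms(3) A by (auto; algebra)+
      then show "b + D * M = - \<sigma>\<^sub>3 * a * M \<and> a + M * M = - \<sigma>\<^sub>3 * b * M"
        unfolding mult_eq_0_iff using M by auto
    qed
    finally show ?thesis using M by (simp add: eq_divide_eq)
  qed
  show ?thesis by (auto simp: iff)
qed

definition zr_L1 :: "real \<Rightarrow> real \<Rightarrow> pdist \<Rightarrow> pdist" where
  "zr_L1 \<delta> \<alpha>\<^sub>1 \<psi> =
     (- \<i> * \<delta> * \<alpha>\<^sub>1) *\<^sub>C \<partial>\<^sub>x (pd_cnj \<psi> \<odot> \<partial>\<^sub>x \<psi> - \<psi> \<odot> \<partial>\<^sub>x (pd_cnj \<psi>))"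

definition zr_L2 :: "real \<Rightarrow> real \<Rightarrow> real \<Rightarrow> pdist \<Rightarrow> pdist" where
  "zr_L2 M \<delta> \<alpha>\<^sub>2 \<psi> =
     (- (\<i> / M) * \<delta> * \<alpha>\<^sub>2) *\<^sub>C (pd_cnj \<psi> \<odot> \<partial>\<^sub>x \<psi> - \<psi> \<odot> \<partial>\<^sub>x (pd_cnj \<psi>))"

definition pd_abs2 :: "pdist \<Rightarrow> pdist" where
  "pd_abs2 \<psi> = \<psi> \<odot> pd_cnj \<psi>"

text \<open>The arguments \<open>(\<psi>\<^sub>t, \<rho>\<^sub>t, \<phi>\<^sub>t)\<close> stand for the time derivatives.\<close>

definition zr_system ::
    "real \<Rightarrow> real \<Rightarrow> real \<Rightarrow> real \<Rightarrow> real \<Rightarrow> real \<Rightarrow> real \<Rightarrow> real \<Rightarrow> real \<Rightarrow>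
      pdist \<times> pdist \<times> pdist \<Rightarrow> pdist \<times> pdist \<times> pdist \<Rightarrow> bool" where
  "zr_system M \<epsilon> \<delta> D W \<sigma>\<^sub>2 \<sigma>\<^sub>3 \<alpha>\<^sub>1 \<alpha>\<^sub>2 = (\<lambda>(\<psi>, \<rho>, \<phi>) (\<psi>\<^sub>t, \<rho>\<^sub>t, \<phi>\<^sub>t).
     \<psi>\<^sub>t - \<sigma>\<^sub>3 *\<^sub>R \<partial>\<^sub>x \<psi> - (\<i> * \<epsilon> * \<delta>) *\<^sub>C \<partial>\<^sub>x (\<partial>\<^sub>x \<psi>)
       + (\<i> * \<epsilon>) *\<^sub>C ((\<sigma>\<^sub>2 *\<^sub>R pd_abs2 \<psi> + W *\<^sub>R (\<rho> + D *\<^sub>R \<partial>\<^sub>x \<phi>)) \<odot> \<psi>) = 0 \<and>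
     \<rho>\<^sub>t + \<partial>\<^sub>x (\<partial>\<^sub>x \<phi>) + D *\<^sub>R \<partial>\<^sub>x (pd_abs2 \<psi>) + \<epsilon> *\<^sub>R zr_L1 \<delta> \<alpha>\<^sub>1 \<psi> = 0 \<and>
     \<phi>\<^sub>t + (1 / M\<^sup>2) *\<^sub>R \<rho> + pd_abs2 \<psi> + \<epsilon> *\<^sub>R zr_L2 M \<delta> \<alpha>\<^sub>2 \<psi> = 0)"

text \<open>
  \<open>\<Psi>\<close> lies in \<open>C([0,T]; Z) \<inter> C\<^sup>1([0,T]; Z')\<close> with \<open>Z' = Zspace (s - 2)\<close>, solves the system and
  has initial value \<open>\<Psi>\<^sub>0\<close>; its values outside \<open>[0,T]\<close> are irrelevant.
\<close>

definition zr_solution ::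
    "real \<Rightarrow> real \<Rightarrow> real \<Rightarrow> real \<Rightarrow> real \<Rightarrow> real \<Rightarrow> real \<Rightarrow> real \<Rightarrow> real \<Rightarrow> real \<Rightarrow>
      real \<Rightarrow> pdist \<times> pdist \<times> pdist \<Rightarrow> (real \<Rightarrow> pdist \<times> pdist \<times> pdist) \<Rightarrow> bool" where
  "zr_solution s M \<epsilon> \<delta> D W \<sigma>\<^sub>2 \<sigma>\<^sub>3 \<alpha>\<^sub>1 \<alpha>\<^sub>2 T \<Psi>\<^sub>0 \<Psi> \<longleftrightarrow>
     \<Psi> \<in> C_Z s T \<and> \<Psi> \<in> C_Z (s - 2) T \<and>
     (\<exists>\<Psi>'. \<Psi>' \<in> C_Z (s - 2) T \<and> has_Z_derivative (s - 2) T \<Psi> \<Psi>' \<and>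
        (\<forall>t\<in>{0..T}. zr_system M \<epsilon> \<delta> D W \<sigma>\<^sub>2 \<sigma>\<^sub>3 \<alpha>\<^sub>1 \<alpha>\<^sub>2 (\<Psi> t) (\<Psi>' t))) \<and>
     \<Psi> 0 = \<Psi>\<^sub>0"

definition zr_unique_solution ::
    "real \<Rightarrow> real \<Rightarrow> real \<Rightarrow> real \<Rightarrow> real \<Rightarrow> real \<Rightarrow> real \<Rightarrow> real \<Rightarrow> real \<Rightarrow> real \<Rightarrow>
      real \<Rightarrow> pdist \<times> pdist \<times> pdist \<Rightarrow> (real \<Rightarrow> pdist \<times> pdist \<times> pdist) \<Rightarrow> bool" where
  "zr_unique_solution s M \<epsilon> \<delta> D W \<sigma>\<^sub>2 \<sigma>\<^sub>3 \<alpha>\<^sub>1 \<alpha>\<^sub>2 T \<Psi>\<^sub>0 \<Psi> \<longleftrightarrow>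
     zr_solution s M \<epsilon> \<delta> D W \<sigma>\<^sub>2 \<sigma>\<^sub>3 \<alpha>\<^sub>1 \<alpha>\<^sub>2 T \<Psi>\<^sub>0 \<Psi> \<and>
     (\<forall>\<Phi>. zr_solution s M \<epsilon> \<delta> D W \<sigma>\<^sub>2 \<sigma>\<^sub>3 \<alpha>\<^sub>1 \<alpha>\<^sub>2 T \<Psi>\<^sub>0 \<Phi> \<longrightarrow> (\<forall>t\<in>{0..T}. \<Phi> t = \<Psi> t))"

end

theory Submission
  imports Defs
begin

text \<open>
  The quadratic terms \<open>L\<^sub>1\<close> and \<open>L\<^sub>2\<close> lose two derivatives, but up to constants they are
  \<open>\<partial>\<^sub>t|\<psi>|\<^sup>2 - \<sigma>\<^sub>3 \<partial>\<^sub>x|\<psi>|\<^sup>2\<close> and its antiderivative, since a real potential does not contribute to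
  \<open>\<partial>\<^sub>t|\<psi>|\<^sup>2\<close>.  In the unknowns \<open>\<rho> - \<alpha>\<^sub>1|\<psi>|\<^sup>2\<close> and \<open>\<partial>\<^sub>x\<phi> - (\<alpha>\<^sub>2/M)|\<psi>|\<^sup>2\<close> the loss disappears, and the
  equations for \<open>\<alpha>\<^sub>1\<close>, \<open>\<alpha>\<^sub>2\<close> say exactly that the remaining multiples of \<open>\<partial>\<^sub>x|\<psi>|\<^sup>2\<close> cancel as well: the
  new unknowns solve a free wave equation.  What is left for \<open>\<psi>\<close> is a cubic Schroedinger equation with a
  potential in \<open>H\<^sup>s\<close>, an algebra; in the interaction picture the whole system becomes an ordinary
  differential equation in \<open>\<ell>\<^sup>2\<close> with a locally Lipschitz right-hand side.  Every solution of the
  original system has this form, so Picard iteration and Gronwall's inequality give existence,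
  uniqueness and continuous dependence.
\<close>

section \<open>The Hilbert space of square-summable sequences\<close>

text \<open>A solution has a time derivative only in the larger space, two derivatives below Z, so
  \<partial>t|\<psi>|^2 cannot be computed in H^s. It is computed one Fourier coefficient at a time,
  where a product of H^s and H^(s-2) makes sense for s > 3/2. This suffices because each coefficient
  of the new unknowns then satisfies an explicit scalar equation, and continuity of the right-hand
  side lifts the coefficientwise statement back to norms. The change of unknowns is inverted
  algebraically, so uniqueness covers the whole stated class and needs no energy estimate or
  regularisation. One obstacle remains: \<phi> enters the new unknowns only through
  \<partial>x\<phi>, which forgets the mean. The mean is therefore carried as a separate real
  coordinate with its own equation. All Sobolev orders are represented in the same \<ell>^2 by
  absorbing the weight into the sequence. Derivatives and embeddings between orders become bounded
  diagonal operators there, so a single Banach space serves Z and the larger space alike.\<close>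

definition in_ell2 :: "(int \<Rightarrow> complex) \<Rightarrow> bool" where
  "in_ell2 f \<longleftrightarrow> (\<exists>B. \<forall>F. finite F \<longrightarrow> L2_set (\<lambda>k. cmod (f k)) F \<le> B)"

lemma in_ell2I: "(\<And>F. finite F \<Longrightarrow> L2_set (\<lambda>k. cmod (f k)) F \<le> B) \<Longrightarrow> in_ell2 f"
  by (auto simp: in_ell2_def)

lemma in_ell2_0: "in_ell2 (\<lambda>_. 0)"
  by (rule in_ell2I[of _ 0]) (simp add: L2_set_def)

lemma in_ell2_dominated:
  assumes "in_ell2 g" "\<And>k. cmod (f k) \<le> C * cmod (g k)"
  shows "in_ell2 f"
proof -
  obtain B where B: "\<And>F. finite F \<Longrightarrow> L2_set (\<lambda>k. cmod (g k)) F \<le> B"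
    using assms(1) by (auto simp: in_ell2_def)
  show ?thesis
  proof (rule in_ell2I)
    fix F :: "int set" assume F: "finite F"
    have "L2_set (\<lambda>k. cmod (f k)) F \<le> L2_set (\<lambda>k. \<bar>C\<bar> * cmod (g k)) F"
    proof (rule L2_set_mono)
      fix k show "cmod (f k) \<le> \<bar>C\<bar> * cmod (g k)"
        by (rule order_trans[OF assms(2)]) (intro mult_right_mono, auto)
    qed simp
    also have "\<dots> = \<bar>C\<bar> * L2_set (\<lambda>k. cmod (g k)) F"
      by (simp add: L2_set_right_distrib)
    also have "\<dots> \<le> \<bar>C\<bar> * B"
      using B[OF F] by (intro mult_left_mono) auto
    finally show "L2_set (\<lambda>k. cmod (f k)) F \<le> \<bar>C\<bar> * B" .
  qed
qed

lemma in_ell2_add: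
  assumes "in_ell2 f" "in_ell2 g"
  shows "in_ell2 (\<lambda>k. f k + g k)"
proof -
  obtain A B where A: "\<And>F. finite F \<Longrightarrow> L2_set (\<lambda>k. cmod (f k)) F \<le> A"
    and B: "\<And>F. finite F \<Longrightarrow> L2_set (\<lambda>k. cmod (g k)) F \<le> B"
    using assms by (auto simp: in_ell2_def)
  show ?thesis
  proof (rule in_ell2I)
    fix F :: "int set" assume F: "finite F"
    have "L2_set (\<lambda>k. cmod (f k + g k)) F \<le> L2_set (\<lambda>k. cmod (f k) + cmod (g k)) F"
      by (rule L2_set_mono) (auto intro: norm_triangle_ineq)
    also have "\<dots> \<le> L2_set (\<lambda>k. cmod (f k)) F + L2_set (\<lambda>k. cmod (g k)) F"
      by (rule L2_set_triangle_ineq)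
    also have "\<dots> \<le> A + B" using A[OF F] B[OF F] by simp
    finally show "L2_set (\<lambda>k. cmod (f k + g k)) F \<le> A + B" .
  qed
qed

lemma in_ell2_mult: "in_ell2 f \<Longrightarrow> in_ell2 (\<lambda>k. c * f k)"
  by (erule in_ell2_dominated[of _ _ "cmod c"]) (simp add: norm_mult)

typedef ell2 = "{f :: int \<Rightarrow> complex. in_ell2 f}"
  morphisms comp_ell2 Abs_ell2
  using in_ell2_0 by blast

notation comp_ell2 (infixl \<open>$$\<close> 100)

setup_lifting type_definition_ell2

lemma in_ell2_comp [simp]: "in_ell2 (comp_ell2 a)"
  using comp_ell2[of a] by simp

lemma ell2_eqI: "(\<And>k. a $$ k = b $$ k) \<Longrightarrow> a = b"
  by (metis comp_ell2_inject ext)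

instantiation ell2 :: real_vector
begin

lift_definition zero_ell2 :: ell2 is "\<lambda>_. 0" by (rule in_ell2_0)
lift_definition plus_ell2 :: "ell2 \<Rightarrow> ell2 \<Rightarrow> ell2" is "\<lambda>f g k. f k + g k" by (rule in_ell2_add)
lift_definition uminus_ell2 :: "ell2 \<Rightarrow> ell2" is "\<lambda>f k. - f k"
  using in_ell2_mult[of _ "-1"] by simp
lift_definition minus_ell2 :: "ell2 \<Rightarrow> ell2 \<Rightarrow> ell2" is "\<lambda>f g k. f k - g k"
  using in_ell2_add in_ell2_mult[of _ "-1"] by fastforce
lift_definition scaleR_ell2 :: "real \<Rightarrow> ell2 \<Rightarrow> ell2" is "\<lambda>r f k. r *\<^sub>R f k"
  unfolding scaleR_conv_of_real by (rule in_ell2_mult)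

instance
  by standard (transfer; simp add: algebra_simps)+

end

lemmas comp_ell2_simps [simp] =
  zero_ell2.rep_eq plus_ell2.rep_eq uminus_ell2.rep_eq minus_ell2.rep_eq scaleR_ell2.rep_eq

instantiation ell2 :: real_normed_vector
begin

text \<open>A supremum over finite sections, so that Minkowski's inequality and homogeneity are
  inherited from \<open>L2_set\<close>; \<open>norm_ell2_infsum\<close> recovers the series.\<close>

definition norm_ell2 :: "ell2 \<Rightarrow> real" where
  "norm_ell2 a = (SUP F\<in>Collect finite. L2_set (\<lambda>k. cmod (a $$ k)) F)"

definition sgn_ell2 :: "ell2 \<Rightarrow> ell2" where "sgn_ell2 x = x /\<^sub>R norm x"
definition dist_ell2 :: "ell2 \<Rightarrow> ell2 \<Rightarrow> real" where "dist_ell2 x y = norm (x - y)"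
definition uniformity_ell2 :: "(ell2 \<times> ell2) filter" where
  "uniformity_ell2 = (INF e\<in>{0 <..}. principal {(x, y). dist x y < e})"
definition open_ell2 :: "ell2 set \<Rightarrow> bool" where
  "open_ell2 U = (\<forall>x\<in>U. eventually (\<lambda>(x', y). x' = x \<longrightarrow> y \<in> U) uniformity)"

lemma L2_set_le_norm_ell2: "finite F \<Longrightarrow> L2_set (\<lambda>k. cmod (a $$ k)) F \<le> norm a"
  unfolding norm_ell2_def
  by (rule cSUP_upper) (use in_ell2_comp[of a] in \<open>auto simp: in_ell2_def bdd_above_def\<close>)

lemma norm_ell2_leI: "(\<And>F. finite F \<Longrightarrow> L2_set (\<lambda>k. cmod (a $$ k)) F \<le> B) \<Longrightarrow> norm a \<le> B"
  unfolding norm_ell2_def by (rule cSUP_least) auto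

lemma norm_comp_ell2_le: "cmod (a $$ k) \<le> norm a"
  using L2_set_le_norm_ell2[of "{k}" a] by simp

instance
proof
  fix a b :: ell2 and r :: real
  show "dist a b = norm (a - b)" by (rule dist_ell2_def)
  show "sgn a = a /\<^sub>R norm a" by (rule sgn_ell2_def)
  show "uniformity = (INF e\<in>{0 <..}. principal {(x, y). dist x (y::ell2) < e})"
    by (rule uniformity_ell2_def)
  show "open U = (\<forall>x\<in>U. eventually (\<lambda>(x', y). x' = x \<longrightarrow> y \<in> U) uniformity)" for U :: "ell2 set"
    by (rule open_ell2_def)
  show "norm a = 0 \<longleftrightarrow> a = 0"
  proof
    assume "norm a = 0"
    then show "a = 0" using norm_comp_ell2_le[of a] by (intro ell2_eqI) simp
  next
    assume "a = 0"
    then show "norm a = 0"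
      by (auto simp: norm_ell2_def L2_set_def intro!: cSUP_const)
  qed
  show "norm (a + b) \<le> norm a + norm b"
  proof (rule norm_ell2_leI)
    fix F :: "int set" assume F: "finite F"
    have "L2_set (\<lambda>k. cmod ((a + b) $$ k)) F \<le> L2_set (\<lambda>k. cmod (a $$ k) + cmod (b $$ k)) F"
      by (rule L2_set_mono) (auto intro: norm_triangle_ineq)
    also have "\<dots> \<le> L2_set (\<lambda>k. cmod (a $$ k)) F + L2_set (\<lambda>k. cmod (b $$ k)) F"
      by (rule L2_set_triangle_ineq)
    also have "\<dots> \<le> norm a + norm b"
      using L2_set_le_norm_ell2[OF F] by (intro add_mono)
    finally show "L2_set (\<lambda>k. cmod ((a + b) $$ k)) F \<le> norm a + norm b" .
  qed
  \<comment> \<open>The inequality for all scalars yields equality, by applying it once more with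
    \<open>inverse r\<close>.\<close>
  have le: "norm (r *\<^sub>R a) \<le> \<bar>r\<bar> * norm a" for r and a :: ell2
  proof (rule norm_ell2_leI)
    fix F :: "int set" assume F: "finite F"
    have "L2_set (\<lambda>k. cmod ((r *\<^sub>R a) $$ k)) F = \<bar>r\<bar> * L2_set (\<lambda>k. cmod (a $$ k)) F"
      by (simp add: L2_set_right_distrib)
    then show "L2_set (\<lambda>k. cmod ((r *\<^sub>R a) $$ k)) F \<le> \<bar>r\<bar> * norm a"
      using L2_set_le_norm_ell2[OF F, of a] by (simp add: mult_left_mono)
  qed
  show "norm (r *\<^sub>R a) = \<bar>r\<bar> * norm a"
  proof (cases "r = 0")
    case True
    then show ?thesis using le[of 0 a] norm_comp_ell2_le[of "0 *\<^sub>R a" 0] by simp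
  next
    case False
    have "norm (inverse r *\<^sub>R (r *\<^sub>R a)) \<le> \<bar>inverse r\<bar> * norm (r *\<^sub>R a)" by (rule le)
    then have "\<bar>r\<bar> * norm a \<le> \<bar>r\<bar> * (\<bar>inverse r\<bar> * norm (r *\<^sub>R a))"
      using False by (intro mult_left_mono) auto
    then show ?thesis using le[of r a] False by (simp add: abs_inverse field_simps)
  qed
qed

end

lemma bounded_linear_comp_ell2: "bounded_linear (\<lambda>a. a $$ k)"
  by (rule bounded_linear_intro[of _ 1]) (auto simp: norm_comp_ell2_le)

lemmas tendsto_comp_ell2 [tendsto_intros] = bounded_linear.tendsto[OF bounded_linear_comp_ell2]
lemmas has_vector_derivative_comp_ell2 =
  bounded_linear.has_vector_derivative[OF bounded_linear_comp_ell2]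

instance ell2 :: banach
proof
  fix X :: "nat \<Rightarrow> ell2" assume X: "Cauchy X"
  have "Cauchy (\<lambda>n. X n $$ k)" for k
    using bounded_linear.Cauchy[OF bounded_linear_comp_ell2 X] .
  then have "\<exists>l. (\<lambda>n. X n $$ k) \<longlonglongrightarrow> l" for k
    by (simp add: Cauchy_convergent_iff convergent_def)
  then obtain l where l: "\<And>k. (\<lambda>n. X n $$ k) \<longlonglongrightarrow> l k" by metis
  \<comment> \<open>On a finite set the Cauchy bound passes to the componentwise limit, with a bound
    independent of the set. This gives both membership of the limit and convergence in norm.\<close>
  have ev: "L2_set (\<lambda>k. cmod (X n $$ k - l k)) F \<le> e"
    if N: "\<And>m. m \<ge> N \<Longrightarrow> norm (X n - X m) \<le> e" and F: "finite F" for n N e F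
  proof (rule tendsto_upperbound)
    show "(\<lambda>m. L2_set (\<lambda>k. cmod (X n $$ k - X m $$ k)) F)
        \<longlonglongrightarrow> L2_set (\<lambda>k. cmod (X n $$ k - l k)) F"
      unfolding L2_set_def by (intro tendsto_intros l)
    show "\<forall>\<^sub>F m in sequentially. L2_set (\<lambda>k. cmod (X n $$ k - X m $$ k)) F \<le> e"
      unfolding eventually_sequentially
    proof (intro exI[of _ N] allI impI)
      fix m assume "N \<le> m"
      then show "L2_set (\<lambda>k. cmod (X n $$ k - X m $$ k)) F \<le> e"
        using N[of m] L2_set_le_norm_ell2[OF F, of "X n - X m"] by simp
    qed
  qed simp
  obtain N1 where N1: "\<And>m n. m \<ge> N1 \<Longrightarrow> n \<ge> N1 \<Longrightarrow> norm (X m - X n) < 1"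
    using CauchyD[OF X zero_less_one] by blast
  have "in_ell2 (\<lambda>k. l k - X N1 $$ k)"
    using ev[of N1 N1 1] N1[of N1] by (intro in_ell2I[of _ 1]) (simp add: norm_minus_commute less_imp_le)
  then have "in_ell2 (\<lambda>k. (l k - X N1 $$ k) + X N1 $$ k)"
    by (rule in_ell2_add) simp
  then have "in_ell2 l" by simp
  then have L: "Abs_ell2 l $$ k = l k" for k
    by (simp add: Abs_ell2_inverse)
  have "X \<longlonglongrightarrow> Abs_ell2 l"
  proof (rule LIMSEQ_I)
    fix e :: real assume e: "0 < e"
    obtain N where N: "\<And>m n. m \<ge> N \<Longrightarrow> n \<ge> N \<Longrightarrow> norm (X m - X n) < e/2"
      using CauchyD[OF X half_gt_zero[OF e]] by blast
    have "norm (X n - Abs_ell2 l) \<le> e/2" if "n \<ge> N" for n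
      using ev[of N n "e/2"] N[OF that] by (intro norm_ell2_leI) (simp add: L less_imp_le)
    then show "\<exists>N. \<forall>n\<ge>N. norm (X n - Abs_ell2 l) < e"
      using e by (intro exI[of _ N]) (fastforce intro: le_less_trans)
  qed
  then show "convergent X" by (auto simp: convergent_def)
qed

lemma norm_ell2_dominated:
  assumes "\<And>k. cmod (a $$ k) \<le> C * cmod (b $$ k)" "0 \<le> C"
  shows "norm a \<le> C * norm b"
proof (rule norm_ell2_leI)
  fix F :: "int set" assume F: "finite F"
  have "L2_set (\<lambda>k. cmod (a $$ k)) F \<le> L2_set (\<lambda>k. C * cmod (b $$ k)) F"
    by (rule L2_set_mono) (use assms in auto)
  also have "\<dots> = C * L2_set (\<lambda>k. cmod (b $$ k)) F"
    using assms by (simp add: L2_set_right_distrib)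
  finally show "L2_set (\<lambda>k. cmod (a $$ k)) F \<le> C * norm b"
    using L2_set_le_norm_ell2[OF F, of b] assms(2) by (meson mult_left_mono order_trans)
qed

lemma in_ell2_iff_summable: "in_ell2 f \<longleftrightarrow> (\<lambda>k. (cmod (f k))\<^sup>2) summable_on UNIV"
proof
  assume "in_ell2 f"
  then obtain B where B: "\<And>F. finite F \<Longrightarrow> L2_set (\<lambda>k. cmod (f k)) F \<le> B"
    by (auto simp: in_ell2_def)
  have "(\<Sum>k\<in>F. (cmod (f k))\<^sup>2) \<le> B\<^sup>2" if "finite F" for F
    using B[OF that] unfolding L2_set_def by (rule sqrt_le_D)
  then show "(\<lambda>k. (cmod (f k))\<^sup>2) summable_on UNIV"
    by (intro nonneg_bdd_above_summable_on) (auto simp: bdd_above_def)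
next
  assume *: "(\<lambda>k. (cmod (f k))\<^sup>2) summable_on UNIV"
  show "in_ell2 f"
  proof (rule in_ell2I)
    fix F :: "int set" assume "finite F"
    then show "L2_set (\<lambda>k. cmod (f k)) F \<le> sqrt (\<Sum>\<^sub>\<infinity>k. (cmod (f k))\<^sup>2)"
      unfolding L2_set_def by (intro real_sqrt_le_mono finite_sum_le_infsum *) auto
  qed
qed

lemma sum_le_norm_ell2: "finite F \<Longrightarrow> (\<Sum>k\<in>F. (cmod (a $$ k))\<^sup>2) \<le> (norm a)\<^sup>2"
  using sqrt_le_D[OF L2_set_le_norm_ell2[of F a, unfolded L2_set_def]] .

lemma norm_ell2_infsum: "norm a = sqrt (\<Sum>\<^sub>\<infinity>k. (cmod (a $$ k))\<^sup>2)"
proof (rule antisym)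
  have *: "(\<lambda>k. (cmod (a $$ k))\<^sup>2) summable_on UNIV"
    using in_ell2_comp[of a] unfolding in_ell2_iff_summable by simp
  show "norm a \<le> sqrt (\<Sum>\<^sub>\<infinity>k. (cmod (a $$ k))\<^sup>2)"
    by (rule norm_ell2_leI, unfold L2_set_def) (intro real_sqrt_le_mono finite_sum_le_infsum *, auto)
  have "(\<Sum>\<^sub>\<infinity>k. (cmod (a $$ k))\<^sup>2) \<le> (norm a)\<^sup>2"
  proof (rule infsum_le_finite_sums[OF *])
    fix F :: "int set" assume "finite F"
    then show "(\<Sum>k\<in>F. (cmod (a $$ k))\<^sup>2) \<le> (norm a)\<^sup>2"
      by (rule sum_le_norm_ell2)
  qed
  then show "sqrt (\<Sum>\<^sub>\<infinity>k. (cmod (a $$ k))\<^sup>2) \<le> norm a"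
    by (intro real_le_lsqrt) auto
qed

text \<open>Outside a large finite set the squared mass of \<open>a\<close> is at most
  \<open>e\<^sup>2\<close>, and anything dominated by \<open>a\<close> and supported there inherits
  this bound.\<close>

lemma ell2_small_tail:
  assumes "e > 0"
  obtains F where "finite F" "\<And>b. (\<And>k. k \<in> F \<Longrightarrow> b $$ k = 0) \<Longrightarrow>
    (\<And>k. cmod (b $$ k) \<le> cmod (a $$ k)) \<Longrightarrow> norm b \<le> e"
proof -
  have *: "(\<lambda>k. (cmod (a $$ k))\<^sup>2) summable_on UNIV"
    using in_ell2_comp[of a] unfolding in_ell2_iff_summable by simp
  obtain F where F: "finite F" "dist (\<Sum>k\<in>F. (cmod (a $$ k))\<^sup>2) (\<Sum>\<^sub>\<infinity>k. (cmod (a $$ k))\<^sup>2) \<le> e\<^sup>2"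
    using infsum_finite_approximation[OF *, of "e\<^sup>2"] assms by auto
  have "norm b \<le> e" if b: "\<And>k. k \<in> F \<Longrightarrow> b $$ k = 0" "\<And>k. cmod (b $$ k) \<le> cmod (a $$ k)" for b
  proof (rule norm_ell2_leI)
    fix G :: "int set" assume G: "finite G"
    have "(\<Sum>k\<in>G. (cmod (b $$ k))\<^sup>2) = (\<Sum>k\<in>G - F. (cmod (b $$ k))\<^sup>2)"
      using G b(1) by (intro sum.mono_neutral_right) auto
    also have "\<dots> \<le> (\<Sum>k\<in>G - F. (cmod (a $$ k))\<^sup>2)"
      using b(2) by (intro sum_mono power_mono) auto
    also have "\<dots> = (\<Sum>k\<in>G \<union> F. (cmod (a $$ k))\<^sup>2) - (\<Sum>k\<in>F. (cmod (a $$ k))\<^sup>2)"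
      using G F(1) sum.union_disjoint[of "G - F" F "\<lambda>k. (cmod (a $$ k))\<^sup>2"] by fastforce
    also have "\<dots> \<le> (\<Sum>\<^sub>\<infinity>k. (cmod (a $$ k))\<^sup>2) - (\<Sum>k\<in>F. (cmod (a $$ k))\<^sup>2)"
      using G F(1) by (intro diff_right_mono finite_sum_le_infsum *) auto
    also have "\<dots> \<le> e\<^sup>2" using F(2) by (simp add: dist_real_def)
    finally show "L2_set (\<lambda>k. cmod (b $$ k)) G \<le> e"
      unfolding L2_set_def using assms by (intro real_le_lsqrt sum_nonneg) auto
  qed
  then show ?thesis using that F(1) by blast
qed

section \<open>Diagonal operators (Fourier multipliers)\<close>

definition mk_ell2 :: "(int \<Rightarrow> complex) \<Rightarrow> ell2" where
  "mk_ell2 f = (if in_ell2 f then Abs_ell2 f else 0)"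

lemma comp_mk_ell2 [simp]: "in_ell2 f \<Longrightarrow> mk_ell2 f $$ k = f k"
  by (simp add: mk_ell2_def Abs_ell2_inverse)

text \<open>Meaningful for bounded symbols only: otherwise the product may leave \<ell>^2 and
  \<open>mk_ell2\<close> returns its default 0. Hence the bound assumed in
  \<open>comp_diag\<close>.\<close>

definition diag :: "(int \<Rightarrow> complex) \<Rightarrow> ell2 \<Rightarrow> ell2" where
  "diag m a = mk_ell2 (\<lambda>k. m k * a $$ k)"

lemma comp_diag:
  assumes "\<And>k. cmod (m k) \<le> C"
  shows "diag m a $$ k = m k * a $$ k"
proof -
  have "in_ell2 (\<lambda>k. m k * a $$ k)"
    by (rule in_ell2_dominated[of "comp_ell2 a" _ C])
      (use assms in \<open>auto simp: norm_mult intro: mult_right_mono\<close>)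
  then show ?thesis by (simp add: diag_def)
qed

lemma norm_diag_le:
  assumes "\<And>k. cmod (m k) \<le> C"
  shows "norm (diag m a) \<le> C * norm a"
proof -
  have "0 \<le> C" using assms[of 0] norm_ge_zero order_trans by blast
  then show ?thesis
    by (intro norm_ell2_dominated)
      (auto simp: comp_diag[OF assms] norm_mult intro!: mult_right_mono assms)
qed

lemma bounded_linear_diag:
  assumes "\<And>k. cmod (m k) \<le> C"
  shows "bounded_linear (diag m)"
  by (rule bounded_linear_intro[of _ C])
    (auto intro!: ell2_eqI simp: comp_diag[OF assms] algebra_simps norm_diag_le[OF assms]
      mult.commute[of _ C])

text \<open>Only strong continuity can be expected: the propagators used later have unbounded
  frequencies and are not continuous in operator norm. For fixed \<open>a\<close> the tail is small
  uniformly in time, and the finitely many remaining modes are continuous.\<close>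

lemma continuous_on_diag:
  assumes "\<And>t k. t \<in> S \<Longrightarrow> cmod (m t k) \<le> C" "\<And>k. continuous_on S (\<lambda>t::real. m t k)"
  shows "continuous_on S (\<lambda>t. diag (m t) a)"
  unfolding continuous_on_def
proof
  fix t assume t: "t \<in> S"
  have C: "0 \<le> C" using assms(1)[OF t, of 0] norm_ge_zero order_trans by blast
  show "((\<lambda>t. diag (m t) a) \<longlongrightarrow> diag (m t) a) (at t within S)"
  proof (rule tendstoI)
    fix e :: real assume e: "e > 0"
    \<comment> \<open>The tail will contribute at most \<open>2 * C * e / (4 * (C + 1))\<close>,
      which is below \<open>e / 2\<close> also when \<open>C = 0\<close>.\<close>
    then have "e / (4 * (C + 1)) > 0" using C by simp
    then obtain F where F: "finite F" and tail: "\<And>b. (\<And>k. k \<in> F \<Longrightarrow> b $$ k = 0) \<Longrightarrow>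
        (\<And>k. cmod (b $$ k) \<le> cmod (a $$ k)) \<Longrightarrow> norm b \<le> e / (4 * (C + 1))"
      by (rule ell2_small_tail[where a=a]) blast
    define b where "b = diag (\<lambda>k. if k \<in> F then 0 else 1) a"
    have b_comp: "b $$ k = (if k \<in> F then 0 else a $$ k)" for k
      unfolding b_def by (subst comp_diag[where C=1]) auto
    have nb: "norm b \<le> e / (4 * (C + 1))"
      by (rule tail) (auto simp: b_comp)
    \<comment> \<open>The modes in \<open>F\<close> keep the difference of the symbols; on the other
      modes it is estimated crudely by \<open>2 * C\<close>.\<close>
    have bound: "norm (diag (m \<tau>) a - diag (m t) a)
        \<le> (\<Sum>k\<in>F. cmod (m \<tau> k - m t k) * cmod (a $$ k)) + 2 * C * norm b" if \<tau>: "\<tau> \<in> S" for \<tau>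
    proof (rule norm_ell2_leI)
      fix G :: "int set" assume G: "finite G"
      let ?x = "\<lambda>k. cmod ((diag (m \<tau>) a - diag (m t) a) $$ k)"
      let ?g = "\<lambda>k. if k \<in> F then cmod (m \<tau> k - m t k) * cmod (a $$ k) else 0"
      have "L2_set ?x G \<le> L2_set (\<lambda>k. ?g k + 2 * C * cmod (b $$ k)) G"
      proof (rule L2_set_mono)
        fix k
        have x: "?x k = cmod (m \<tau> k - m t k) * cmod (a $$ k)"
          by (simp add: comp_diag[OF assms(1)[OF \<tau>]] comp_diag[OF assms(1)[OF t]]
              norm_mult[symmetric] left_diff_distrib)
        have "cmod (m \<tau> k - m t k) \<le> 2 * C"
          using norm_triangle_ineq4[of "m \<tau> k" "m t k"] assms(1)[OF \<tau>, of k] assms(1)[OF t, of k]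
          by linarith
        then show "?x k \<le> ?g k + 2 * C * cmod (b $$ k)"
          unfolding x using C by (auto simp: b_comp intro: mult_right_mono)
      qed auto
      also have "\<dots> \<le> L2_set ?g G + L2_set (\<lambda>k. 2 * C * cmod (b $$ k)) G"
        by (rule L2_set_triangle_ineq)
      also have "L2_set ?g G \<le> sum ?g G" by (rule L2_set_le_sum) auto
      also have "sum ?g G = (\<Sum>k\<in>G \<inter> F. cmod (m \<tau> k - m t k) * cmod (a $$ k))"
        using G by (simp add: sum.inter_restrict)
      also have "\<dots> \<le> (\<Sum>k\<in>F. cmod (m \<tau> k - m t k) * cmod (a $$ k))"
        using F by (intro sum_mono2) auto
      also have "L2_set (\<lambda>k. 2 * C * cmod (b $$ k)) G = 2 * C * L2_set (\<lambda>k. cmod (b $$ k)) G"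
        using C by (simp add: L2_set_right_distrib)
      also have "\<dots> \<le> 2 * C * norm b"
        using L2_set_le_norm_ell2[OF G] C by (intro mult_left_mono) auto
      finally show "L2_set ?x G
        \<le> (\<Sum>k\<in>F. cmod (m \<tau> k - m t k) * cmod (a $$ k)) + 2 * C * norm b" by simp
    qed
    have "2 * C * norm b \<le> 2 * C * (e / (4 * (C + 1)))"
      using nb C by (intro mult_left_mono) auto
    also have "\<dots> \<le> e / 2"
      using C e by (simp add: field_simps)
    finally have b2: "2 * C * norm b \<le> e / 2" .
    have "((\<lambda>\<tau>. \<Sum>k\<in>F. cmod (m \<tau> k - m t k) * cmod (a $$ k))
        \<longlongrightarrow> (\<Sum>k\<in>F. cmod (m t k - m t k) * cmod (a $$ k))) (at t within S)"
      using assms(2) t by (intro tendsto_intros) (auto simp: continuous_on_def)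
    then have "\<forall>\<^sub>F \<tau> in at t within S. (\<Sum>k\<in>F. cmod (m \<tau> k - m t k) * cmod (a $$ k)) < e / 2"
      using e by (intro order_tendstoD(2)) auto
    moreover have "\<forall>\<^sub>F \<tau> in at t within S. \<tau> \<in> S"
      by (simp add: eventually_at_filter)
    ultimately show "\<forall>\<^sub>F \<tau> in at t within S. dist (diag (m \<tau>) a) (diag (m t) a) < e"
    proof eventually_elim
      case (elim \<tau>)
      then show ?case using bound[of \<tau>] b2 by (simp add: dist_norm)
    qed
  qed
qed

text \<open>
  By the fundamental theorem of calculus, \<open>f\<close> has the same components as the primitive of \<open>g\<close>.
\<close>

lemma ell2_has_vector_derivative_componentwise:
  assumes g: "continuous_on {0..T} g"
    and f: "\<And>t k. t \<in> {0..T} \<Longrightarrow>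
      ((\<lambda>t. f t $$ k) has_vector_derivative g t $$ k) (at t within {0..T})"
    and t: "t \<in> {0..T}"
  shows "(f has_vector_derivative g t) (at t within {0..T})"
proof -
  let ?h = "\<lambda>t. f 0 + integral {0..t} g"
  have eq: "f t = ?h t" if t: "t \<in> {0..T}" for t
  proof (rule ell2_eqI)
    fix k
    have int: "g integrable_on {0..t}"
      using g t by (intro integrable_continuous_real) (auto intro: continuous_on_subset)
    have "((\<lambda>\<tau>. g \<tau> $$ k) has_integral f t $$ k - f 0 $$ k) {0..t}"
      using t by (intro fundamental_theorem_of_calculus)
        (auto intro: has_vector_derivative_within_subset[OF f])
    moreover have "((\<lambda>\<tau>. g \<tau> $$ k) has_integral integral {0..t} g $$ k) {0..t}"
      using has_integral_linear[OF integrable_integral[OF int] bounded_linear_comp_ell2]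
      by (simp add: o_def)
    ultimately have "f t $$ k - f 0 $$ k = integral {0..t} g $$ k"
      by (rule has_integral_unique)
    then show "f t $$ k = ?h t $$ k"
      by (simp add: algebra_simps)
  qed
  have "(?h has_vector_derivative 0 + g t) (at t within {0..T})"
    by (intro derivative_intros integral_has_vector_derivative g t)
  then have d: "(?h has_vector_derivative g t) (at t within {0..T})" by simp
  show ?thesis
    by (rule has_vector_derivative_transform[OF t _ d]) (rule eq)
qed

section \<open>Ordinary differential equations in Banach spaces\<close>

text \<open>The class of vector fields for the ODE theory. Lipschitz constants and bounds on balls
  are uniform in time, while continuity in time is asked only for each fixed point: this is what
  strongly continuous propagators provide. The closure rules below allow the property to be read off
  from the syntax of a field.\<close>

definition cont_lip ::
    "(real \<Rightarrow> 'a::real_normed_vector \<Rightarrow> 'b::real_normed_vector) \<Rightarrow> bool" where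
  "cont_lip f \<longleftrightarrow>
     (\<forall>R. \<exists>L\<ge>0. \<forall>t x y. norm x \<le> R \<longrightarrow> norm y \<le> R \<longrightarrow> norm (f t x - f t y) \<le> L * norm (x - y)) \<and>
     (\<forall>R. \<exists>B\<ge>0. \<forall>t x. norm x \<le> R \<longrightarrow> norm (f t x) \<le> B) \<and>
     (\<forall>x. continuous_on UNIV (\<lambda>t. f t x))"

lemma cont_lipI:
  assumes "\<And>R. \<exists>L\<ge>0. \<forall>t x y. norm x \<le> R \<longrightarrow> norm y \<le> R \<longrightarrow>
      norm (f t x - f t y) \<le> L * norm (x - y)"
    and "\<And>R. \<exists>B\<ge>0. \<forall>t x. norm x \<le> R \<longrightarrow> norm (f t x) \<le> B"
    and "\<And>x. continuous_on UNIV (\<lambda>t. f t x)"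
  shows "cont_lip f"
  using assms unfolding cont_lip_def by blast

lemma cont_lip_lipschitz:
  assumes "cont_lip f"
  obtains L where "L \<ge> 0" "\<And>t x y. norm x \<le> R \<Longrightarrow> norm y \<le> R \<Longrightarrow>
    norm (f t x - f t y) \<le> L * norm (x - y)"
  using assms unfolding cont_lip_def by meson

lemma cont_lip_bound:
  assumes "cont_lip f"
  obtains B where "B \<ge> 0" "\<And>t x. norm x \<le> R \<Longrightarrow> norm (f t x) \<le> B"
  using assms unfolding cont_lip_def by meson

lemma cont_lip_continuous: "cont_lip f \<Longrightarrow> continuous_on S (\<lambda>t. f t x)"
  unfolding cont_lip_def using continuous_on_subset by blast

lemma cont_lip_id: "cont_lip (\<lambda>t x. x)"
proof (rule cont_lipI)
  fix R :: real
  show "\<exists>B\<ge>0. \<forall>t x. norm x \<le> R \<longrightarrow> norm x \<le> B"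
    by (intro exI[of _ "max 0 R"]) auto
qed (auto intro: exI[of _ 1])

text \<open>The Lipschitz bound uniform in time turns separate continuity into continuity along a
  moving point: \<open>f \<tau> (y \<tau>)\<close> is compared with
  \<open>f \<tau> (y t)\<close>.\<close>

lemma cont_lip_curve:
  fixes f :: "real \<Rightarrow> 'a::real_normed_vector \<Rightarrow> 'b::real_normed_vector"
  assumes "cont_lip f" "continuous_on S y"
  shows "continuous_on S (\<lambda>t. f t (y t))"
  unfolding continuous_on_def
proof
  fix t assume t: "t \<in> S"
  define R where "R = norm (y t) + 1"
  obtain L where L: "L \<ge> 0" "\<And>t x z. norm x \<le> R \<Longrightarrow> norm z \<le> R \<Longrightarrow>
    norm (f t x - f t z) \<le> L * norm (x - z)" using cont_lip_lipschitz[OF assms(1)] by blast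
  have y: "(y \<longlongrightarrow> y t) (at t within S)"
    using assms(2) t by (simp add: continuous_on_def)
  have ev: "\<forall>\<^sub>F \<tau> in at t within S. norm (y \<tau>) < R"
    using tendsto_norm[OF y] by (rule order_tendstoD) (simp add: R_def)
  have "((\<lambda>\<tau>. f \<tau> (y \<tau>) - f \<tau> (y t)) \<longlongrightarrow> 0) (at t within S)"
  proof (rule Lim_null_comparison)
    show "\<forall>\<^sub>F \<tau> in at t within S. norm (f \<tau> (y \<tau>) - f \<tau> (y t)) \<le> L * norm (y \<tau> - y t)"
      using ev by eventually_elim (rule L(2), auto simp: R_def)
    have "((\<lambda>\<tau>. L * norm (y \<tau> - y t)) \<longlongrightarrow> L * norm (y t - y t)) (at t within S)"
      by (intro tendsto_intros y)
    then show "((\<lambda>\<tau>. L * norm (y \<tau> - y t)) \<longlongrightarrow> 0) (at t within S)" by simp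
  qed
  moreover have "((\<lambda>\<tau>. f \<tau> (y t)) \<longlongrightarrow> f t (y t)) (at t within S)"
    using cont_lip_continuous[OF assms(1), of S "y t"] t by (simp add: continuous_on_def)
  ultimately have "((\<lambda>\<tau>. (f \<tau> (y \<tau>) - f \<tau> (y t)) + f \<tau> (y t)) \<longlongrightarrow> 0 + f t (y t)) (at t within S)"
    by (rule tendsto_add)
  then show "((\<lambda>t. f t (y t)) \<longlongrightarrow> f t (y t)) (at t within S)" by simp
qed

lemma cont_lip_compose:
  fixes f :: "real \<Rightarrow> 'a::real_normed_vector \<Rightarrow> 'b::real_normed_vector"
    and g :: "real \<Rightarrow> 'b \<Rightarrow> 'c::real_normed_vector"
  assumes g: "cont_lip g" and f: "cont_lip f"
  shows "cont_lip (\<lambda>t x. g t (f t x))"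
proof (rule cont_lipI)
  fix R :: real
  obtain L where L: "L \<ge> 0" "\<And>t x y. norm x \<le> R \<Longrightarrow> norm y \<le> R \<Longrightarrow>
    norm (f t x - f t y) \<le> L * norm (x - y)" using cont_lip_lipschitz[OF f] by blast
  obtain B where B: "\<And>t x. norm x \<le> R \<Longrightarrow> norm (f t x) \<le> B"
    using cont_lip_bound[OF f] by blast
  obtain L' where L': "L' \<ge> 0" "\<And>t x y. norm x \<le> B \<Longrightarrow> norm y \<le> B \<Longrightarrow>
    norm (g t x - g t y) \<le> L' * norm (x - y)" using cont_lip_lipschitz[OF g] by blast
  obtain B' where B': "B' \<ge> 0" "\<And>t x. norm x \<le> B \<Longrightarrow> norm (g t x) \<le> B'"
    using cont_lip_bound[OF g] by blast
  have "norm (g t (f t x) - g t (f t y)) \<le> L' * (L * norm (x - y))"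
    if "norm x \<le> R" "norm y \<le> R" for t x y
    using L'(2)[OF B[OF that(1)] B[OF that(2)], of t] mult_left_mono[OF L(2)[OF that] L'(1), of t]
    by (rule order_trans)
  then show "\<exists>L\<ge>0. \<forall>t x y. norm x \<le> R \<longrightarrow> norm y \<le> R \<longrightarrow>
      norm (g t (f t x) - g t (f t y)) \<le> L * norm (x - y)"
    using L(1) L'(1) by (intro exI[of _ "L' * L"]) (auto simp: mult.assoc)
  show "\<exists>B\<ge>0. \<forall>t x. norm x \<le> R \<longrightarrow> norm (g t (f t x)) \<le> B"
    using B B' by blast
  show "continuous_on UNIV (\<lambda>t. g t (f t x))" for x :: 'a
    by (rule cont_lip_curve[OF g cont_lip_continuous[OF f]])
qed

lemma cont_lip_linear:
  fixes f :: "real \<Rightarrow> 'a::real_normed_vector \<Rightarrow> 'b::real_normed_vector"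
  assumes "bounded_linear h" "cont_lip f"
  shows "cont_lip (\<lambda>t x. h (f t x))"
proof -
  interpret bounded_linear h by fact
  obtain K where K: "K \<ge> 0" "\<And>x. norm (h x) \<le> norm x * K" using nonneg_bounded by blast
  have "cont_lip (\<lambda>t. h)"
  proof (rule cont_lipI)
    fix R :: real
    show "\<exists>L\<ge>0. \<forall>t::real. \<forall>x y. norm x \<le> R \<longrightarrow> norm y \<le> R \<longrightarrow> norm (h x - h y) \<le> L * norm (x - y)"
      using K(1) K(2)[of "_ - _"] by (intro exI[of _ K]) (simp add: diff mult.commute)
    have "norm (h x) \<le> max 0 R * K" if "norm x \<le> R" for x
      by (rule order_trans[OF K(2)]) (use that K(1) in \<open>auto intro: mult_right_mono\<close>)
    then show "\<exists>B\<ge>0. \<forall>t::real. \<forall>x. norm x \<le> R \<longrightarrow> norm (h x) \<le> B"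
      using K(1) by (intro exI[of _ "max 0 R * K"]) auto
  qed simp
  from cont_lip_compose[OF this assms(2)] show ?thesis .
qed

lemma cont_lip_Pair:
  fixes f :: "real \<Rightarrow> 'a::real_normed_vector \<Rightarrow> 'b::real_normed_vector"
    and g :: "real \<Rightarrow> 'a \<Rightarrow> 'c::real_normed_vector"
  assumes "cont_lip f" "cont_lip g"
  shows "cont_lip (\<lambda>t x. (f t x, g t x))"
proof (rule cont_lipI)
  fix R :: real
  obtain L where L: "L \<ge> 0" "\<And>t x y. norm x \<le> R \<Longrightarrow> norm y \<le> R \<Longrightarrow>
    norm (f t x - f t y) \<le> L * norm (x - y)" using cont_lip_lipschitz[OF assms(1)] by blast
  obtain L' where L': "L' \<ge> 0" "\<And>t x y. norm x \<le> R \<Longrightarrow> norm y \<le> R \<Longrightarrow>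
    norm (g t x - g t y) \<le> L' * norm (x - y)" using cont_lip_lipschitz[OF assms(2)] by blast
  obtain B where B: "B \<ge> 0" "\<And>t x. norm x \<le> R \<Longrightarrow> norm (f t x) \<le> B"
    using cont_lip_bound[OF assms(1)] by blast
  obtain B' where B': "B' \<ge> 0" "\<And>t x. norm x \<le> R \<Longrightarrow> norm (g t x) \<le> B'"
    using cont_lip_bound[OF assms(2)] by blast
  have "norm ((f t x, g t x) - (f t y, g t y)) \<le> (L + L') * norm (x - y)"
    if "norm x \<le> R" "norm y \<le> R" for t x y
    using norm_Pair_le[of "f t x - f t y" "g t x - g t y"] L(2)[OF that, of t] L'(2)[OF that, of t]
    by (simp add: distrib_right)
  then show "\<exists>L\<ge>0. \<forall>t x y. norm x \<le> R \<longrightarrow> norm y \<le> R \<longrightarrow>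
      norm ((f t x, g t x) - (f t y, g t y)) \<le> L * norm (x - y)"
    using L(1) L'(1) by (intro exI[of _ "L + L'"]) auto
  have "norm (f t x, g t x) \<le> B + B'" if "norm x \<le> R" for t x
    using norm_Pair_le[of "f t x" "g t x"] B(2)[OF that, of t] B'(2)[OF that, of t] by linarith
  then show "\<exists>B\<ge>0. \<forall>t x. norm x \<le> R \<longrightarrow> norm (f t x, g t x) \<le> B"
    using B(1) B'(1) by (intro exI[of _ "B + B'"]) auto
  show "continuous_on UNIV (\<lambda>t. (f t x, g t x))" for x :: 'a
    by (intro continuous_on_Pair cont_lip_continuous assms)
qed

lemma cont_lip_add:
  fixes f g :: "real \<Rightarrow> 'a::real_normed_vector \<Rightarrow> 'b::real_normed_vector"
  assumes "cont_lip f" "cont_lip g"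
  shows "cont_lip (\<lambda>t x. f t x + g t x)"
  using cont_lip_linear[OF bounded_linear_add[OF bounded_linear_fst bounded_linear_snd]
      cont_lip_Pair[OF assms]] by simp

lemma cont_lip_const: "cont_lip (\<lambda>t x. c)"
  by (rule cont_lipI) (auto intro: exI[of _ 0] exI[of _ "norm c"])

lemma cont_lip_bilinear:
  fixes f :: "real \<Rightarrow> 'a::real_normed_vector \<Rightarrow> 'b::real_normed_vector"
    and g :: "real \<Rightarrow> 'a \<Rightarrow> 'c::real_normed_vector"
  assumes "bounded_bilinear h" "cont_lip f" "cont_lip g"
  shows "cont_lip (\<lambda>t x. h (f t x) (g t x))"
proof -
  interpret bounded_bilinear h by fact
  obtain K where K: "K \<ge> 0" "\<And>u v. norm (h u v) \<le> norm u * norm v * K"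
    using nonneg_bounded by blast
  have "cont_lip (\<lambda>t p. h (fst p) (snd p))"
  proof (rule cont_lipI)
    fix R :: real
    \<comment> \<open>Keeps the constants nonnegative when \<open>R < 0\<close> and the ball is
      empty.\<close>
    let ?R = "max 0 R"
    have n: "norm (fst p) \<le> norm p" "norm (snd p) \<le> norm p" for p :: "'b \<times> 'c"
      using norm_fst_le[of "fst p" "snd p"] norm_snd_le[of "snd p" "fst p"] by auto
    \<comment> \<open>Changing one argument at a time produces two terms, each at most
      \<open>?R * K\<close> times the distance.\<close>
    have "norm (h (fst p) (snd p) - h (fst q) (snd q)) \<le> 2 * ?R * K * norm (p - q)"
      if "norm p \<le> R" "norm q \<le> R" for p q
    proof -
      have R: "norm (snd p) \<le> ?R" "norm (fst q) \<le> ?R"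
        using n(2)[of p] n(1)[of q] that by auto
      have "norm (h (fst p) (snd p) - h (fst q) (snd q))
          = norm (h (fst (p - q)) (snd p) + h (fst q) (snd (p - q)))"
        by (simp add: diff_left diff_right)
      also have "\<dots> \<le> norm (fst (p - q)) * norm (snd p) * K + norm (fst q) * norm (snd (p - q)) * K"
        by (intro norm_triangle_le add_mono K)
      also have "\<dots> \<le> norm (p - q) * ?R * K + ?R * norm (p - q) * K"
        using K(1) n[of "p - q"] R by (intro add_mono mult_mono) auto
      finally show ?thesis by (simp add: mult_ac)
    qed
    then show "\<exists>L\<ge>0. \<forall>t::real. \<forall>p q. norm p \<le> R \<longrightarrow> norm q \<le> R \<longrightarrow>
        norm (h (fst p) (snd p) - h (fst q) (snd q)) \<le> L * norm (p - q)"
      using K(1) by (intro exI[of _ "2 * ?R * K"]) auto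
    have "norm (h (fst p) (snd p)) \<le> ?R * ?R * K" if "norm p \<le> R" for p
      by (rule order_trans[OF K(2)]) (use that n[of p] K(1) in \<open>intro mult_mono; auto\<close>)
    then show "\<exists>B\<ge>0. \<forall>t::real. \<forall>p. norm p \<le> R \<longrightarrow> norm (h (fst p) (snd p)) \<le> B"
      using K(1) by (intro exI[of _ "?R * ?R * K"]) auto
  qed simp
  from cont_lip_compose[OF this cont_lip_Pair[OF assms(2,3)]] show ?thesis by simp
qed

lemma cont_lip_diag:
  fixes f :: "real \<Rightarrow> 'a::real_normed_vector \<Rightarrow> ell2"
  assumes "\<And>t k. cmod (m t k) \<le> C" "\<And>k. continuous_on UNIV (\<lambda>t::real. m t k)" "cont_lip f"
  shows "cont_lip (\<lambda>t x. diag (m t) (f t x))"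
proof (rule cont_lip_compose[OF _ assms(3)], rule cont_lipI)
  have C: "0 \<le> C" using assms(1)[of 0 0] norm_ge_zero order_trans by blast
  fix R :: real
  have "norm (diag (m t) x - diag (m t) y) \<le> C * norm (x - y)" for t x y
    using norm_diag_le[of "m t" C "x - y", OF assms(1)]
    by (simp add: linear_diff[OF bounded_linear.linear[OF bounded_linear_diag], OF assms(1)])
  then show "\<exists>L\<ge>0. \<forall>t x y. norm x \<le> R \<longrightarrow> norm y \<le> R \<longrightarrow>
      norm (diag (m t) x - diag (m t) y) \<le> L * norm (x - y)"
    using C by blast
  have "norm (diag (m t) x) \<le> C * max 0 R" if "norm x \<le> R" for t x
    by (rule order_trans[OF norm_diag_le[OF assms(1)]]) (use that C in \<open>auto intro: mult_left_mono\<close>)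
  then show "\<exists>B\<ge>0. \<forall>t x. norm x \<le> R \<longrightarrow> norm (diag (m t) x) \<le> B"
    using C by (intro exI[of _ "C * max 0 R"]) auto
  show "continuous_on UNIV (\<lambda>t. diag (m t) x)" for x
    using assms by (intro continuous_on_diag) auto
qed

section \<open>Picard existence, Gronwall's inequality and continuous dependence\<close>

definition ode_solution ::
    "(real \<Rightarrow> 'a::real_normed_vector \<Rightarrow> 'a) \<Rightarrow> real \<Rightarrow> (real \<Rightarrow> 'a) \<Rightarrow> bool" where
  "ode_solution G T y \<longleftrightarrow>
     (\<forall>t\<in>{0..T}. (y has_vector_derivative G t (y t)) (at t within {0..T}))"

lemma ode_solution_subset: "ode_solution G T y \<Longrightarrow> T' \<le> T \<Longrightarrow> ode_solution G T' y"
  unfolding ode_solution_def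
  by (metis atLeastAtMost_iff atLeastatMost_subset_iff has_vector_derivative_within_subset
      order_refl order_trans)

lemma ode_solution_continuous: "ode_solution G T y \<Longrightarrow> continuous_on {0..T} y"
  unfolding ode_solution_def
  by (meson continuous_on_eq_continuous_within has_vector_derivative_continuous)

text \<open>The order of quantifiers matters: \<open>T\<close> depends only on the radius
  \<open>R\<close>, so all data close to a given one share an interval of existence.\<close>

lemma picard_local:
  fixes G :: "real \<Rightarrow> 'a::banach \<Rightarrow> 'a"
  assumes G: "cont_lip G" and R: "R \<ge> 0"
  obtains T where "T > 0" "\<And>x0. norm x0 \<le> R \<Longrightarrow>
    \<exists>y. y 0 = x0 \<and> ode_solution G T y \<and> (\<forall>t\<in>{0..T}. norm (y t) \<le> R + 1)"
proof -
  obtain L where L: "L \<ge> 0" "\<And>t x z. norm x \<le> R + 1 \<Longrightarrow> norm z \<le> R + 1 \<Longrightarrow>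
    norm (G t x - G t z) \<le> L * norm (x - z)" using cont_lip_lipschitz[OF G] by blast
  obtain B where B: "B \<ge> 0" "\<And>t x. norm x \<le> R + 1 \<Longrightarrow> norm (G t x) \<le> B"
    using cont_lip_bound[OF G] by blast
  \<comment> \<open>\<open>B * T \<le> 1\<close> keeps the Picard map inside the ball of radius
    \<open>R + 1\<close>, and \<open>L * T \<le> 1 / 2\<close> makes it a contraction.\<close>
  define T where "T = 1 / (2 * (L + B + 1))"
  have T: "T > 0" "B * T \<le> 1" "L * T \<le> 1 / 2"
    using L(1) B(1) by (auto simp: T_def field_simps)
  have "\<exists>y. y 0 = x0 \<and> ode_solution G T y \<and> (\<forall>t\<in>{0..T}. norm (y t) \<le> R + 1)"
    if x0: "norm x0 \<le> R" for x0
  proof -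
    \<comment> \<open>Clamping time to \<open>{0..T}\<close> lets the Picard map act on bounded
      continuous functions on the whole line, which form a complete space.\<close>
    define c where "c t = max 0 (min t T)" for t
    have c: "c t \<in> {0..T}" "t \<in> {0..T} \<Longrightarrow> c t = t" for t using T by (auto simp: c_def)
    have c_cont: "continuous_on UNIV c" unfolding c_def by (intro continuous_intros)
    define P where "P y = (\<lambda>t. x0 + integral {0..c t} (\<lambda>\<tau>. G \<tau> (apply_bcontfun y \<tau>)))"
      for y :: "real \<Rightarrow>\<^sub>C 'a"
    define S where "S = {y :: real \<Rightarrow>\<^sub>C 'a. \<forall>t. norm (apply_bcontfun y t) \<le> R + 1}"
    have Gc: "continuous_on A (\<lambda>\<tau>. G \<tau> (apply_bcontfun y \<tau>))" for y A
      by (intro cont_lip_curve[OF G] continuous_on_apply_bcontfun)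
    have int: "(\<lambda>\<tau>. G \<tau> (apply_bcontfun y \<tau>)) integrable_on {a..b}" for y a b
      by (intro integrable_continuous_real Gc)
    have bound: "norm (P y t) \<le> R + 1" if y: "y \<in> S" for y t
    proof -
      have "norm (integral {0..c t} (\<lambda>\<tau>. G \<tau> (apply_bcontfun y \<tau>))) \<le> B * (c t - 0)"
        using c(1)[of t] y by (intro integral_bound Gc) (auto simp: S_def intro: B(2))
      also have "\<dots> \<le> B * T" using c(1)[of t] B(1) by (auto intro: mult_left_mono)
      finally have "norm (integral {0..c t} (\<lambda>\<tau>. G \<tau> (apply_bcontfun y \<tau>))) \<le> 1" using T(2) by linarith
      then show ?thesis unfolding P_def by (intro norm_triangle_le add_mono x0)
    qed
    have P_cont: "continuous_on UNIV (P y)" for y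
    proof -
      have "continuous_on {0..T} (\<lambda>t. integral {0..t} (\<lambda>\<tau>. G \<tau> (apply_bcontfun y \<tau>)))"
        by (intro indefinite_integral_continuous_1 int)
      then have "continuous_on UNIV (\<lambda>t. integral {0..c t} (\<lambda>\<tau>. G \<tau> (apply_bcontfun y \<tau>)))"
        using c by (intro continuous_on_compose2[OF _ c_cont]) auto
      then show ?thesis unfolding P_def by (intro continuous_intros)
    qed
    \<comment> \<open>\<open>Bcontfun\<close> is faithful only on bounded continuous functions; for
      \<open>P y\<close> boundedness is known because \<open>y\<close> lies in
      \<open>S\<close>.\<close>
    have P_bc: "apply_bcontfun (Bcontfun (P y)) = P y" if "y \<in> S" for y
      using P_cont bound[OF that]
      by (intro Bcontfun_inverse) (auto simp: bcontfun_def bounded_iff)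
    have "\<exists>!y\<in>S. Bcontfun (P y) = y"
    proof (rule Banach_fix)
      have "closed S"
      proof -
        have "S = PiC UNIV (\<lambda>_. cball 0 (R + 1))"
          by (auto simp: S_def mem_PiC_iff Pi_def)
        then show ?thesis by (simp add: closed_PiC)
      qed
      then show "complete S" by (simp add: complete_eq_closed)
      have "const_bcontfun 0 \<in> S" using R by (auto simp: S_def const_bcontfun.rep_eq)
      then show "S \<noteq> {}" by blast
      show "(\<lambda>y. Bcontfun (P y)) ` S \<subseteq> S"
        using bound by (auto simp: S_def P_bc[unfolded S_def])
      show "dist (Bcontfun (P y)) (Bcontfun (P z)) \<le> (1/2) * dist y z"
        if y: "y \<in> S" and z: "z \<in> S" for y z
      proof (rule dist_bound)
        fix t
        have "P y t - P z t = integral {0..c t}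
            (\<lambda>\<tau>. G \<tau> (apply_bcontfun y \<tau>) - G \<tau> (apply_bcontfun z \<tau>))"
          by (simp add: P_def integral_diff[OF int int])
        also have "norm \<dots> \<le> (L * dist y z) * (c t - 0)"
        proof (intro integral_bound continuous_intros Gc)
          fix \<tau>
          have "norm (G \<tau> (apply_bcontfun y \<tau>) - G \<tau> (apply_bcontfun z \<tau>))
              \<le> L * norm (apply_bcontfun y \<tau> - apply_bcontfun z \<tau>)"
            using y z by (intro L(2)) (auto simp: S_def)
          also have "\<dots> \<le> L * dist y z"
            using L(1) dist_bounded[of y \<tau> z] by (intro mult_left_mono) (auto simp: dist_norm)
          finally show "norm (G \<tau> (apply_bcontfun y \<tau>) - G \<tau> (apply_bcontfun z \<tau>)) \<le> L * dist y z" .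
        qed (use c in auto)
        also have "\<dots> \<le> (L * dist y z) * T"
          using c(1)[of t] L(1) by (intro mult_left_mono) auto
        also have "\<dots> = (L * T) * dist y z" by simp
        also have "\<dots> \<le> (1/2) * dist y z" using T(3) by (intro mult_right_mono) auto
        finally show "dist (apply_bcontfun (Bcontfun (P y)) t) (apply_bcontfun (Bcontfun (P z)) t)
            \<le> (1/2) * dist y z"
          by (simp add: P_bc y z dist_norm)
      qed
    qed auto
    then obtain y where y: "y \<in> S" "Bcontfun (P y) = y" by blast
    let ?y = "apply_bcontfun y"
    have yP: "?y t = P y t" for t using P_bc[OF y(1)] y(2) by simp
    have "?y 0 = x0" using T(1) by (subst yP) (simp add: P_def c_def)
    moreover have "ode_solution G T ?y"
      unfolding ode_solution_def
    proof
      fix t assume t: "t \<in> {0..T}"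
      have d: "((\<lambda>t. x0 + integral {0..t} (\<lambda>\<tau>. G \<tau> (?y \<tau>))) has_vector_derivative 0 + G t (?y t))
          (at t within {0..T})"
        by (intro derivative_intros integral_has_vector_derivative Gc t)
      have "(?y has_vector_derivative 0 + G t (?y t)) (at t within {0..T})"
        by (rule has_vector_derivative_transform[OF t _ d]) (subst yP, simp only: P_def c(2))
      then show "(?y has_vector_derivative G t (?y t)) (at t within {0..T})" by simp
    qed
    ultimately show ?thesis using y(1) by (auto simp: S_def)
  qed
  then show ?thesis using that T(1) by blast
qed

text \<open>A weighted maximum replaces iteration. Let \<open>m\<close> be the maximum of
  \<open>exp (- 2 * L * t) * f t\<close>, attained at \<open>u\<close>. Inserting
  \<open>f \<tau> \<le> m * exp (2 * L * \<tau>)\<close> into the hypothesis at \<open>u\<close>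
  gives \<open>f u \<le> c + f u / 2 - m / 2\<close>, hence \<open>f u + m \<le> 2 * c\<close>. The
  factors 2 are not sharp; what matters later is that the bound is linear in
  \<open>c\<close>.\<close>

lemma gronwall_integral:
  fixes f :: "real \<Rightarrow> real"
  assumes f: "continuous_on {0..T} f" and L: "L > 0"
    and le: "\<And>t. t \<in> {0..T} \<Longrightarrow> f t \<le> c + L * integral {0..t} f"
    and c: "c \<ge> 0" and t: "t \<in> {0..T}"
  shows "f t \<le> 2 * c * exp (2 * L * t)"
proof -
  have "continuous_on {0..T} (\<lambda>t. exp (- 2 * L * t) * f t)"
    by (intro continuous_intros f)
  moreover have "{0..T} \<noteq> {}" using t by auto
  ultimately obtain u where u: "u \<in> {0..T}"
    "\<And>\<tau>. \<tau> \<in> {0..T} \<Longrightarrow> exp (- 2 * L * \<tau>) * f \<tau> \<le> exp (- 2 * L * u) * f u"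
    using continuous_attains_sup[OF compact_Icc] by blast
  define m where "m = exp (- 2 * L * u) * f u"
  have fm: "f \<tau> \<le> m * exp (2 * L * \<tau>)" if "\<tau> \<in> {0..T}" for \<tau>
  proof -
    have "exp (2 * L * \<tau>) * (exp (- 2 * L * \<tau>) * f \<tau>) \<le> exp (2 * L * \<tau>) * m"
      using u(2)[OF that] by (intro mult_left_mono) (auto simp: m_def)
    moreover have "exp (2 * L * \<tau>) * (exp (- 2 * L * \<tau>) * f \<tau>) = f \<tau>"
      by (simp only: mult.assoc[symmetric] exp_add[symmetric]) simp
    ultimately show ?thesis by (simp only: mult.commute)
  qed
  have hi: "((\<lambda>\<tau>. m * exp (2 * L * \<tau>)) has_integral
      m * exp (2 * L * u) / (2 * L) - m * exp (2 * L * 0) / (2 * L)) {0..u}"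
  proof (rule fundamental_theorem_of_calculus)
    show "0 \<le> u" using u by simp
    show "((\<lambda>x. m * exp (2 * L * x) / (2 * L)) has_vector_derivative m * exp (2 * L * x))
        (at x within {0..u})" for x
      unfolding has_real_derivative_iff_has_vector_derivative[symmetric]
      using L by (auto intro!: derivative_eq_intros)
  qed
  have int: "integral {0..u} (\<lambda>\<tau>. m * exp (2 * L * \<tau>)) = m * (exp (2 * L * u) - 1) / (2 * L)"
    "(\<lambda>\<tau>. m * exp (2 * L * \<tau>)) integrable_on {0..u}"
    unfolding integral_unique[OF hi] using has_integral_integrable[OF hi]
    by (simp_all add: diff_divide_distrib right_diff_distrib)
  have "integral {0..u} f \<le> integral {0..u} (\<lambda>\<tau>. m * exp (2 * L * \<tau>))"
    using u(1) by (intro integral_le int integrable_continuous_real fm)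
      (auto intro: continuous_on_subset[OF f])
  then have "f u \<le> c + L * (m * (exp (2 * L * u) - 1) / (2 * L))"
    using le[OF u(1)] L unfolding int(1) by (meson add_left_mono less_imp_le mult_left_mono order_trans)
  then have "f u \<le> c + m * exp (2 * L * u) / 2 - m / 2"
    using L by (simp add: right_diff_distrib diff_divide_distrib)
  moreover have "m * exp (2 * L * u) = f u" by (simp add: m_def exp_minus)
  ultimately have fu: "f u + m \<le> 2 * c" by linarith
  have "m \<le> 2 * c"
  proof (cases "m \<ge> 0")
    case True
    then have "f u \<ge> 0" using \<open>m * exp (2 * L * u) = f u\<close> by (metis exp_ge_zero mult_nonneg_nonneg)
    then show ?thesis using fu by linarith
  qed (use c in linarith)
  then have "m * exp (2 * L * t) \<le> 2 * c * exp (2 * L * t)" by (intro mult_right_mono) auto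
  then show ?thesis using fm[OF t] by linarith
qed

text \<open>The constant depends on the trajectories only through the radius \<open>R\<close>. The
  same estimate gives uniqueness, when the initial values agree, and continuous dependence.\<close>

lemma ode_solution_dependence:
  fixes G :: "real \<Rightarrow> 'a::banach \<Rightarrow> 'a"
  assumes G: "cont_lip G"
  obtains C where "C \<ge> 0" "\<And>y z t. ode_solution G T y \<Longrightarrow> ode_solution G T z \<Longrightarrow>
    (\<And>t. t \<in> {0..T} \<Longrightarrow> norm (y t) \<le> R) \<Longrightarrow> (\<And>t. t \<in> {0..T} \<Longrightarrow> norm (z t) \<le> R) \<Longrightarrow>
    t \<in> {0..T} \<Longrightarrow> norm (y t - z t) \<le> C * norm (y 0 - z 0)"
proof -
  obtain K where K: "K \<ge> 0" "\<And>t x z. norm x \<le> R \<Longrightarrow> norm z \<le> R \<Longrightarrow>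
    norm (G t x - G t z) \<le> K * norm (x - z)" using cont_lip_lipschitz[OF G] by blast
  \<comment> \<open>Gronwall's inequality is stated for a strictly positive constant, and
    \<open>K\<close> may be 0.\<close>
  define L where "L = K + 1"
  have L: "L > 0" "norm x \<le> R \<Longrightarrow> norm z \<le> R \<Longrightarrow> norm (G t x - G t z) \<le> L * norm (x - z)" for t x z
    using K(1) K(2)[of x z t] norm_ge_zero[of "x - z"] by (auto simp: L_def distrib_right intro: order_trans)
  show ?thesis
  proof (rule that[of "2 * exp (2 * L * T)"])
    fix y z t
    assume y: "ode_solution G T y" "\<And>t. t \<in> {0..T} \<Longrightarrow> norm (y t) \<le> R"
      and z: "ode_solution G T z" "\<And>t. t \<in> {0..T} \<Longrightarrow> norm (z t) \<le> R"
      and t: "t \<in> {0..T}"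
    note cont = ode_solution_continuous[OF y(1)] ode_solution_continuous[OF z(1)]
    have "norm (y t - z t) \<le> 2 * norm (y 0 - z 0) * exp (2 * L * t)"
    proof (rule gronwall_integral[where T=T])
      show c: "continuous_on {0..T} (\<lambda>t. norm (y t - z t))" by (intro continuous_intros cont)
      fix t assume t: "t \<in> {0..T}"
      have sub: "{0..t} \<subseteq> {0..T}" using t by auto
      have "((\<lambda>\<tau>. G \<tau> (y \<tau>) - G \<tau> (z \<tau>)) has_integral (y t - z t) - (y 0 - z 0)) {0..t}"
        using t y(1) z(1) unfolding ode_solution_def
        by (intro fundamental_theorem_of_calculus has_vector_derivative_diff)
          (auto intro: has_vector_derivative_within_subset[OF _ sub])
      then have eq: "(y t - z t) - (y 0 - z 0) = integral {0..t} (\<lambda>\<tau>. G \<tau> (y \<tau>) - G \<tau> (z \<tau>))"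
        by (simp add: integral_unique)
      have i2: "(\<lambda>\<tau>. norm (y \<tau> - z \<tau>)) integrable_on {0..t}"
        by (intro integrable_continuous_real continuous_on_subset[OF c sub])
      have "norm (integral {0..t} (\<lambda>\<tau>. G \<tau> (y \<tau>) - G \<tau> (z \<tau>)))
          \<le> integral {0..t} (\<lambda>\<tau>. L * norm (y \<tau> - z \<tau>))"
        using t y(2) z(2)
        by (intro integral_norm_bound_integral integrable_continuous_real continuous_intros
            cont_lip_curve[OF G] continuous_on_subset[OF cont(1) sub]
            continuous_on_subset[OF cont(2) sub] L(2)) auto
      also have "\<dots> = L * integral {0..t} (\<lambda>\<tau>. norm (y \<tau> - z \<tau>))" by simp
      finally show "norm (y t - z t) \<le> norm (y 0 - z 0) + L * integral {0..t} (\<lambda>t. norm (y t - z t))"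
        using norm_triangle_ineq[of "(y t - z t) - (y 0 - z 0)" "y 0 - z 0"]
        unfolding eq[symmetric] by simp
    qed (use L t in auto)
    also have "\<dots> \<le> 2 * norm (y 0 - z 0) * exp (2 * L * T)"
      using t L by (intro mult_left_mono) auto
    finally show "norm (y t - z t) \<le> 2 * exp (2 * L * T) * norm (y 0 - z 0)" by (simp add: mult_ac)
  qed simp
qed

section \<open>Sobolev weights and convolution\<close>

text \<open>The exponent is halved: this is the factor on the coefficient itself, whose square is
  the Sobolev weight.\<close>

definition wt :: "real \<Rightarrow> int \<Rightarrow> real" where
  "wt r k = (1 + (of_int k)\<^sup>2) powr (r / 2)"

lemma wt_base: "1 + (of_int k :: real)\<^sup>2 \<ge> 1" "1 + (of_int k :: real)\<^sup>2 > 0"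
  using zero_le_power2[of "of_int k :: real"] by linarith+

lemma wt_pos [simp]: "wt r k > 0"
  using wt_base(2)[of k] by (simp add: wt_def)

lemma wt_nonneg [simp]: "wt r k \<ge> 0" and wt_nonzero [simp]: "wt r k \<noteq> 0"
  using wt_pos[of r k] by linarith+

lemma wt_mult: "wt r k * wt r' k = wt (r + r') k"
  by (simp add: wt_def add_divide_distrib powr_add)

lemma wt_zero [simp]: "wt 0 k = 1"
  using wt_base(2)[of k] by (simp add: wt_def)

lemma wt_at_0 [simp]: "wt r 0 = 1"
  by (simp add: wt_def)

lemma wt_cancel [simp]: "wt (- r) k * wt r k = 1" "wt r k * wt (- r) k = 1"
  by (simp_all add: wt_mult)

lemma wt_cancel_left [simp]: "wt (- r) k * (wt r k * x) = x" "wt r k * (wt (- r) k * x) = x"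
  by (simp_all add: mult.assoc[symmetric])

lemma wt_uminus [simp]: "wt r (- k) = wt r k"
  by (simp add: wt_def)

lemma wt_mono: "r \<le> r' \<Longrightarrow> wt r k \<le> wt r' k"
  unfolding wt_def using wt_base(1) by (intro powr_mono) auto

lemma wt_le_1: "r \<le> 0 \<Longrightarrow> wt r k \<le> 1"
  using wt_mono[of r 0 k] by simp

lemma wt_2: "wt 2 k = 1 + (of_int k)\<^sup>2"
  using wt_base(2)[of k] by (simp add: wt_def)

lemma wt_square: "(wt r k)\<^sup>2 = (1 + (of_int k)\<^sup>2) powr r"
  by (simp add: wt_def power2_eq_square powr_add[symmetric])

lemma abs_le_wt_1: "\<bar>of_int k\<bar> \<le> wt 1 k"
proof -
  have "(of_int k)\<^sup>2 \<le> (wt 1 k)\<^sup>2"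
    using wt_base(2)[of k] by (simp add: wt_square)
  then show ?thesis by (metis abs_le_square_iff abs_of_nonneg wt_nonneg)
qed

text \<open>From (j+l)^2 \<le> 2 j^2 + 2 l^2 the base at \<open>j + l\<close> is at most 4 times the
  larger of the two bases, and the power r/2 turns 4 into \<open>2 powr r\<close>. This is what
  makes H^r an algebra: the weight of a product falls on one of its factors.\<close>

lemma wt_triangle:
  assumes "r \<ge> 0"
  shows "wt r (j + l) \<le> 2 powr r * (wt r j + wt r l)"
proof -
  let ?m = "max (1 + (of_int j :: real)\<^sup>2) (1 + (of_int l)\<^sup>2)"
  have "(of_int j + of_int l :: real)\<^sup>2 \<le> 2 * (of_int j)\<^sup>2 + 2 * (of_int l)\<^sup>2"
    using sum_squares_bound[of "of_int j :: real" "of_int l"] by (simp add: power2_sum)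
  moreover have "1 + x \<le> 4 * m" if "x \<le> 2 * a + 2 * b" "1 + a \<le> m" "1 + b \<le> m" for x a b m :: real
    using that by linarith
  ultimately have "1 + (of_int (j + l) :: real)\<^sup>2 \<le> 4 * ?m"
    unfolding of_int_add by (meson max.cobounded1 max.cobounded2)
  then have "wt r (j + l) \<le> (4 * ?m) powr (r / 2)"
    unfolding wt_def using assms wt_base(2) by (intro powr_mono2) auto
  also have "\<dots> = 4 powr (r / 2) * ?m powr (r / 2)"
    using wt_base(2)[of j] by (subst powr_mult) (auto simp: max_def)
  also have "4 powr (r / 2) = (2::real) powr r"
  proof -
    have "(4::real) = 2 powr 2" by simp
    then show ?thesis by (simp only: powr_powr) simp
  qed
  also have "?m powr (r / 2) \<le> wt r j + wt r l"
    using wt_nonneg[of r j] wt_nonneg[of r l] by (simp add: max_def wt_def)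
  finally show ?thesis by (simp add: mult_left_mono)
qed

lemma wt_summable:
  assumes "r > 1 / 2"
  shows "(\<lambda>k. (wt (- r) k)\<^sup>2) summable_on UNIV"
proof -
  have s: "summable (\<lambda>n. real n powr (- 2 * r))"
    using assms by (simp add: summable_real_powr_iff)
  \<comment> \<open>The index 0 is excluded: there the left side is 1, while
    \<open>0 powr x = 0\<close> by convention.\<close>
  have le: "norm ((wt (- r) (int n))\<^sup>2) \<le> real n powr (- 2 * r)" if "n \<ge> 1" for n
  proof -
    have "(wt (- r) (int n))\<^sup>2 = (1 + (real n)\<^sup>2) powr (- r)" by (simp add: wt_square)
    also have "\<dots> \<le> ((real n)\<^sup>2) powr (- r)"
      using that assms by (intro powr_mono2') auto
    also have "\<dots> = real n powr (- 2 * r)"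
      using that by (simp add: powr_powr flip: powr_numeral)
    finally show ?thesis by simp
  qed
  have "summable (\<lambda>n. norm ((wt (- r) (int n))\<^sup>2))"
    using le by (intro summable_comparison_test'[OF s, of 1]) auto
  then have n: "(\<lambda>n. (wt (- r) (int n))\<^sup>2) summable_on UNIV"
    by (rule norm_summable_imp_summable_on)
  have "(\<lambda>k. (wt (- r) k)\<^sup>2) summable_on range int"
    using n by (subst summable_on_reindex) (auto simp: o_def)
  moreover have "(\<lambda>k. (wt (- r) k)\<^sup>2) summable_on range (\<lambda>n. - int n)"
    using n by (subst summable_on_reindex) (auto simp: o_def inj_on_def)
  ultimately have "(\<lambda>k. (wt (- r) k)\<^sup>2) summable_on (range int \<union> range (\<lambda>n. - int n))"
    by (rule summable_on_union)
  moreover have "range int \<union> range (\<lambda>n. - int n) = UNIV"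
    by (auto intro: int_cases2)
  ultimately show ?thesis by simp
qed

text \<open>
  An element \<open>a\<close> of \<open>\<ell>\<^sup>2\<close> represents the element of \<open>H\<^sup>r\<close> whose Fourier coefficients are
  \<open>coef r a\<close>; this makes the representation isometric up to the factor \<open>\<surd>(2\<pi>)\<close>.
\<close>

definition coef :: "real \<Rightarrow> ell2 \<Rightarrow> int \<Rightarrow> complex" where
  "coef r a k = of_real (wt (- r) k) * a $$ k"

text \<open>The Cauchy-Schwarz constant of the embedding of H^r into absolutely convergent Fourier
  series, for r > 1/2.\<close>

definition embed_const :: "real \<Rightarrow> real" where
  "embed_const r = sqrt (\<Sum>\<^sub>\<infinity>k. (wt (- r) k)\<^sup>2)"

lemma embed_const_nonneg [simp]: "embed_const r \<ge> 0"
  by (simp add: embed_const_def infsum_nonneg)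

lemma norm_coef: "cmod (coef r a k) = wt (- r) k * cmod (a $$ k)"
  by (simp add: coef_def norm_mult)

lemma coef_l1:
  assumes "r > 1 / 2"
  shows "(\<lambda>k. cmod (coef r a k)) summable_on UNIV"
    and "(\<Sum>\<^sub>\<infinity>k. cmod (coef r a k)) \<le> embed_const r * norm a"
proof -
  have le: "(\<Sum>k\<in>F. cmod (coef r a k)) \<le> embed_const r * norm a" if F: "finite F" for F
  proof -
    have "(\<Sum>k\<in>F. cmod (coef r a k)) = (\<Sum>k\<in>F. \<bar>wt (- r) k\<bar> * \<bar>cmod (a $$ k)\<bar>)"
      by (simp add: norm_coef)
    also have "\<dots> \<le> L2_set (wt (- r)) F * L2_set (\<lambda>k. cmod (a $$ k)) F"
      by (rule L2_set_mult_ineq)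
    also have "L2_set (wt (- r)) F \<le> embed_const r"
      unfolding L2_set_def embed_const_def using F wt_summable[OF assms]
      by (intro real_sqrt_le_mono finite_sum_le_infsum) auto
    then have "L2_set (wt (- r)) F * L2_set (\<lambda>k. cmod (a $$ k)) F \<le> embed_const r * norm a"
      using L2_set_le_norm_ell2[OF F] by (intro mult_mono) auto
    finally show ?thesis .
  qed
  show s: "(\<lambda>k. cmod (coef r a k)) summable_on UNIV"
    using le by (intro nonneg_bdd_above_summable_on) (auto simp: bdd_above_def)
  show "(\<Sum>\<^sub>\<infinity>k. cmod (coef r a k)) \<le> embed_const r * norm a"
    using le by (intro infsum_le_finite_sums s) auto
qed

section \<open>Convolution and the algebra property of H^r for r > 1/2\<close>

definition conv :: "(int \<Rightarrow> complex) \<Rightarrow> (int \<Rightarrow> complex) \<Rightarrow> int \<Rightarrow> complex" where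
  "conv f g k = (\<Sum>\<^sub>\<infinity>j. f j * g (k - j))"

lemma conv_summable:
  assumes "(\<lambda>j. cmod (f j)) summable_on UNIV" "\<And>j. cmod (g j) \<le> B"
  shows "(\<lambda>j. cmod (f j * g (k - j))) summable_on UNIV"
    "(\<lambda>j. f j * g (k - j)) summable_on UNIV"
proof -
  show *: "(\<lambda>j. cmod (f j * g (k - j))) summable_on UNIV"
    by (rule summable_on_comparison_test[OF summable_on_cmult_left[OF assms(1), of B]])
      (auto simp: norm_mult intro: mult_left_mono assms(2))
  show "(\<lambda>j. f j * g (k - j)) summable_on UNIV"
    by (rule abs_summable_summable) (rule *)
qed

lemma conv_commute: "conv f g k = conv g f k"
  unfolding conv_def
  by (rule infsum_reindex_bij_witness[where i="\<lambda>j. k - j" and j="\<lambda>j. k - j"]) auto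

text \<open>Young's inequality for \<ell>^1 * \<ell>^2. A finitely supported \<open>f\<close> gives
  a finite combination of translates of \<open>b\<close>, each with the norm of \<open>b\<close>;
  the general case is a limit on each finite set of frequencies.\<close>

lemma conv_l1_ell2:
  assumes f: "(\<lambda>j. cmod (f j)) summable_on UNIV"
  shows "in_ell2 (conv f (comp_ell2 b))"
    and "norm (mk_ell2 (conv f (comp_ell2 b))) \<le> (\<Sum>\<^sub>\<infinity>j. cmod (f j)) * norm b"
proof -
  have le: "L2_set (\<lambda>k. cmod (conv f (comp_ell2 b) k)) F \<le> (\<Sum>\<^sub>\<infinity>j. cmod (f j)) * norm b"
    if F: "finite F" for F
  proof (rule tendsto_upperbound)
    have "((\<lambda>J. \<Sum>j\<in>J. f j * b $$ (k - j)) \<longlongrightarrow> conv f (comp_ell2 b) k) (finite_subsets_at_top UNIV)" for k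
      unfolding conv_def
      by (rule infsum_tendsto) (rule conv_summable[OF f norm_comp_ell2_le])
    then show "((\<lambda>J. L2_set (\<lambda>k. cmod (\<Sum>j\<in>J. f j * b $$ (k - j))) F)
        \<longlongrightarrow> L2_set (\<lambda>k. cmod (conv f (comp_ell2 b) k)) F) (finite_subsets_at_top UNIV)"
      unfolding L2_set_def by (intro tendsto_intros)
    show "\<forall>\<^sub>F J in finite_subsets_at_top UNIV. L2_set (\<lambda>k. cmod (\<Sum>j\<in>J. f j * b $$ (k - j))) F
        \<le> (\<Sum>\<^sub>\<infinity>j. cmod (f j)) * norm b"
    proof (rule eventually_finite_subsets_at_top_weakI)
      fix J :: "int set" assume J: "finite J"
      have shift: "L2_set (\<lambda>k. cmod (b $$ (k - j))) F \<le> norm b" for j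
      proof -
        have "L2_set (\<lambda>k. cmod (b $$ (k - j))) F = L2_set (\<lambda>k. cmod (b $$ k)) ((\<lambda>k. k - j) ` F)"
          by (simp add: L2_set_def sum.reindex inj_on_def)
        also have "\<dots> \<le> norm b" using F by (intro L2_set_le_norm_ell2) simp
        finally show ?thesis .
      qed
      have "L2_set (\<lambda>k. cmod (\<Sum>j\<in>J. f j * b $$ (k - j))) F \<le> (\<Sum>j\<in>J. cmod (f j) * norm b)"
        using J
      proof (induction J)
        case empty
        then show ?case by (simp add: L2_set_def)
      next
        case (insert j J)
        have "L2_set (\<lambda>k. cmod (\<Sum>j\<in>insert j J. f j * b $$ (k - j))) F
            \<le> L2_set (\<lambda>k. cmod (f j) * cmod (b $$ (k - j)) + cmod (\<Sum>j\<in>J. f j * b $$ (k - j))) F"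
          using insert.hyps by (intro L2_set_mono) (auto simp flip: norm_mult intro: norm_triangle_ineq)
        also have "\<dots> \<le> L2_set (\<lambda>k. cmod (f j) * cmod (b $$ (k - j))) F
            + L2_set (\<lambda>k. cmod (\<Sum>j\<in>J. f j * b $$ (k - j))) F"
          by (rule L2_set_triangle_ineq)
        also have "L2_set (\<lambda>k. cmod (f j) * cmod (b $$ (k - j))) F
            = cmod (f j) * L2_set (\<lambda>k. cmod (b $$ (k - j))) F"
          by (simp add: L2_set_right_distrib)
        also have "\<dots> \<le> cmod (f j) * norm b" by (intro mult_left_mono shift) auto
        finally show ?case using insert by simp
      qed
      also have "\<dots> = (\<Sum>j\<in>J. cmod (f j)) * norm b" by (simp add: sum_distrib_right)
      also have "\<dots> \<le> (\<Sum>\<^sub>\<infinity>j. cmod (f j)) * norm b"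
        using J f by (intro mult_right_mono finite_sum_le_infsum) auto
      finally show "L2_set (\<lambda>k. cmod (\<Sum>j\<in>J. f j * b $$ (k - j))) F
        \<le> (\<Sum>\<^sub>\<infinity>j. cmod (f j)) * norm b" .
    qed
  qed simp
  show i: "in_ell2 (conv f (comp_ell2 b))" using le by (rule in_ell2I)
  show "norm (mk_ell2 (conv f (comp_ell2 b))) \<le> (\<Sum>\<^sub>\<infinity>j. cmod (f j)) * norm b"
    using le i by (intro norm_ell2_leI) simp
qed

lemma coef_bounded: "r \<ge> 0 \<Longrightarrow> cmod (coef r a k) \<le> norm a"
  using mult_mono[OF wt_le_1[of "- r" k] norm_comp_ell2_le[of a k]] by (simp add: norm_coef)

definition mul :: "real \<Rightarrow> ell2 \<Rightarrow> ell2 \<Rightarrow> ell2" where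
  "mul r a b = mk_ell2 (\<lambda>k. of_real (wt r k) * conv (coef r a) (coef r b) k)"

definition cmod_ell2 :: "ell2 \<Rightarrow> ell2" where
  "cmod_ell2 a = mk_ell2 (\<lambda>k. of_real (cmod (a $$ k)))"

lemma cmod_ell2 [simp]:
  "cmod_ell2 a $$ k = of_real (cmod (a $$ k))" "norm (cmod_ell2 a) = norm a"
proof -
  have "in_ell2 (\<lambda>k. of_real (cmod (a $$ k)))"
    by (rule in_ell2_dominated[of "comp_ell2 a" _ 1]) auto
  then show *: "cmod_ell2 a $$ k = of_real (cmod (a $$ k))" for k
    by (simp add: cmod_ell2_def)
  show "norm (cmod_ell2 a) = norm a"
    by (simp add: norm_ell2_infsum *)
qed

text \<open>By \<open>wt_triangle\<close> the weight at frequency \<open>k\<close> moves to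
  \<open>j\<close> or to \<open>k - j\<close>. In either case the factor that receives it becomes an
  \<ell>^2 sequence, while the other is still in \<ell>^1, so Young's inequality applies. The two
  cases account for the factor 2.\<close>

lemma mul_bounds:
  assumes r: "r > 1 / 2"
  shows "in_ell2 (\<lambda>k. of_real (wt r k) * conv (coef r a) (coef r b) k)"
    and "norm (mul r a b) \<le> 2 powr r * 2 * embed_const r * norm a * norm b"
proof -
  let ?f = "\<lambda>a k. of_real (cmod (coef r a k)) :: complex"
  have f1: "(\<lambda>k. cmod (?f a k)) summable_on UNIV" for a using coef_l1[OF r] by simp
  \<comment> \<open>Convolutions of moduli, used as majorants: the domination \<open>dom\<close>
    then holds at each frequency separately.\<close>
  define y where "y a b = mk_ell2 (conv (?f a) (comp_ell2 (cmod_ell2 b)))" for a b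
  have y: "y a b $$ k = conv (?f a) (comp_ell2 (cmod_ell2 b)) k" for a b k
    using conv_l1_ell2(1)[OF f1] by (simp add: y_def)
  have ny: "norm (y a b) \<le> embed_const r * norm a * norm b" for a b
  proof -
    have "norm (y a b) \<le> (\<Sum>\<^sub>\<infinity>k. cmod (?f a k)) * norm (cmod_ell2 b)"
      unfolding y_def by (rule conv_l1_ell2(2)[OF f1])
    also have "\<dots> \<le> (embed_const r * norm a) * norm b"
      using coef_l1(2)[OF r, of a] by (simp add: mult_right_mono)
    finally show ?thesis .
  qed
  have s: "(\<lambda>j. cmod (coef r a j) * cmod (b $$ (k - j))) summable_on UNIV" for a b k
    using conv_summable(1)[OF coef_l1(1)[OF r] norm_comp_ell2_le] by (simp add: norm_mult)
  have yr: "y a b $$ k = of_real (\<Sum>\<^sub>\<infinity>j. cmod (coef r a j) * cmod (b $$ (k - j)))" for a b k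
    unfolding y conv_def
    using infsumI[OF has_sum_of_real_iff[THEN iffD2, OF has_sum_infsum[OF s]]] by simp
  have dom: "cmod (of_real (wt r k) * conv (coef r a) (coef r b) k)
      \<le> 2 powr r * cmod ((y a b + y b a) $$ k)" for k
  proof -
    have sab: "(\<lambda>j. cmod (coef r a j * coef r b (k - j))) summable_on UNIV"
      by (rule conv_summable[OF coef_l1(1)[OF r] coef_bounded]) (use r in auto)
    have s2: "(\<lambda>j. cmod (coef r b (k - j)) * cmod (a $$ j)) summable_on UNIV"
      using s[of b a k] by (subst (asm) summable_on_reindex_bij_witness[of UNIV "\<lambda>j. k - j" "\<lambda>j. k - j" UNIV]) auto
    have "cmod (conv (coef r a) (coef r b) k) \<le> (\<Sum>\<^sub>\<infinity>j. cmod (coef r a j * coef r b (k - j)))"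
      unfolding conv_def by (rule norm_infsum_bound) (rule sab)
    then have "cmod (of_real (wt r k) * conv (coef r a) (coef r b) k)
        \<le> wt r k * (\<Sum>\<^sub>\<infinity>j. cmod (coef r a j * coef r b (k - j)))"
      by (simp add: norm_mult[of "of_real _"] mult_left_mono)
    also have "\<dots> = (\<Sum>\<^sub>\<infinity>j. wt r k * cmod (coef r a j * coef r b (k - j)))"
      by (simp add: infsum_cmult_right sab)
    also have "\<dots> \<le> (\<Sum>\<^sub>\<infinity>j. 2 powr r * (cmod (coef r a j) * cmod (b $$ (k - j))
        + cmod (coef r b (k - j)) * cmod (a $$ j)))"
    proof (rule infsum_mono)
      show "(\<lambda>j. wt r k * cmod (coef r a j * coef r b (k - j))) summable_on UNIV"
        by (intro summable_on_cmult_right sab)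
      show "(\<lambda>j. 2 powr r * (cmod (coef r a j) * cmod (b $$ (k - j))
        + cmod (coef r b (k - j)) * cmod (a $$ j))) summable_on UNIV"
        by (intro summable_on_cmult_right summable_on_add s s2)
      fix j
      have "wt r k \<le> 2 powr r * (wt r j + wt r (k - j))"
        using wt_triangle[of r j "k - j"] r by simp
      then have "wt r k * cmod (coef r a j * coef r b (k - j))
          \<le> 2 powr r * (wt r j + wt r (k - j)) * cmod (coef r a j * coef r b (k - j))"
        by (rule mult_right_mono) simp
      also have "\<dots> = 2 powr r * (cmod (coef r a j) * cmod (b $$ (k - j))
        + cmod (coef r b (k - j)) * cmod (a $$ j))"
        by (simp add: norm_mult norm_coef algebra_simps)
      finally show "wt r k * cmod (coef r a j * coef r b (k - j))
          \<le> 2 powr r * (cmod (coef r a j) * cmod (b $$ (k - j))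
        + cmod (coef r b (k - j)) * cmod (a $$ j))" .
    qed
    also have "\<dots> = 2 powr r * ((\<Sum>\<^sub>\<infinity>j. cmod (coef r a j) * cmod (b $$ (k - j)))
        + (\<Sum>\<^sub>\<infinity>j. cmod (coef r b (k - j)) * cmod (a $$ j)))"
      using s s2 by (simp add: infsum_cmult_right summable_on_add infsum_add)
    also have "(\<Sum>\<^sub>\<infinity>j. cmod (coef r b (k - j)) * cmod (a $$ j))
        = (\<Sum>\<^sub>\<infinity>j. cmod (coef r b j) * cmod (a $$ (k - j)))"
      by (rule infsum_reindex_bij_witness[where i="\<lambda>j. k - j" and j="\<lambda>j. k - j"]) auto
    finally have "cmod (of_real (wt r k) * conv (coef r a) (coef r b) k) \<le>
      2 powr r * ((\<Sum>\<^sub>\<infinity>j. cmod (coef r a j) * cmod (b $$ (k - j)))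
        + (\<Sum>\<^sub>\<infinity>j. cmod (coef r b j) * cmod (a $$ (k - j))))" (is "_ \<le> _ * ?S") .
    moreover have "?S \<ge> 0" by (intro add_nonneg_nonneg infsum_nonneg) auto
    then have "cmod ((y a b + y b a) $$ k) = ?S"
      by (simp only: comp_ell2_simps yr of_real_add[symmetric] norm_of_real abs_of_nonneg)
    ultimately show ?thesis by simp
  qed
  show i: "in_ell2 (\<lambda>k. of_real (wt r k) * conv (coef r a) (coef r b) k)"
    by (rule in_ell2_dominated[OF in_ell2_comp dom])
  have "norm (mul r a b) \<le> 2 powr r * norm (y a b + y b a)"
    by (rule norm_ell2_dominated) (use dom i in \<open>auto simp: mul_def\<close>)
  also have "\<dots> \<le> 2 powr r * (embed_const r * norm a * norm b + embed_const r * norm b * norm a)"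
    by (intro mult_left_mono norm_triangle_le add_mono ny) auto
  finally show "norm (mul r a b) \<le> 2 powr r * 2 * embed_const r * norm a * norm b"
    by (simp add: algebra_simps)
qed

lemma comp_mul:
  "r > 1 / 2 \<Longrightarrow> mul r a b $$ k = of_real (wt r k) * conv (coef r a) (coef r b) k"
  by (simp add: mul_def mul_bounds(1))

lemma coef_mul: "r > 1 / 2 \<Longrightarrow> coef r (mul r a b) k = conv (coef r a) (coef r b) k"
  by (simp add: coef_def comp_mul flip: mult.assoc of_real_mult)

lemma mul_commute: "mul r a b = mul r b a"
  unfolding mul_def by (simp add: conv_commute[of "coef r a" "coef r b"])

lemma coef_mul_summable:
  assumes "r > 1 / 2"
  shows "(\<lambda>j. coef r a j * coef r b (k - j)) summable_on UNIV"
  by (rule conv_summable[OF coef_l1(1)[OF assms] coef_bounded]) (use assms in auto)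

lemma coef_add [simp]: "coef r (a + b) k = coef r a k + coef r b k"
  by (simp add: coef_def algebra_simps)

lemma bounded_bilinear_mul:
  assumes r: "r > 1 / 2"
  shows "bounded_bilinear (mul r)"
proof
  have add: "mul r (a + a') b = mul r a b + mul r a' b" for a a' b
  proof (rule ell2_eqI)
    show "mul r (a + a') b $$ k = (mul r a b + mul r a' b) $$ k" for k
      using infsum_add[OF coef_mul_summable[OF r, of a b k] coef_mul_summable[OF r, of a' b k]]
      by (simp add: comp_mul[OF r] conv_def algebra_simps)
  qed
  have scale: "mul r (c *\<^sub>R a) b = c *\<^sub>R mul r a b" for c a b
  proof (rule ell2_eqI)
    fix k
    have "coef r (c *\<^sub>R a) j * x = of_real c * (coef r a j * x)" for j x
      by (simp add: coef_def scaleR_conv_of_real)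
    then have "conv (coef r (c *\<^sub>R a)) (coef r b) k = of_real c * conv (coef r a) (coef r b) k"
      unfolding conv_def by (simp only: infsum_cmult_right')
    then show "mul r (c *\<^sub>R a) b $$ k = (c *\<^sub>R mul r a b) $$ k"
      by (simp add: comp_mul[OF r] scaleR_conv_of_real)
  qed
  fix a a' b b' :: ell2 and c :: real
  show "mul r (a + a') b = mul r a b + mul r a' b" by (rule add)
  show "mul r a (b + b') = mul r a b + mul r a b'" using add by (simp add: mul_commute[of r a])
  show "mul r (c *\<^sub>R a) b = c *\<^sub>R mul r a b" by (rule scale)
  show "mul r a (c *\<^sub>R b) = c *\<^sub>R mul r a b" using scale by (simp add: mul_commute[of r a])
  show "\<exists>K. \<forall>a b. norm (mul r a b) \<le> norm a * norm b * K"
    using mul_bounds(2)[OF r] by (intro exI[of _ "2 powr r * 2 * embed_const r"]) (simp add: mult_ac)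
qed

text \<open>Complex conjugation of a function, seen on its coefficients; this is why the index is
  reflected. Fixed points represent real-valued distributions.\<close>

definition cj :: "ell2 \<Rightarrow> ell2" where
  "cj a = mk_ell2 (\<lambda>k. cnj (a $$ (- k)))"

lemma L2_set_reflect: "L2_set (\<lambda>k. cmod (a $$ (- k))) F = L2_set (\<lambda>k. cmod (a $$ k)) (uminus ` F)"
  by (simp add: L2_set_def sum.reindex inj_on_def)

lemma comp_cj [simp]: "cj a $$ k = cnj (a $$ (- k))"
proof -
  have "in_ell2 (\<lambda>k. cnj (a $$ (- k)))"
    using L2_set_le_norm_ell2[of _ a] by (intro in_ell2I[of _ "norm a"]) (simp add: L2_set_reflect)
  then show ?thesis by (simp add: cj_def)
qed

lemma norm_cj_le: "norm (cj a) \<le> norm a"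
  by (rule norm_ell2_leI) (simp add: L2_set_reflect L2_set_le_norm_ell2)

lemma bounded_linear_cj: "bounded_linear cj"
  by (rule bounded_linear_intro[of _ 1]) (auto intro!: ell2_eqI norm_cj_le)

lemma coef_cj: "coef r (cj a) k = cnj (coef r a (- k))"
  by (simp add: coef_def)

lemma cj_mul:
  assumes "r > 1 / 2"
  shows "cj (mul r a b) = mul r (cj a) (cj b)"
proof (rule ell2_eqI)
  fix k
  have "conv (coef r (cj a)) (coef r (cj b)) k = (\<Sum>\<^sub>\<infinity>j. cnj (coef r a (- j) * coef r b (- k - - j)))"
    unfolding conv_def coef_cj by simp
  also have "\<dots> = (\<Sum>\<^sub>\<infinity>j. cnj (coef r a j * coef r b (- k - j)))"
    by (rule infsum_reindex_bij_witness[where i=uminus and j=uminus]) auto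
  also have "\<dots> = cnj (conv (coef r a) (coef r b) (- k))"
    unfolding conv_def by (rule infsum_cnj)
  finally show "cj (mul r a b) $$ k = mul r (cj a) (cj b) $$ k"
    by (simp add: comp_mul[OF assms])
qed

section \<open>Fourier series\<close>

definition ek :: "int \<Rightarrow> real \<Rightarrow> complex" where
  "ek k x = exp (\<i> * of_int k * of_real x)"

lemma ek_add: "ek (j + k) x = ek j x * ek k x"
  by (simp add: ek_def exp_add[symmetric] algebra_simps)

lemma ek_0 [simp]: "ek 0 x = 1" and ek_at_0 [simp]: "ek k 0 = 1"
  by (simp_all add: ek_def)

lemma norm_ek [simp]: "cmod (ek k x) = 1"
  by (simp add: ek_def norm_exp_eq_Re)

lemma cnj_ek [simp]: "cnj (ek k x) = ek (- k) x"
  by (simp add: ek_def exp_cnj)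

lemma ek_test: "ek k \<in> test_functions"
  unfolding ek_def by (rule test_functions_exp)

lemma ek_periodic: "periodic_2pi (ek k)"
  using ek_test by (rule test_functionsD)

lemma ek_at_2pi [simp]: "ek k (2 * pi) = 1"
  using ek_periodic[of k] unfolding periodic_2pi_def by (metis add_0 ek_at_0)

lemma ek_has_vector_derivative:
  "(ek k has_vector_derivative \<i> * of_int k * ek k x) (at x within S)"
  unfolding ek_def
  by (rule has_vector_derivative_real_field) (auto intro!: derivative_eq_intros simp: mult_ac)

lemma continuous_on_ek [continuous_intros]: "continuous_on S (ek k)"
  by (meson ek_has_vector_derivative continuous_at_imp_continuous_on has_vector_derivative_continuous)

lemma fun_deriv_ek: "fun_deriv (ek k) = (\<lambda>x. \<i> * of_int k * ek k x)"
  unfolding fun_deriv_def by (intro ext vector_derivative_at ek_has_vector_derivative)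

lemma integral_ek: "integral {0..2 * pi} (ek k) = (if k = 0 then 2 * pi else 0)"
proof (cases "k = 0")
  case False
  have "(ek k has_integral ek k (2 * pi) / (\<i> * of_int k) - ek k 0 / (\<i> * of_int k)) {0..2 * pi}"
  proof (rule fundamental_theorem_of_calculus)
    fix x
    have "((\<lambda>x. ek k x / (\<i> * of_int k)) has_vector_derivative (\<i> * of_int k * ek k x) / (\<i> * of_int k))
        (at x within {0..2 * pi})"
      by (intro has_vector_derivative_divide ek_has_vector_derivative)
    then show "((\<lambda>x. ek k x / (\<i> * of_int k)) has_vector_derivative ek k x) (at x within {0..2 * pi})"
      using False by simp
  qed simp
  then show ?thesis using False by (simp add: integral_unique)
next
  case True
  have "ek 0 = (\<lambda>_. 1)" by auto
  then show ?thesis using True by (simp add: scaleR_conv_of_real)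
qed

definition fc :: "(real \<Rightarrow> complex) \<Rightarrow> int \<Rightarrow> complex" where
  "fc F k = 1 / (2 * pi) * integral {0..2 * pi} (\<lambda>x. F x * ek (- k) x)"

lemma cont_periodicD:
  "cont_periodic F \<Longrightarrow> continuous_on S F" "cont_periodic F \<Longrightarrow> periodic_2pi F"
  by (auto simp: cont_periodic_def intro: continuous_on_subset)

lemma cont_periodic_test: "\<phi> \<in> test_functions \<Longrightarrow> cont_periodic \<phi>"
  by (simp add: cont_periodic_def test_functions_continuous test_functionsD)

lemma cont_periodic_mult: "cont_periodic F \<Longrightarrow> cont_periodic G \<Longrightarrow> cont_periodic (\<lambda>x. F x * G x)"
  by (auto simp: cont_periodic_def periodic_2pi_def intro: continuous_intros)

lemma cont_periodic_diff: "cont_periodic F \<Longrightarrow> cont_periodic G \<Longrightarrow> cont_periodic (\<lambda>x. F x - G x)"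
  by (auto simp: cont_periodic_def periodic_2pi_def intro: continuous_intros)

lemma integrable_cont_mult:
  "continuous_on {a..b} F \<Longrightarrow> continuous_on {a..b} G \<Longrightarrow>
    (\<lambda>x. F x * G x :: complex) integrable_on {a..b::real}"
  by (intro integrable_continuous_real continuous_intros)

lemma real_poly_circle_orthogonal:
  fixes p :: "complex \<Rightarrow> real"
  assumes "real_polynomial_function p"
    and "continuous_on {0..2 * pi} F" "\<And>k. integral {0..2 * pi} (\<lambda>x. F x * ek k x) = 0"
  shows "integral {0..2 * pi} (\<lambda>x. F x * of_real (p (ek 1 x)) * ek k x) = 0"
  using assms
proof (induction arbitrary: F k rule: real_polynomial_function.induct)
  case lin: (linear p)
  interpret bounded_linear p by fact
  \<comment> \<open>The complex form \<open>a * z + b * cnj z\<close> of a real-linear functional.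
    Multiplication by \<open>z\<close> or \<open>cnj z\<close> on the circle shifts the frequency by
    one.\<close>
  define a b where "a = of_real (p 1) / 2 - \<i> * of_real (p \<i>) / 2"
    and "b = of_real (p 1) / 2 + \<i> * of_real (p \<i>) / 2"
  have p: "of_real (p z) = a * z + b * cnj z" for z
  proof -
    have "z = Re z *\<^sub>R 1 + Im z *\<^sub>R \<i>" by (simp add: complex_eq_iff)
    then have "p z = p (Re z *\<^sub>R 1 + Im z *\<^sub>R \<i>)" by (rule arg_cong)
    also have "\<dots> = Re z * p 1 + Im z * p \<i>" by (simp only: add scale real_scaleR_def)
    finally show ?thesis by (simp add: a_def b_def complex_eq_iff field_simps)
  qed
  have "(\<lambda>x. F x * of_real (p (ek 1 x)) * ek k x)
      = (\<lambda>x. a * (F x * ek (k + 1) x) + b * (F x * ek (k - 1) x))"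
    by (intro ext, simp only: p ek_add[of k 1] ek_add[of k "-1", simplified] cnj_ek)
      (simp add: algebra_simps)
  moreover have "integral {0..2 * pi} (\<lambda>x. a * (F x * ek (k + 1) x) + b * (F x * ek (k - 1) x))
      = a * integral {0..2 * pi} (\<lambda>x. F x * ek (k + 1) x)
      + b * integral {0..2 * pi} (\<lambda>x. F x * ek (k - 1) x)"
    by (subst integral_add)
      (auto intro!: integrable_continuous_real continuous_intros lin(2))
  ultimately show ?case using lin(3) by simp
next
  case (const c)
  have "integral {0..2 * pi} (\<lambda>x. of_real c * (F x * ek k x)) = 0"
    using const by simp
  then show ?case by (simp add: mult_ac)
next
  case (add p q)
  have c: "continuous_on {0..2 * pi} (\<lambda>x. p (ek 1 x))" "continuous_on {0..2 * pi} (\<lambda>x. q (ek 1 x))"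
    using add.hyps continuous_real_polymonial_function
    by (auto intro!: continuous_on_compose2[OF continuous_at_imp_continuous_on continuous_on_ek, of UNIV])
  have "(\<lambda>x. F x * of_real (p (ek 1 x) + q (ek 1 x)) * ek k x)
    = (\<lambda>x. F x * of_real (p (ek 1 x)) * ek k x + F x * of_real (q (ek 1 x)) * ek k x)"
    by (simp add: algebra_simps)
  moreover have "integral {0..2 * pi} \<dots> = 0"
    using add.IH[OF add.prems] add.prems
    by (subst integral_add) (auto intro!: integrable_continuous_real continuous_intros c)
  ultimately show ?case by simp
next
  case (mult p q)
  have c: "continuous_on {0..2 * pi} (\<lambda>x. p (ek 1 x))"
    using mult.hyps continuous_real_polymonial_function
    by (auto intro!: continuous_on_compose2[OF continuous_at_imp_continuous_on continuous_on_ek, of UNIV])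
  have "integral {0..2 * pi} (\<lambda>x. (F x * of_real (p (ek 1 x))) * of_real (q (ek 1 x)) * ek k x) = 0"
    using mult.prems by (intro mult.IH(2) mult.IH(1)) (auto intro!: continuous_intros c)
  then show ?case by (simp add: mult_ac)
qed

lemma le_0_if_le_mult:
  fixes x K :: real
  assumes "\<And>e. e > 0 \<Longrightarrow> x \<le> e * K"
  shows "x \<le> 0"
proof (rule field_le_epsilon)
  fix e :: real assume "e > 0"
  then have "x \<le> e / (\<bar>K\<bar> + 1) * K" by (intro assms) (simp add: add_nonneg_pos)
  also have "\<dots> \<le> e"
    using \<open>e > 0\<close> by (simp add: divide_le_eq add_nonneg_pos)
  finally show "x \<le> 0 + e" by simp
qed

text \<open>
  A periodic function factors through the circle, where Stone--Weierstrass provides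
  approximation by polynomials in \<open>Re z\<close> and \<open>Im z\<close>.
\<close>

lemma fourier_unique_0:
  assumes F: "cont_periodic F" and z: "\<And>k. integral {0..2 * pi} (\<lambda>x. F x * ek k x) = 0"
  shows "F x = 0"
proof -
  note Fc = cont_periodicD(1)[OF F] and Fp = cont_periodicD(2)[OF F]
  \<comment> \<open>The conjugate of \<open>F\<close> as a function on the circle; periodicity makes
    the choice of angle irrelevant there, and the values off the circle are arbitrary.\<close>
  define G where "G w = cnj (F (SOME x. w = ek 1 x))" for w
  have G: "G (ek 1 x) = cnj (F x)" for x
  proof -
    define y where "y = (SOME y. ek 1 x = ek 1 y)"
    have "ek 1 x = ek 1 y" unfolding y_def by (rule someI) simp
    then obtain n :: int where "\<i> * of_real x = \<i> * of_real y + of_int (2 * n) * pi * \<i>"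
      by (auto simp: ek_def exp_eq)
    then have "x = y + 2 * pi * of_int n" by (simp add: complex_eq_iff)
    then show ?thesis using periodic_2pi_int[OF Fp, of y n] by (simp add: G_def y_def)
  qed
  have circle: "\<exists>x\<in>{0..2 * pi}. w = ek 1 x" if "w \<in> sphere 0 1" for w
  proof -
    have "w = ek 1 (Arg2pi w)"
      using that Arg2pi_eq[of w] by (simp add: ek_def)
    then show ?thesis using Arg2pi[of w] by (metis atLeastAtMost_iff less_imp_le)
  qed
  \<comment> \<open>The exponential on the compact interval is a quotient map: preimages under
    \<open>G\<close> of closed sets are images of compact sets.\<close>
  have Gc: "continuous_on (sphere 0 1) G"
    unfolding continuous_on_closed_vimage[OF closed_sphere]
  proof (intro allI impI)
    fix C :: "complex set" assume C: "closed C"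
    have eq: "G -` C \<inter> sphere 0 1 = ek 1 ` ((\<lambda>x. cnj (F x)) -` C \<inter> {0..2 * pi})"
    proof (intro set_eqI iffI)
      fix w assume "w \<in> G -` C \<inter> sphere 0 1"
      then show "w \<in> ek 1 ` ((\<lambda>x. cnj (F x)) -` C \<inter> {0..2 * pi})"
        using circle[of w] G by auto
    qed (auto simp: G)
    have "closed ((\<lambda>x. cnj (F x)) -` C \<inter> {0..2 * pi})"
      by (rule continuous_on_closed_vimage[OF closed_atLeastAtMost, THEN iffD1, rule_format, OF _ C])
        (intro continuous_intros Fc)
    then have "compact ((\<lambda>x. cnj (F x)) -` C \<inter> {0..2 * pi})"
      by (simp add: compact_eq_bounded_closed bounded_Int)
    then show "closed (G -` C \<inter> sphere 0 1)"
      unfolding eq by (intro compact_imp_closed compact_continuous_image continuous_on_ek)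
  qed
  obtain B where B: "\<And>x. cmod (F x) \<le> B" using periodic_2pi_bounded[OF Fp Fc] by blast
  have B0: "B \<ge> 0" using B[of 0] norm_ge_zero order_trans by blast
  \<comment> \<open>\<open>I\<close> is the integral of |F|^2. Since \<open>F\<close> is orthogonal
    to polynomials on the circle, \<open>cnj (F x)\<close> may be replaced by its error of
    approximation.\<close>
  define I where "I = integral {0..2 * pi} (\<lambda>x. F x * cnj (F x))"
  have "cmod I \<le> e * (2 * pi * B)" if e: "e > 0" for e
  proof -
    obtain g where g: "polynomial_function g" "\<And>w. w \<in> sphere 0 1 \<Longrightarrow> cmod (G w - g w) < e"
      using Stone_Weierstrass_polynomial_function[OF compact_sphere Gc e] by blast
    have gc: "continuous_on UNIV (\<lambda>x. g (ek 1 x))"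
      using g(1) by (intro continuous_on_compose2[OF continuous_on_polymonial_function continuous_on_ek]) auto
    have re: "real_polynomial_function (Re \<circ> g)" "real_polynomial_function (Im \<circ> g)"
      using g(1) bounded_linear_Re bounded_linear_Im unfolding polynomial_function_def by auto
    have cri: "continuous_on {0..2 * pi} (\<lambda>x. Re (g (ek 1 x)))" "continuous_on {0..2 * pi} (\<lambda>x. Im (g (ek 1 x)))"
      by (intro continuous_intros continuous_on_subset[OF gc]; simp)+
    have "integral {0..2 * pi} (\<lambda>x. F x * g (ek 1 x))
        = integral {0..2 * pi} (\<lambda>x. F x * of_real ((Re \<circ> g) (ek 1 x)) * ek 0 x
            + \<i> * (F x * of_real ((Im \<circ> g) (ek 1 x)) * ek 0 x))"
      by (intro integral_cong) (simp add: complex_eq_iff algebra_simps)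
    also have "\<dots> = 0"
      using real_poly_circle_orthogonal[OF re(1) Fc z, of 0] real_poly_circle_orthogonal[OF re(2) Fc z, of 0]
      by (subst integral_add)
        (auto intro!: integrable_continuous_real continuous_intros Fc cri simp: o_def)
    finally have "I = integral {0..2 * pi} (\<lambda>x. F x * cnj (F x) - F x * g (ek 1 x))"
      unfolding I_def
      by (subst integral_diff)
        (auto intro!: integrable_cont_mult continuous_intros Fc continuous_on_subset[OF gc])
    also have "cmod \<dots> \<le> (B * e) * (2 * pi - 0)"
    proof (rule integral_bound)
      show "continuous_on {0..2 * pi} (\<lambda>x. F x * cnj (F x) - F x * g (ek 1 x))"
        by (intro continuous_intros Fc continuous_on_subset[OF gc]) auto
      fix x
      have "cmod (F x * cnj (F x) - F x * g (ek 1 x)) = cmod (F x) * cmod (G (ek 1 x) - g (ek 1 x))"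
        by (simp add: G norm_mult flip: right_diff_distrib)
      also have "\<dots> \<le> B * e"
        using g(2)[of "ek 1 x"] by (intro mult_mono B) (auto simp: B0)
      finally show "cmod (F x * cnj (F x) - F x * g (ek 1 x)) \<le> B * e" .
    qed simp
    finally show ?thesis by (simp add: mult_ac)
  qed
  then have "cmod I \<le> 0" by (rule le_0_if_le_mult)
  then have "I = 0" by simp
  moreover have "I = of_real (integral {0..2 * pi} (\<lambda>x. (cmod (F x))\<^sup>2))"
    unfolding I_def complex_norm_square[symmetric]
    by (rule integral_unique[OF has_integral_of_real[OF integrable_integral]])
      (intro integrable_continuous_real continuous_intros Fc)
  ultimately have "integral {0..2 * pi} (\<lambda>x. (cmod (F x))\<^sup>2) = 0" by simp
  moreover have "integral {0..2 * pi} (\<lambda>x. (cmod (F x))\<^sup>2) = 0 \<longleftrightarrow> (\<forall>x\<in>{0..2 * pi}. (cmod (F x))\<^sup>2 = 0)"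
    by (rule integral_eq_0_iff) (auto intro!: continuous_intros Fc)
  ultimately have "\<And>x. x \<in> {0..2 * pi} \<Longrightarrow> F x = 0" by simp
  then show ?thesis using periodic_2pi_reduce[OF Fp, of x] by metis
qed

lemma fourier_unique:
  assumes "cont_periodic F" "cont_periodic G" "\<And>k. fc F k = fc G k"
  shows "F = G"
proof
  fix x
  have "F x - G x = 0"
  proof (rule fourier_unique_0[OF cont_periodic_diff[OF assms(1,2)]])
    fix k
    have "integral {0..2 * pi} (\<lambda>x. F x * ek k x) = integral {0..2 * pi} (\<lambda>x. G x * ek k x)"
      using assms(3)[of "- k"] by (simp add: fc_def)
    then show "integral {0..2 * pi} (\<lambda>x. (F x - G x) * ek k x) = 0"
      unfolding left_diff_distrib using assms
      by (subst integral_diff) (auto intro!: integrable_cont_mult continuous_intros cont_periodicD)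
  qed
  then show "F x = G x" by simp
qed

section \<open>Absolutely convergent Fourier series\<close>

definition ser :: "(int \<Rightarrow> complex) \<Rightarrow> real \<Rightarrow> complex" where
  "ser c x = (\<Sum>\<^sub>\<infinity>k. c k * ek k x)"

definition l1 :: "(int \<Rightarrow> complex) \<Rightarrow> bool" where
  "l1 c \<longleftrightarrow> (\<lambda>k. cmod (c k)) summable_on UNIV"

lemma ser_uniform_limit:
  assumes "l1 c"
  shows "uniform_limit S (\<lambda>J x. \<Sum>k\<in>J. c k * ek k x) (ser c) (finite_subsets_at_top UNIV)"
  unfolding ser_def
  by (rule Weierstrass_m_test_general[where M="\<lambda>k. cmod (c k)"])
    (use assms in \<open>auto simp: norm_mult l1_def\<close>)

lemma cont_periodic_ser:
  assumes "l1 c"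
  shows "cont_periodic (ser c)"
proof -
  have "continuous_on UNIV (ser c)"
    by (rule uniform_limit_theorem[OF _ ser_uniform_limit[OF assms]])
      (auto intro!: always_eventually continuous_intros)
  moreover have "periodic_2pi (ser c)"
    using ek_periodic by (simp add: periodic_2pi_def ser_def)
  ultimately show ?thesis by (simp add: cont_periodic_def)
qed

text \<open>Only one factor has to be an absolutely convergent series: its uniform convergence
  permits integrating term by term, and each exponential shifts the coefficients of
  \<open>G\<close>. The choice \<open>G = 1\<close> shows that \<open>ser c\<close> has coefficients
  \<open>c\<close>; a second series gives the convolution rule for products.\<close>

lemma fc_ser_mult:
  assumes c: "l1 c" and G: "cont_periodic G"
  shows "fc (\<lambda>x. ser c x * G x) k = conv c (fc G) k"
proof -
  obtain B where B: "\<And>x. cmod (G x) \<le> B"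
    using periodic_2pi_bounded[OF cont_periodicD(2)[OF G] cont_periodicD(1)[OF G]] by blast
  let ?f = "\<lambda>J x. (\<Sum>j\<in>J. c j * ek j x) * (G x * ek (- k) x)"
  have "uniform_limit {0..2 * pi} ?f (\<lambda>x. ser c x * (G x * ek (- k) x)) (finite_subsets_at_top UNIV)"
  proof (rule uniform_lim_mult[OF ser_uniform_limit[OF c] uniform_limit_const])
    show "bounded (ser c ` {0..2 * pi})"
      by (intro compact_imp_bounded compact_continuous_image cont_periodicD cont_periodic_ser c) simp
    show "bounded ((\<lambda>x. G x * ek (- k) x) ` {0..2 * pi})"
      using B by (auto simp: bounded_iff norm_mult)
  qed
  moreover have "continuous_on {0..2 * pi} (?f J)" for J
    by (intro continuous_intros cont_periodicD[OF G])
  ultimately obtain I J where IJ: "\<And>A. (?f A has_integral I A) {0..2 * pi}"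
    "((\<lambda>x. ser c x * (G x * ek (- k) x)) has_integral J) {0..2 * pi}"
    "(I \<longlongrightarrow> J) (finite_subsets_at_top UNIV)"
    by (rule uniform_limit_integral) auto
  \<comment> \<open>Infinite \<open>A\<close> are included, where both sides are 0, so that
    \<open>I\<close> equals \<open>sum\<close> as a function, as \<open>has_sum_def\<close>
    requires.\<close>
  have "I A = (\<Sum>j\<in>A. 2 * pi * (c j * fc G (k - j)))" for A
  proof -
    have e: "ek (- (k - j)) x = ek j x * ek (- k) x" for j x
      using ek_add[of j "- k" x] by simp
    have "?f A = (\<lambda>x. \<Sum>j\<in>A. c j * (G x * ek (- (k - j)) x))"
      unfolding e sum_distrib_right by (intro ext sum.cong) (auto simp: mult_ac)
    then have "I A = integral {0..2 * pi} (\<lambda>x. \<Sum>j\<in>A. c j * (G x * ek (- (k - j)) x))"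
      using integral_unique[OF IJ(1)[of A]] by simp
    also have "\<dots> = (\<Sum>j\<in>A. integral {0..2 * pi} (\<lambda>x. c j * (G x * ek (- (k - j)) x)))"
      by (cases "finite A", rule integral_sum)
        (auto intro!: integrable_continuous_real continuous_intros cont_periodicD[OF G])
    finally show ?thesis by (simp add: fc_def)
  qed
  then have "I = sum (\<lambda>j. 2 * pi * (c j * fc G (k - j)))" by (rule ext)
  then have "((\<lambda>j. 2 * pi * (c j * fc G (k - j))) has_sum J) UNIV"
    using IJ(3) by (simp add: has_sum_def)
  then have "((\<lambda>j. 1 / (2 * pi) * (2 * pi * (c j * fc G (k - j)))) has_sum 1 / (2 * pi) * J) UNIV"
    by (rule has_sum_cmult_right)
  moreover have "(\<lambda>j. 1 / (2 * pi) * (2 * pi * (c j * fc G (k - j)))) = (\<lambda>j. c j * fc G (k - j))" by simp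
  ultimately have "conv c (fc G) k = 1 / (2 * pi) * J"
    unfolding conv_def by (metis infsumI)
  then show ?thesis
    using integral_unique[OF IJ(2)] by (simp add: fc_def mult.assoc)
qed

lemma fc_one: "fc (\<lambda>x. 1) k = (if k = 0 then 1 else 0)"
  using integral_ek[of "- k"] by (simp add: fc_def)

lemma fc_ser:
  assumes "l1 c"
  shows "fc (ser c) k = c k"
proof -
  have "fc (ser c) k = (\<Sum>\<^sub>\<infinity>j. c j * fc (\<lambda>x. 1) (k - j))"
    using fc_ser_mult[OF assms, of "\<lambda>x. 1"]
    by (simp add: cont_periodic_def periodic_2pi_def conv_def)
  also have "\<dots> = (\<Sum>\<^sub>\<infinity>j\<in>{k}. c j * fc (\<lambda>x. 1) (k - j))"
    by (rule infsum_cong_neutral) (auto simp: fc_one)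
  finally show ?thesis by (simp add: fc_one)
qed

lemma fc_bound:
  assumes "\<And>x. cmod (F x) \<le> B" "cont_periodic F"
  shows "cmod (fc F k) \<le> B"
proof -
  have "cmod (integral {0..2 * pi} (\<lambda>x. F x * ek (- k) x)) \<le> B * (2 * pi - 0)"
    using assms(1)
    by (intro integral_bound continuous_intros cont_periodicD assms) (auto simp: norm_mult)
  then show ?thesis by (simp add: fc_def norm_mult norm_divide field_simps)
qed

section \<open>Distributions are determined by their Fourier coefficients\<close>

lemma test_has_vector_derivative:
  "\<phi> \<in> test_functions \<Longrightarrow> (\<phi> has_vector_derivative fun_deriv \<phi> x) (at x within S)"
  unfolding fun_deriv_def
  by (meson has_vector_derivative_at_within test_functionsD(3) vector_derivative_works)

lemma fc_fun_deriv:
  assumes "\<phi> \<in> test_functions"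
  shows "fc (fun_deriv \<phi>) k = \<i> * of_int k * fc \<phi> k"
proof -
  note cont = test_functions_continuous[OF assms] test_functions_continuous[OF test_functions_fun_deriv[OF assms]]
  have per: "\<phi> (2 * pi) = \<phi> 0"
    using test_functionsD(1)[OF assms] by (metis add_0 periodic_2pi_def)
  have "((\<lambda>x. \<phi> x * (\<i> * of_int (- k) * ek (- k) x) + fun_deriv \<phi> x * ek (- k) x)
      has_integral \<phi> (2 * pi) * ek (- k) (2 * pi) - \<phi> 0 * ek (- k) 0) {0..2 * pi}"
    by (intro fundamental_theorem_of_calculus has_vector_derivative_mult
        ek_has_vector_derivative test_has_vector_derivative assms) simp
  then have "integral {0..2 * pi} (\<lambda>x. \<phi> x * (\<i> * of_int (- k) * ek (- k) x) + fun_deriv \<phi> x * ek (- k) x) = 0"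
    by (simp add: per integral_unique)
  also have "integral {0..2 * pi} (\<lambda>x. \<phi> x * (\<i> * of_int (- k) * ek (- k) x) + fun_deriv \<phi> x * ek (- k) x)
      = integral {0..2 * pi} (\<lambda>x. (\<i> * of_int (- k)) * (\<phi> x * ek (- k) x))
      + integral {0..2 * pi} (\<lambda>x. fun_deriv \<phi> x * ek (- k) x)"
    by (subst integral_add)
      (auto intro!: integrable_continuous_real continuous_intros cont simp: mult_ac)
  also have "integral {0..2 * pi} (\<lambda>x. (\<i> * of_int (- k)) * (\<phi> x * ek (- k) x))
      = (\<i> * of_int (- k)) * integral {0..2 * pi} (\<lambda>x. \<phi> x * ek (- k) x)"
    by (rule integral_mult_right)
  finally have "integral {0..2 * pi} (\<lambda>x. fun_deriv \<phi> x * ek (- k) x)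
      = \<i> * of_int k * integral {0..2 * pi} (\<lambda>x. \<phi> x * ek (- k) x)"
    by (simp add: add_eq_0_iff)
  then show ?thesis by (simp add: fc_def)
qed

text \<open>Two integrations by parts bound \<open>(1 + k\<^sup>2) * cmod (fc \<phi> k)\<close> by
  suprema of \<open>\<phi>\<close> and its second derivative, and the inverse of this weight is
  summable.\<close>

lemma l1_fc_test:
  assumes "\<phi> \<in> test_functions"
  shows "l1 (fc \<phi>)"
proof -
  let ?\<phi>2 = "fun_deriv (fun_deriv \<phi>)"
  have t2: "?\<phi>2 \<in> test_functions" by (intro test_functions_fun_deriv assms)
  obtain B where B: "\<And>x. cmod (\<phi> x) \<le> B"
    using periodic_2pi_bounded[OF test_functionsD(1)[OF assms] test_functions_continuous[OF assms]] by blast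
  obtain B2 where B2: "\<And>x. cmod (?\<phi>2 x) \<le> B2"
    using periodic_2pi_bounded[OF test_functionsD(1)[OF t2] test_functions_continuous[OF t2]] by blast
  have le: "cmod (fc \<phi> k) \<le> (B + B2) * (wt (- 1) k)\<^sup>2" for k
  proof -
    have "fc ?\<phi>2 k = - (of_int k)\<^sup>2 * fc \<phi> k"
      by (simp add: fc_fun_deriv test_functions_fun_deriv assms power2_eq_square algebra_simps)
    then have "cmod (fc ?\<phi>2 k) = (of_int k)\<^sup>2 * cmod (fc \<phi> k)"
      by (simp add: norm_mult norm_power)
    then have "(1 + (of_int k)\<^sup>2) * cmod (fc \<phi> k) \<le> B + B2"
      using fc_bound[OF B cont_periodic_test[OF assms], of k]
        fc_bound[OF B2 cont_periodic_test[OF t2], of k] by (simp add: distrib_right)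
    moreover have "(wt (- 1) k)\<^sup>2 * (1 + (of_int k)\<^sup>2) = 1"
      using wt_cancel(1)[of 2 k] by (simp add: power2_eq_square wt_mult wt_2)
    then have "cmod (fc \<phi> k) = (wt (- 1) k)\<^sup>2 * ((1 + (of_int k)\<^sup>2) * cmod (fc \<phi> k))"
      by (simp flip: mult.assoc)
    ultimately show ?thesis
      by (metis mult.commute mult_left_mono zero_le_power2)
  qed
  have "(\<lambda>k. (B + B2) * (wt (- 1) k)\<^sup>2) summable_on UNIV"
    by (intro summable_on_cmult_right wt_summable) simp
  then show ?thesis unfolding l1_def
    by (rule summable_on_comparison_test) (auto simp: le)
qed

lemma test_eq_ser: "\<phi> \<in> test_functions \<Longrightarrow> \<phi> = ser (fc \<phi>)"
  by (rule fourier_unique)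
    (auto intro: cont_periodic_test cont_periodic_ser l1_fc_test simp: fc_ser l1_fc_test)

lemma test_functions_sum:
  "finite J \<Longrightarrow> (\<lambda>x. \<Sum>k\<in>J. c k * ek k x) \<in> test_functions"
proof (induction J rule: finite_induct)
  case empty
  show ?case using test_functions_mult_left[OF ek_test, of 0 0] by simp
next
  case (insert k J)
  then show ?case using test_functions_add[OF test_functions_mult_left[OF ek_test, of "c k" k]] by simp
qed

text \<open>Differentiation commutes with partial Fourier sums, so each seminorm of the remainder is
  controlled by remainders of absolutely convergent series.\<close>

lemma funpow_deriv_remainder:
  assumes "\<phi> \<in> test_functions" "finite J"
  shows "(fun_deriv ^^ n) (\<lambda>x. \<phi> x - (\<Sum>k\<in>J. fc \<phi> k * ek k x))
    = (\<lambda>x. (fun_deriv ^^ n) \<phi> x - (\<Sum>k\<in>J. fc ((fun_deriv ^^ n) \<phi>) k * ek k x))"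
proof (induction n)
  case (Suc n)
  let ?\<phi> = "(fun_deriv ^^ n) \<phi>"
  have t: "?\<phi> \<in> test_functions" by (rule test_functions_funpow[OF assms(1)])
  have "((\<lambda>x. ?\<phi> x - (\<Sum>k\<in>J. fc ?\<phi> k * ek k x)) has_vector_derivative
      fun_deriv ?\<phi> x - (\<Sum>k\<in>J. fc ?\<phi> k * (\<i> * of_int k * ek k x))) (at x)" for x
    by (intro has_vector_derivative_diff test_has_vector_derivative t has_vector_derivative_sum
        has_vector_derivative_mult_right ek_has_vector_derivative)
  then have "fun_deriv (\<lambda>x. ?\<phi> x - (\<Sum>k\<in>J. fc ?\<phi> k * ek k x))
      = (\<lambda>x. fun_deriv ?\<phi> x - (\<Sum>k\<in>J. fc ?\<phi> k * (\<i> * of_int k * ek k x)))"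
    unfolding fun_deriv_def by (intro ext vector_derivative_at)
  then show ?case unfolding funpow.simps comp_def Suc fc_fun_deriv[OF t] by (simp add: mult_ac)
qed simp

lemma pairing_add: "\<phi> \<in> test_functions \<Longrightarrow> \<eta> \<in> test_functions \<Longrightarrow>
    pairing u (\<lambda>x. \<phi> x + \<eta> x) = pairing u \<phi> + pairing u \<eta>"
  and pairing_mult: "\<phi> \<in> test_functions \<Longrightarrow> pairing u (\<lambda>x. c * \<phi> x) = c * pairing u \<phi>"
  using pairing[of u] by auto

lemma fcoeff_ek: "fcoeff u k = 1 / (2 * pi) * pairing u (ek (- k))"
proof -
  have "(\<lambda>x. exp (- (\<i> * of_int k * complex_of_real x))) = ek (- k)"
    by (auto simp: ek_def)
  then show ?thesis by (simp add: fcoeff_def)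
qed

text \<open>Continuity bounds \<open>w\<close> by a seminorm of some finite order \<open>N\<close>,
  and partial Fourier sums of a test function converge in that seminorm. As \<open>w\<close>
  vanishes on trigonometric polynomials, it vanishes on their limit.\<close>

lemma fcoeff_eq_0_imp:
  assumes "\<And>k. fcoeff w k = 0"
  shows "w = 0"
proof (rule pdist_eqI)
  fix \<phi> assume \<phi>: "\<phi> \<in> test_functions"
  have w: "pairing w (ek k) = 0" for k using assms[of "- k"] by (simp add: fcoeff_ek)
  have "\<exists>C N. \<forall>\<phi>\<in>test_functions. cmod (pairing w \<phi>) \<le> C * test_seminorm N \<phi>"
    using pairing[of w] by simp
  then obtain C N where CN: "\<And>\<phi>. \<phi> \<in> test_functions \<Longrightarrow> cmod (pairing w \<phi>) \<le> C * test_seminorm N \<phi>"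
    by blast
  have sumz: "pairing w (\<lambda>x. \<Sum>k\<in>J. c k * ek k x) = 0" if "finite J" for J c
    using that
  proof (induction J rule: finite_induct)
    case empty
    show ?case using pairing_mult[OF ek_test, of w 0 0] by simp
  next
    case (insert k J)
    then show ?case
      using pairing_add[OF test_functions_mult_left[OF ek_test] test_functions_sum, of J w "c k" k c]
      by (simp add: pairing_mult ek_test w)
  qed
  have "cmod (pairing w \<phi>) \<le> e * (\<bar>C\<bar> * real (Suc N))" if e: "e > 0" for e
  proof -
    \<comment> \<open>One finite set of frequencies must serve all derivatives up to order
      \<open>N\<close>; the \<open>N + 1\<close> errors explain the factor
      \<open>Suc N\<close>.\<close>
    have ev: "\<forall>\<^sub>F J in finite_subsets_at_top UNIV. finite J \<and> (\<forall>n\<in>{..N}. \<forall>x\<in>UNIV.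
        dist (\<Sum>k\<in>J. fc ((fun_deriv ^^ n) \<phi>) k * ek k x) (ser (fc ((fun_deriv ^^ n) \<phi>)) x) < e)"
      using ser_uniform_limit[OF l1_fc_test[OF test_functions_funpow[OF \<phi>]], where S=UNIV]
      by (intro eventually_conj eventually_finite_subsets_at_top_weakI eventually_ball_finite)
        (auto simp: uniform_limit_iff e)
    obtain J where J: "finite J" "\<And>n x. n \<le> N \<Longrightarrow>
        dist (\<Sum>k\<in>J. fc ((fun_deriv ^^ n) \<phi>) k * ek k x) (ser (fc ((fun_deriv ^^ n) \<phi>)) x) < e"
      using eventually_happens'[OF finite_subsets_at_top_neq_bot ev] by auto
    define r where "r = (\<lambda>x. \<phi> x - (\<Sum>k\<in>J. fc \<phi> k * ek k x))"
    have rt: "r \<in> test_functions"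
      using test_functions_add[OF \<phi> test_functions_mult_left[OF test_functions_sum[OF J(1)], of "-1"]]
      by (simp add: r_def)
    have "pairing w \<phi> = pairing w (\<lambda>x. r x + (\<Sum>k\<in>J. fc \<phi> k * ek k x))" by (simp add: r_def)
    also have "\<dots> = pairing w r"
      using pairing_add[OF rt test_functions_sum[OF J(1)]] by (simp add: sumz J(1))
    finally have "cmod (pairing w \<phi>) \<le> C * test_seminorm N r" using CN[OF rt] by simp
    also have "\<dots> \<le> \<bar>C\<bar> * test_seminorm N r"
      by (intro mult_right_mono test_seminorm_nonneg rt) simp
    finally have wr: "cmod (pairing w \<phi>) \<le> \<bar>C\<bar> * test_seminorm N r" .
    have "test_seminorm N r \<le> (\<Sum>n\<le>N. e)"
      unfolding test_seminorm_def
    proof (intro sum_mono cSUP_least)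
      fix n x assume n: "n \<in> {..N}"
      have "(fun_deriv ^^ n) r x = ser (fc ((fun_deriv ^^ n) \<phi>)) x
          - (\<Sum>k\<in>J. fc ((fun_deriv ^^ n) \<phi>) k * ek k x)"
        unfolding r_def funpow_deriv_remainder[OF \<phi> J(1)]
        by (subst test_eq_ser[OF test_functions_funpow[OF \<phi>]]) simp
      then show "cmod ((fun_deriv ^^ n) r x) \<le> e"
        using J(2)[of n x] n by (simp add: dist_norm norm_minus_commute)
    qed simp
    then have "\<bar>C\<bar> * test_seminorm N r \<le> \<bar>C\<bar> * (\<Sum>n\<le>N. e)" by (intro mult_left_mono) auto
    with wr show ?thesis by (simp add: mult_ac)
  qed
  then have "cmod (pairing w \<phi>) \<le> 0" by (rule le_0_if_le_mult)
  then show "pairing w \<phi> = pairing 0 \<phi>" by (simp add: zero_pdist.rep_eq)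
qed

section \<open>Fourier coefficients of distributions\<close>

lemma fcoeff_add [simp]: "fcoeff (u + v) k = fcoeff u k + fcoeff v k"
  by (simp add: fcoeff_def plus_pdist.rep_eq distrib_left add_divide_distrib)

lemma fcoeff_cscale [simp]: "fcoeff (c *\<^sub>C u) k = c * fcoeff u k"
  by (simp add: fcoeff_def cscale.rep_eq)

lemma fcoeff_uminus [simp]: "fcoeff (- u) k = - fcoeff u k"
  by (simp add: uminus_pdist_def)

lemma fcoeff_diff [simp]: "fcoeff (u - v) k = fcoeff u k - fcoeff v k"
  unfolding minus_pdist_def fcoeff_add fcoeff_uminus by simp

lemma fcoeff_scaleR [simp]: "fcoeff (r *\<^sub>R u) k = r *\<^sub>R fcoeff u k"
  unfolding scaleR_pdist_def by (simp add: scaleR_conv_of_real)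

lemma fcoeff_eqI: "(\<And>k. fcoeff u k = fcoeff v k) \<Longrightarrow> u = v"
  using fcoeff_eq_0_imp[of "u - v"] by simp

lemma fcoeff_deriv [simp]: "fcoeff (\<partial>\<^sub>x u) k = \<i> * of_int k * fcoeff u k"
  using pairing_mult[OF ek_test, of u "\<i> * of_int (- k)" "- k"]
  by (simp add: fcoeff_ek pd_deriv.rep_eq ek_test fun_deriv_ek)

lemma fcoeff_cnj [simp]: "fcoeff (pd_cnj u) k = cnj (fcoeff u (- k))"
  by (simp add: fcoeff_ek pd_cnj.rep_eq ek_test)

lemma fcoeff_pd_of_fun: "cont_periodic F \<Longrightarrow> fcoeff (pd_of_fun F) k = fc F k"
  by (simp add: fcoeff_ek pd_of_fun.rep_eq ek_test fc_def)

text \<open>Justifies the definite description in \<open>pd_fun\<close>: a continuous representative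
  is determined by its Fourier coefficients.\<close>

lemma pd_fun_of_fun:
  assumes "cont_periodic F"
  shows "pd_fun (pd_of_fun F) = F"
  unfolding pd_fun_def
proof (rule the_equality)
  fix G assume G: "cont_periodic G \<and> pd_of_fun G = pd_of_fun F"
  then show "G = F"
    using fcoeff_pd_of_fun assms by (metis fourier_unique)
qed (use assms in simp)

lemma pd_of_fun_ser: "l1 (fcoeff u) \<Longrightarrow> pd_of_fun (ser (fcoeff u)) = u"
  by (rule fcoeff_eqI) (simp add: fcoeff_pd_of_fun cont_periodic_ser fc_ser)

lemma pd_fun_eq_ser: "l1 (fcoeff u) \<Longrightarrow> pd_fun u = ser (fcoeff u)"
  using pd_fun_of_fun[OF cont_periodic_ser] pd_of_fun_ser by metis

lemma fcoeff_mult: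
  assumes "l1 (fcoeff u)" "l1 (fcoeff v)"
  shows "fcoeff (u \<odot> v) k = conv (fcoeff u) (fcoeff v) k"
proof -
  have "fcoeff (u \<odot> v) k = fc (\<lambda>x. ser (fcoeff u) x * ser (fcoeff v) x) k"
    by (simp add: pd_mult_def pd_fun_eq_ser assms fcoeff_pd_of_fun cont_periodic_mult cont_periodic_ser)
  also have "\<dots> = conv (fcoeff u) (fc (ser (fcoeff v))) k"
    by (intro fc_ser_mult assms cont_periodic_ser)
  also have "fc (ser (fcoeff v)) = fcoeff v" by (intro ext fc_ser assms)
  finally show ?thesis .
qed

section \<open>Sobolev spaces as \<open>\<ell>\<^sup>2\<close>\<close>

definition emb :: "real \<Rightarrow> pdist \<Rightarrow> ell2" where
  "emb r u = mk_ell2 (\<lambda>k. of_real (wt r k) * fcoeff u k)"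

lemma sobolev_iff: "u \<in> sobolev r \<longleftrightarrow> in_ell2 (\<lambda>k. of_real (wt r k) * fcoeff u k)"
  by (simp add: sobolev_def in_ell2_iff_summable norm_mult power_mult_distrib wt_square)

lemma comp_emb: "u \<in> sobolev r \<Longrightarrow> emb r u $$ k = of_real (wt r k) * fcoeff u k"
  by (simp add: emb_def sobolev_iff)

lemma coef_emb: "u \<in> sobolev r \<Longrightarrow> coef r (emb r u) k = fcoeff u k"
  by (simp add: coef_def comp_emb flip: mult.assoc of_real_mult)

lemma sobolev_norm_emb: "u \<in> sobolev r \<Longrightarrow> sobolev_norm r u = sqrt (2 * pi) * norm (emb r u)"
  by (simp add: sobolev_norm_def norm_ell2_infsum comp_emb norm_mult power_mult_distrib wt_square
      real_sqrt_mult)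

lemma emb_eq_iff: "u \<in> sobolev r \<Longrightarrow> v \<in> sobolev r \<Longrightarrow> emb r u = emb r v \<longleftrightarrow> u = v"
  using coef_emb by (metis fcoeff_eqI)

lemma sobolevI_emb:
  assumes "\<And>k. of_real (wt r k) * fcoeff u k = a $$ k"
  shows "u \<in> sobolev r \<and> emb r u = a"
proof -
  have *: "(\<lambda>k. of_real (wt r k) * fcoeff u k) = comp_ell2 a" using assms by auto
  then have "u \<in> sobolev r" by (simp add: sobolev_iff)
  moreover from this have "emb r u = a" by (intro ell2_eqI) (simp add: comp_emb assms)
  ultimately show ?thesis ..
qed

lemma emb_add:
  assumes "u \<in> sobolev r" "v \<in> sobolev r"
  shows "u + v \<in> sobolev r" "emb r (u + v) = emb r u + emb r v"
  using sobolevI_emb[of r "u + v" "emb r u + emb r v"] assms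
  by (simp_all add: comp_emb algebra_simps)

lemma emb_diff:
  assumes "u \<in> sobolev r" "v \<in> sobolev r"
  shows "u - v \<in> sobolev r" "emb r (u - v) = emb r u - emb r v"
  using sobolevI_emb[of r "u - v" "emb r u - emb r v"] assms
  by (simp_all add: comp_emb algebra_simps)

lemma emb_uminus:
  assumes "u \<in> sobolev r"
  shows "- u \<in> sobolev r" "emb r (- u) = - emb r u"
  using sobolevI_emb[of r "- u" "- emb r u"] assms
  by (simp_all add: comp_emb algebra_simps)

lemma emb_scaleR:
  assumes "u \<in> sobolev r"
  shows "c *\<^sub>R u \<in> sobolev r" "emb r (c *\<^sub>R u) = c *\<^sub>R emb r u"
  using sobolevI_emb[of r "c *\<^sub>R u" "c *\<^sub>R emb r u"] assms
  by (simp_all add: comp_emb scaleR_conv_of_real algebra_simps)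

definition cmult :: "complex \<Rightarrow> ell2 \<Rightarrow> ell2" where
  "cmult c = diag (\<lambda>_. c)"

lemma comp_cmult [simp]: "cmult c a $$ k = c * a $$ k"
  unfolding cmult_def by (rule comp_diag) (rule order_refl)

lemma bounded_linear_cmult: "bounded_linear (cmult c)"
  unfolding cmult_def by (rule bounded_linear_diag) (rule order_refl)

lemma emb_cscale:
  assumes "u \<in> sobolev r"
  shows "c *\<^sub>C u \<in> sobolev r" "emb r (c *\<^sub>C u) = cmult c (emb r u)"
  using sobolevI_emb[of r "c *\<^sub>C u" "cmult c (emb r u)"] assms
  by (simp_all add: comp_emb algebra_simps)

lemma emb_cnj:
  assumes "u \<in> sobolev r"
  shows "pd_cnj u \<in> sobolev r" "emb r (pd_cnj u) = cj (emb r u)"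
  using sobolevI_emb[of r "pd_cnj u" "cj (emb r u)"] assms
  by (simp_all add: comp_emb algebra_simps)

text \<open>
  In this representation \<open>down n\<close> is the embedding of \<open>H\<^sup>r\<close> into \<open>H\<^sup>r\<^sup>-\<^sup>n\<close>, and \<open>dx\<close> is the derivative
  as a map from \<open>H\<^sup>r\<close> to \<open>H\<^sup>r\<^sup>-\<^sup>1\<close>.
\<close>

definition down :: "real \<Rightarrow> ell2 \<Rightarrow> ell2" where
  "down n = diag (\<lambda>k. of_real (wt (- n) k))"

lemma comp_down: "n \<ge> 0 \<Longrightarrow> down n a $$ k = of_real (wt (- n) k) * a $$ k"
  unfolding down_def by (rule comp_diag[where C=1]) (simp add: wt_le_1)

lemma bounded_linear_down: "n \<ge> 0 \<Longrightarrow> bounded_linear (down n)"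
  unfolding down_def by (rule bounded_linear_diag[where C=1]) (simp add: wt_le_1)

lemma emb_down:
  assumes "u \<in> sobolev r" "n \<ge> 0" "r' = r - n"
  shows "u \<in> sobolev r'" "emb r' u = down n (emb r u)"
proof -
  have "of_real (wt r' k) * fcoeff u k = down n (emb r u) $$ k" for k
  proof -
    have "wt r' k = wt (- n) k * wt r k" by (simp add: assms(3) wt_mult)
    then show ?thesis using assms by (simp add: comp_down comp_emb)
  qed
  then show "u \<in> sobolev r'" "emb r' u = down n (emb r u)" using sobolevI_emb by auto
qed

definition dx :: "ell2 \<Rightarrow> ell2" where
  "dx = diag (\<lambda>k. \<i> * of_int k * of_real (wt (- 1) k))"

lemma dx_symbol_bound: "cmod (\<i> * of_int k * of_real (wt (- 1) k)) \<le> 1"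
proof -
  have "\<bar>of_int k\<bar> * wt (- 1) k \<le> wt 1 k * wt (- 1) k"
    by (intro mult_right_mono abs_le_wt_1) simp
  then show ?thesis by (simp add: norm_mult)
qed

lemma comp_dx: "dx a $$ k = \<i> * of_int k * of_real (wt (- 1) k) * a $$ k"
  unfolding dx_def by (rule comp_diag) (rule dx_symbol_bound)

lemma bounded_linear_dx: "bounded_linear dx"
  unfolding dx_def by (rule bounded_linear_diag) (rule dx_symbol_bound)

lemma emb_deriv:
  assumes "u \<in> sobolev r" "r' = r - 1"
  shows "\<partial>\<^sub>x u \<in> sobolev r'" "emb r' (\<partial>\<^sub>x u) = dx (emb r u)"
proof -
  have "of_real (wt r' k) * fcoeff (\<partial>\<^sub>x u) k = dx (emb r u) $$ k" for k
  proof -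
    have "wt r' k = wt (- 1) k * wt r k" by (simp add: assms(2) wt_mult)
    then show ?thesis using assms(1) by (simp add: comp_dx comp_emb)
  qed
  then show "\<partial>\<^sub>x u \<in> sobolev r'" "emb r' (\<partial>\<^sub>x u) = dx (emb r u)" using sobolevI_emb by auto
qed

lemma l1_coef: "r > 1 / 2 \<Longrightarrow> l1 (coef r a)"
  unfolding l1_def by (rule coef_l1)

lemma l1_fcoeff: "u \<in> sobolev r \<Longrightarrow> r > 1 / 2 \<Longrightarrow> l1 (fcoeff u)"
  using l1_coef[of r "emb r u"] by (simp add: coef_emb l1_def)

lemma emb_mult:
  assumes "u \<in> sobolev r" "v \<in> sobolev r" "r > 1 / 2"
  shows "u \<odot> v \<in> sobolev r" "emb r (u \<odot> v) = mul r (emb r u) (emb r v)"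
proof -
  have "coef r (emb r u) = fcoeff u" "coef r (emb r v) = fcoeff v"
    using assms by (auto simp: coef_emb)
  then have "of_real (wt r k) * fcoeff (u \<odot> v) k = mul r (emb r u) (emb r v) $$ k" for k
    using assms by (simp add: comp_mul fcoeff_mult l1_fcoeff)
  then show "u \<odot> v \<in> sobolev r" "emb r (u \<odot> v) = mul r (emb r u) (emb r v)" using sobolevI_emb by auto
qed

text \<open>Inverse of \<open>emb r\<close>, built from a continuous function and therefore used for
  r > 1/2 only. Solutions are reconstructed at the orders \<open>s\<close> and \<open>s + 1\<close>,
  both in this range.\<close>

definition dist_of :: "real \<Rightarrow> ell2 \<Rightarrow> pdist" where
  "dist_of r a = pd_of_fun (ser (coef r a))"

lemma dist_of:
  assumes "r > 1 / 2"
  shows "dist_of r a \<in> sobolev r" "emb r (dist_of r a) = a"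
proof -
  have "of_real (wt r k) * fcoeff (dist_of r a) k = a $$ k" for k
    using l1_coef[OF assms, of a]
    by (simp add: dist_of_def fcoeff_pd_of_fun cont_periodic_ser fc_ser)
      (simp add: coef_def flip: mult.assoc of_real_mult)
  then show "dist_of r a \<in> sobolev r" "emb r (dist_of r a) = a" using sobolevI_emb by auto
qed

text \<open>Transported from pointwise products of continuous functions, which avoids rearranging a
  double sum. It is needed to cancel the potential in the conservation law for |\<psi>|^2.\<close>

lemma mul_assoc:
  assumes r: "r > 1 / 2"
  shows "mul r (mul r a b) c = mul r a (mul r b c)"
proof -
  let ?S = "\<lambda>a. ser (coef r a)"
  have mul: "?S (mul r a b) = (\<lambda>x. ?S a x * ?S b x)" for a b
  proof (rule fourier_unique)
    fix k
    have "fc (\<lambda>x. ?S a x * ?S b x) k = conv (coef r a) (fc (?S b)) k"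
      by (intro fc_ser_mult l1_coef r cont_periodic_ser)
    also have "fc (?S b) = coef r b" by (intro ext fc_ser l1_coef r)
    finally show "fc (?S (mul r a b)) k = fc (\<lambda>x. ?S a x * ?S b x) k"
      by (simp add: fc_ser[OF l1_coef[OF r]] coef_mul[OF r])
  qed (intro cont_periodic_ser cont_periodic_mult l1_coef r)+
  have "?S (mul r (mul r a b) c) = ?S (mul r a (mul r b c))"
    by (simp add: mul mult.assoc)
  then have "emb r (dist_of r (mul r (mul r a b) c)) = emb r (dist_of r (mul r a (mul r b c)))"
    by (simp add: dist_of_def)
  then show ?thesis by (simp add: dist_of[OF r])
qed

lemma pd_real_iff: "u \<in> sobolev r \<Longrightarrow> pd_real u \<longleftrightarrow> cj (emb r u) = emb r u"
  unfolding pd_real_def by (metis emb_cnj emb_eq_iff)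

section \<open>Continuity and differentiability in Z, component by component\<close>

lemma has_vector_derivative_iff_quotient:
  "(f has_vector_derivative d) (at x within S) \<longleftrightarrow>
    ((\<lambda>y. norm ((f y - f x) /\<^sub>R (y - x) - d)) \<longlongrightarrow> 0) (at x within S)"
proof -
  have *: "norm ((f y - f x - (y - x) *\<^sub>R d) /\<^sub>R norm (y - x)) = norm ((f y - f x) /\<^sub>R (y - x) - d)"
    if "y \<noteq> x" for y
  proof -
    have "(f y - f x) /\<^sub>R (y - x) - d = (f y - f x - (y - x) *\<^sub>R d) /\<^sub>R (y - x)"
      using that by (simp add: scaleR_diff_right)
    then show ?thesis by simp
  qed
  have "(f has_vector_derivative d) (at x within S) \<longleftrightarrow>
      ((\<lambda>y. norm ((f y - f x - (y - x) *\<^sub>R d) /\<^sub>R norm (y - x))) \<longlongrightarrow> 0) (at x within S)"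
    unfolding has_vector_derivative_def has_derivative_within tendsto_norm_zero_iff
    by (simp add: bounded_linear_scaleR_left diff_diff_eq inverse_eq_divide)
  also have "\<dots> \<longleftrightarrow> ((\<lambda>y. norm ((f y - f x) /\<^sub>R (y - x) - d)) \<longlongrightarrow> 0) (at x within S)"
    by (intro Lim_cong_within refl *)
  finally show ?thesis .
qed

lemma tendsto_sum3_0_iff:
  fixes f g h :: "real \<Rightarrow> real"
  assumes "\<And>x. x \<in> S \<Longrightarrow> f x \<ge> 0 \<and> g x \<ge> 0 \<and> h x \<ge> 0" "c > 0"
  shows "((\<lambda>x. c * f x + c * g x + c * h x) \<longlongrightarrow> 0) (at t within S) \<longleftrightarrow>
    (f \<longlongrightarrow> 0) (at t within S) \<and> (g \<longlongrightarrow> 0) (at t within S) \<and> (h \<longlongrightarrow> 0) (at t within S)"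
proof
  assume A: "((\<lambda>x. c * f x + c * g x + c * h x) \<longlongrightarrow> 0) (at t within S)"
  then have "((\<lambda>x. inverse c * (c * f x + c * g x + c * h x)) \<longlongrightarrow> inverse c * 0) (at t within S)"
    by (rule tendsto_mult_left)
  moreover have "inverse c * (c * f x + c * g x + c * h x) = f x + g x + h x" for x
    using assms(2) by (simp add: distrib_left flip: mult.assoc)
  ultimately have B: "((\<lambda>x. f x + g x + h x) \<longlongrightarrow> 0) (at t within S)"
    by simp
  have "(q \<longlongrightarrow> 0) (at t within S)" if "\<And>x. x \<in> S \<Longrightarrow> 0 \<le> q x \<and> q x \<le> f x + g x + h x" for q
    by (rule tendsto_sandwich[OF _ _ tendsto_const B]) (use that in \<open>auto simp: eventually_at_filter\<close>)
  then show "(f \<longlongrightarrow> 0) (at t within S) \<and> (g \<longlongrightarrow> 0) (at t within S) \<and> (h \<longlongrightarrow> 0) (at t within S)"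
    using assms(1) by fastforce
next
  assume "(f \<longlongrightarrow> 0) (at t within S) \<and> (g \<longlongrightarrow> 0) (at t within S) \<and> (h \<longlongrightarrow> 0) (at t within S)"
  then have "((\<lambda>x. c * f x + c * g x + c * h x) \<longlongrightarrow> c * 0 + c * 0 + c * 0) (at t within S)"
    by (intro tendsto_intros) auto
  then show "((\<lambda>x. c * f x + c * g x + c * h x) \<longlongrightarrow> 0) (at t within S)" by simp
qed

definition emb1 :: "real \<Rightarrow> pdist \<times> pdist \<times> pdist \<Rightarrow> ell2" where "emb1 r \<Psi> = emb r (fst \<Psi>)"
definition emb2 :: "real \<Rightarrow> pdist \<times> pdist \<times> pdist \<Rightarrow> ell2" where "emb2 r \<Psi> = emb r (fst (snd \<Psi>))"
definition emb3 :: "real \<Rightarrow> pdist \<times> pdist \<times> pdist \<Rightarrow> ell2" where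
  "emb3 r \<Psi> = emb (r + 1) (snd (snd \<Psi>))"

lemma Zspace_iff: "\<Psi> \<in> Zspace r \<longleftrightarrow> fst \<Psi> \<in> sobolev r \<and>
    fst (snd \<Psi>) \<in> sobolev r \<and> cj (emb2 r \<Psi>) = emb2 r \<Psi> \<and>
    snd (snd \<Psi>) \<in> sobolev (r + 1) \<and> cj (emb3 r \<Psi>) = emb3 r \<Psi>"
  by (cases \<Psi>) (auto simp: Zspace_def pd_real_iff emb2_def emb3_def)

lemma Zspace_sobolev:
  "\<Psi> \<in> Zspace r \<Longrightarrow> fst \<Psi> \<in> sobolev r" "\<Psi> \<in> Zspace r \<Longrightarrow> fst (snd \<Psi>) \<in> sobolev r"
  "\<Psi> \<in> Zspace r \<Longrightarrow> snd (snd \<Psi>) \<in> sobolev (r + 1)"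
  by (auto simp: Zspace_iff)

lemma Znorm_diff:
  assumes "\<Psi> \<in> Zspace r" "\<Phi> \<in> Zspace r"
  shows "Znorm r (\<Psi> - \<Phi>) = sqrt (2 * pi) * norm (emb1 r \<Psi> - emb1 r \<Phi>)
    + sqrt (2 * pi) * norm (emb2 r \<Psi> - emb2 r \<Phi>) + sqrt (2 * pi) * norm (emb3 r \<Psi> - emb3 r \<Phi>)"
  using assms by (cases \<Psi>; cases \<Phi>)
    (simp add: Znorm_def Zspace_iff emb1_def emb2_def emb3_def sobolev_norm_emb emb_diff)

lemma Znorm_quotient:
  assumes "\<Psi> \<in> Zspace r" "\<Phi> \<in> Zspace r" "\<Psi>' \<in> Zspace r"
  shows "Znorm r ((\<Psi> - \<Phi>) /\<^sub>R h - \<Psi>') =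
      sqrt (2 * pi) * norm ((emb1 r \<Psi> - emb1 r \<Phi>) /\<^sub>R h - emb1 r \<Psi>')
    + sqrt (2 * pi) * norm ((emb2 r \<Psi> - emb2 r \<Phi>) /\<^sub>R h - emb2 r \<Psi>')
    + sqrt (2 * pi) * norm ((emb3 r \<Psi> - emb3 r \<Phi>) /\<^sub>R h - emb3 r \<Psi>')"
  using assms by (cases \<Psi>; cases \<Phi>; cases \<Psi>')
    (simp add: Znorm_def Zspace_iff emb1_def emb2_def emb3_def sobolev_norm_emb emb_diff emb_scaleR)

lemma C_Z_iff: "\<Psi> \<in> C_Z r T \<longleftrightarrow> (\<forall>t\<in>{0..T}. \<Psi> t \<in> Zspace r) \<and>
    continuous_on {0..T} (\<lambda>t. emb1 r (\<Psi> t)) \<and> continuous_on {0..T} (\<lambda>t. emb2 r (\<Psi> t)) \<and>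
    continuous_on {0..T} (\<lambda>t. emb3 r (\<Psi> t))"
proof (cases "\<forall>t\<in>{0..T}. \<Psi> t \<in> Zspace r")
  case True
  have "((\<lambda>\<tau>. Znorm r (\<Psi> \<tau> - \<Psi> t)) \<longlongrightarrow> 0) (at t within {0..T}) \<longleftrightarrow>
      ((\<lambda>t. emb1 r (\<Psi> t)) \<longlongrightarrow> emb1 r (\<Psi> t)) (at t within {0..T}) \<and>
      ((\<lambda>t. emb2 r (\<Psi> t)) \<longlongrightarrow> emb2 r (\<Psi> t)) (at t within {0..T}) \<and>
      ((\<lambda>t. emb3 r (\<Psi> t)) \<longlongrightarrow> emb3 r (\<Psi> t)) (at t within {0..T})" if t: "t \<in> {0..T}" for t
  proof -
    have "((\<lambda>\<tau>. Znorm r (\<Psi> \<tau> - \<Psi> t)) \<longlongrightarrow> 0) (at t within {0..T}) \<longleftrightarrow>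
      ((\<lambda>\<tau>. sqrt (2 * pi) * norm (emb1 r (\<Psi> \<tau>) - emb1 r (\<Psi> t))
    + sqrt (2 * pi) * norm (emb2 r (\<Psi> \<tau>) - emb2 r (\<Psi> t)) + sqrt (2 * pi) * norm (emb3 r (\<Psi> \<tau>) - emb3 r (\<Psi> t)))
      \<longlongrightarrow> 0) (at t within {0..T})"
      by (rule Lim_cong_within) (use True t in \<open>auto simp: Znorm_diff\<close>)
    then show ?thesis
      by (simp add: tendsto_sum3_0_iff tendsto_norm_zero_iff Lim_null[symmetric])
  qed
  with True show ?thesis unfolding C_Z_def continuous_on_def by auto
qed (auto simp: C_Z_def)

lemma has_Z_derivative_iff:
  assumes "\<And>t. t \<in> {0..T} \<Longrightarrow> \<Psi> t \<in> Zspace r" "\<And>t. t \<in> {0..T} \<Longrightarrow> \<Psi>' t \<in> Zspace r"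
  shows "has_Z_derivative r T \<Psi> \<Psi>' \<longleftrightarrow> (\<forall>t\<in>{0..T}.
    ((\<lambda>t. emb1 r (\<Psi> t)) has_vector_derivative emb1 r (\<Psi>' t)) (at t within {0..T}) \<and>
    ((\<lambda>t. emb2 r (\<Psi> t)) has_vector_derivative emb2 r (\<Psi>' t)) (at t within {0..T}) \<and>
    ((\<lambda>t. emb3 r (\<Psi> t)) has_vector_derivative emb3 r (\<Psi>' t)) (at t within {0..T}))"
  unfolding has_Z_derivative_def
proof (rule ball_cong[OF refl])
  fix t assume t: "t \<in> {0..T}"
  have "((\<lambda>\<tau>. Znorm r ((\<Psi> \<tau> - \<Psi> t) /\<^sub>R (\<tau> - t) - \<Psi>' t)) \<longlongrightarrow> 0) (at t within {0..T}) \<longleftrightarrow>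
    ((\<lambda>\<tau>. sqrt (2 * pi) * norm ((emb1 r (\<Psi> \<tau>) - emb1 r (\<Psi> t)) /\<^sub>R (\<tau> - t) - emb1 r (\<Psi>' t))
    + sqrt (2 * pi) * norm ((emb2 r (\<Psi> \<tau>) - emb2 r (\<Psi> t)) /\<^sub>R (\<tau> - t) - emb2 r (\<Psi>' t))
    + sqrt (2 * pi) * norm ((emb3 r (\<Psi> \<tau>) - emb3 r (\<Psi> t)) /\<^sub>R (\<tau> - t) - emb3 r (\<Psi>' t))) \<longlongrightarrow> 0)
      (at t within {0..T})"
    by (rule Lim_cong_within) (use assms t in \<open>auto simp: Znorm_quotient\<close>)
  then show "((\<lambda>\<tau>. Znorm r ((\<Psi> \<tau> - \<Psi> t) /\<^sub>R (\<tau> - t) - \<Psi>' t)) \<longlongrightarrow> 0) (at t within {0..T}) \<longleftrightarrow>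
    ((\<lambda>t. emb1 r (\<Psi> t)) has_vector_derivative emb1 r (\<Psi>' t)) (at t within {0..T}) \<and>
    ((\<lambda>t. emb2 r (\<Psi> t)) has_vector_derivative emb2 r (\<Psi>' t)) (at t within {0..T}) \<and>
    ((\<lambda>t. emb3 r (\<Psi> t)) has_vector_derivative emb3 r (\<Psi>' t)) (at t within {0..T})"
    unfolding has_vector_derivative_iff_quotient by (simp add: tendsto_sum3_0_iff)
qed

lemma has_vector_derivative_cong_on:
  assumes "t \<in> S" "\<And>x. x \<in> S \<Longrightarrow> f x = g x" "d = e"
  shows "(f has_vector_derivative d) (at t within S) \<longleftrightarrow> (g has_vector_derivative e) (at t within S)"
  using has_vector_derivative_transform[of t S f g d] has_vector_derivative_transform[of t S g f d]
    assms by auto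

lemma cj_cj [simp]: "cj (cj a) = a"
  by (rule ell2_eqI) simp

lemma cj_down: "n \<ge> 0 \<Longrightarrow> cj (down n a) = down n (cj a)"
  by (rule ell2_eqI) (simp add: comp_down)

lemma cj_dx: "cj (dx a) = dx (cj a)"
  by (rule ell2_eqI) (simp add: comp_dx)

lemma cj_cmult: "cj (cmult c a) = cmult (cnj c) (cj a)"
  by (rule ell2_eqI) simp

lemma cj_linear [simp]:
  "cj (a + b) = cj a + cj b" "cj (a - b) = cj a - cj b" "cj (- a) = - cj a" "cj (c *\<^sub>R a) = c *\<^sub>R cj a"
  "cj 0 = 0"
  by (rule ell2_eqI; simp)+

lemma coef_down: "n \<ge> 0 \<Longrightarrow> coef (r - n) (down n a) k = coef r a k"
proof -
  assume "n \<ge> 0"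
  moreover have "wt (- (r - n)) k * wt (- n) k = wt (- r) k" by (simp add: wt_mult)
  then have "complex_of_real (wt (- (r - n)) k) * of_real (wt (- n) k) = of_real (wt (- r) k)"
    by (metis of_real_mult)
  ultimately show ?thesis by (simp add: coef_def comp_down flip: mult.assoc)
qed

lemma coef_dx: "coef (r - 1) (dx a) k = \<i> * of_int k * coef r a k"
proof -
  have "wt (- (r - 1)) k * wt (- 1) k = wt (- r) k" by (simp add: wt_mult)
  then have "complex_of_real (wt (- (r - 1)) k) * of_real (wt (- 1) k) = of_real (wt (- r) k)"
    by (metis of_real_mult)
  then show ?thesis by (simp add: coef_def comp_dx mult_ac)
qed

section \<open>The product rule for convolutions\<close>

text \<open>
  \<open>pair s k a b\<close> is the \<open>k\<close>-th Fourier coefficient of the product of \<open>a \<in> H\<^sup>s\<close> and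
  \<open>b \<in> H\<^sup>s\<^sup>-\<^sup>2\<close>, which makes sense since \<open>s \<ge> 2 - s\<close>.
\<close>

definition pair :: "real \<Rightarrow> int \<Rightarrow> ell2 \<Rightarrow> ell2 \<Rightarrow> complex" where
  "pair s k a b = conv (coef s a) (coef (s - 2) b) k"

text \<open>Here \<langle>k\<rangle> denotes \<open>wt 1 k\<close>. The combined weight is at most
  \<langle>k-j\<rangle>/\<langle>j\<rangle>, hence at most 2 (\<langle>k\<rangle> + 1) uniformly in
  \<open>j\<close>, and Cauchy-Schwarz finishes. The bound grows with \<open>k\<close>, which is
  harmless since coefficients are treated one at a time.\<close>

lemma pair_summable:
  assumes s: "s > 3 / 2"
  shows "(\<lambda>j. cmod (coef s a j * coef (s - 2) b (k - j))) summable_on UNIV"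
    and "cmod (pair s k a b) \<le> norm a * norm b * (2 * (wt 1 k + 1))"
proof -
  let ?K = "2 * (wt 1 k + 1)"
  have w: "wt (- s) j * wt (- (s - 2)) (k - j) \<le> ?K" for j
  proof -
    have "wt (- s) j * wt (- (s - 2)) (k - j) \<le> wt (- 1) j * wt 1 (k - j)"
      using s by (intro mult_mono wt_mono) auto
    also have "\<dots> \<le> wt (- 1) j * (2 * (wt 1 k + wt 1 j))"
      using wt_triangle[of 1 k "- j"] by (intro mult_left_mono) auto
    also have "\<dots> = 2 * (wt (- 1) j * wt 1 k + 1)"
      by (simp add: algebra_simps)
    also have "\<dots> \<le> ?K"
      using mult_right_mono[OF wt_le_1[of "- 1" j], of "wt 1 k"] by simp
    finally show ?thesis .
  qed
  have le: "(\<Sum>j\<in>F. cmod (coef s a j * coef (s - 2) b (k - j))) \<le> norm a * norm b * ?K"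
    if F: "finite F" for F
  proof -
    have "(\<Sum>j\<in>F. cmod (coef s a j * coef (s - 2) b (k - j)))
        = (\<Sum>j\<in>F. (wt (- s) j * wt (- (s - 2)) (k - j)) * (cmod (a $$ j) * cmod (b $$ (k - j))))"
      by (simp add: norm_mult norm_coef mult_ac)
    also have "\<dots> \<le> (\<Sum>j\<in>F. ?K * (cmod (a $$ j) * cmod (b $$ (k - j))))"
      by (intro sum_mono mult_right_mono w) auto
    also have "\<dots> = ?K * (\<Sum>j\<in>F. \<bar>cmod (a $$ j)\<bar> * \<bar>cmod (b $$ (k - j))\<bar>)"
      by (simp add: sum_distrib_left)
    also have "\<dots> \<le> ?K * (L2_set (\<lambda>j. cmod (a $$ j)) F * L2_set (\<lambda>j. cmod (b $$ (k - j))) F)"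
      by (intro mult_left_mono L2_set_mult_ineq) (simp add: add_nonneg_nonneg)
    also have "L2_set (\<lambda>j. cmod (b $$ (k - j))) F = L2_set (\<lambda>j. cmod (b $$ j)) ((\<lambda>j. k - j) ` F)"
      by (simp add: L2_set_def sum.reindex inj_on_def)
    also have "?K * (L2_set (\<lambda>j. cmod (a $$ j)) F * \<dots>) \<le> ?K * (norm a * norm b)"
      using F by (intro mult_left_mono mult_mono L2_set_le_norm_ell2) (auto simp: add_nonneg_nonneg)
    finally show ?thesis by (simp add: mult_ac)
  qed
  show s1: "(\<lambda>j. cmod (coef s a j * coef (s - 2) b (k - j))) summable_on UNIV"
    using le by (intro nonneg_bdd_above_summable_on) (auto simp: bdd_above_def)
  have "cmod (pair s k a b) \<le> (\<Sum>\<^sub>\<infinity>j. cmod (coef s a j * coef (s - 2) b (k - j)))"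
    unfolding pair_def conv_def by (rule norm_infsum_bound) (rule s1)
  also have "\<dots> \<le> norm a * norm b * ?K" using le by (intro infsum_le_finite_sums s1) auto
  finally show "cmod (pair s k a b) \<le> norm a * norm b * ?K" .
qed

lemma pair_summable':
  assumes "s > 3 / 2"
  shows "(\<lambda>j. coef s a j * coef (s - 2) b (k - j)) summable_on UNIV"
  by (rule abs_summable_summable) (rule pair_summable(1)[OF assms])

lemma bounded_bilinear_pair:
  assumes s: "s > 3 / 2"
  shows "bounded_bilinear (pair s k)"
proof
  fix a a' b b' :: ell2 and c :: real
  note sm = pair_summable'[OF s]
  have scale: "coef r (c *\<^sub>R a) j = of_real c * coef r a j" for r a j
    by (simp add: coef_def scaleR_conv_of_real)
  show "pair s k (a + a') b = pair s k a b + pair s k a' b"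
    unfolding pair_def conv_def by (simp add: distrib_right infsum_add sm)
  show "pair s k a (b + b') = pair s k a b + pair s k a b'"
    unfolding pair_def conv_def by (simp add: distrib_left infsum_add sm)
  show "pair s k (c *\<^sub>R a) b = c *\<^sub>R pair s k a b"
    unfolding pair_def conv_def by (simp only: scale mult.assoc infsum_cmult_right' scaleR_conv_of_real)
  show "pair s k a (c *\<^sub>R b) = c *\<^sub>R pair s k a b"
    unfolding pair_def conv_def
    by (simp only: scale mult.left_commute[of _ "of_real c"] infsum_cmult_right' scaleR_conv_of_real)
  show "\<exists>K. \<forall>a b. norm (pair s k a b) \<le> norm a * norm b * K"
    using pair_summable(2)[OF s] by blast
qed

lemma pair_cmult: "pair s k a (cmult c b) = c * pair s k a b"
proof -
  have "coef (s - 2) (cmult c b) j = c * coef (s - 2) b j" for j by (simp add: coef_def)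
  then show ?thesis
    unfolding pair_def conv_def by (simp only: mult.left_commute[of _ c] infsum_cmult_right')
qed

lemma pair_down: "pair s k a (down 2 b) = conv (coef s a) (coef s b) k"
  by (simp add: pair_def conv_def coef_down)

text \<open>The Leibniz rule for curves differentiable only in H^(s-2). The difference quotient
  splits so that every quotient, convergent in H^(s-2), is paired with a factor convergent in H^s:
  \<open>A y\<close> by continuity of \<open>A\<close>, and the constant \<open>B t\<close>.\<close>

lemma conv_has_vector_derivative:
  assumes s: "s > 3 / 2"
    and A: "continuous_on S A" "((\<lambda>t. down 2 (A t)) has_vector_derivative X) (at t within S)"
    and B: "((\<lambda>t. down 2 (B t)) has_vector_derivative Y) (at t within S)"
    and t: "t \<in> S"
  shows "((\<lambda>t. conv (coef s (A t)) (coef s (B t)) k) has_vector_derivative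
    pair s k (A t) Y + pair s k (B t) X) (at t within S)"
proof -
  interpret bounded_bilinear "pair s k" by (rule bounded_bilinear_pair[OF s])
  interpret down: bounded_linear "down 2" by (rule bounded_linear_down) simp
  let ?f = "\<lambda>t. conv (coef s (A t)) (coef s (B t)) k"
  let ?q = "\<lambda>B y. (down 2 (B y) - down 2 (B t)) /\<^sub>R (y - t)"
  have lim: "(?q B \<longlongrightarrow> Y) (at t within S)" "(?q A \<longlongrightarrow> X) (at t within S)"
    using A(2) B unfolding has_vector_derivative_iff_quotient
    by (auto simp: tendsto_norm_zero_iff Lim_null[symmetric])
  have "(?f y - ?f t) /\<^sub>R (y - t) = pair s k (A y) (?q B y) + pair s k (B t) (?q A y)" for y
  proof -
    have "?f y - ?f t = pair s k (A y) (down 2 (B y) - down 2 (B t))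
        + (conv (coef s (A y)) (coef s (B t)) k - ?f t)"
      by (simp add: diff_right pair_down)
    also have "conv (coef s (A y)) (coef s (B t)) k - ?f t = pair s k (B t) (down 2 (A y) - down 2 (A t))"
      by (simp add: diff_right pair_down conv_commute[of _ "coef s (B t)"])
    finally show ?thesis by (simp add: scaleR_right scaleR_add_right)
  qed
  moreover have "((\<lambda>y. pair s k (A y) (?q B y) + pair s k (B t) (?q A y)) \<longlongrightarrow>
      pair s k (A t) Y + pair s k (B t) X) (at t within S)"
    using A(1) t by (intro tendsto_add tendsto tendsto_const lim) (auto simp: continuous_on_def)
  ultimately show ?thesis
    unfolding has_vector_derivative_iff_quotient by (simp add: tendsto_norm_zero_iff Lim_null[symmetric])
qed

section \<open>The system on the Fourier side\<close>

locale zr_params =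
  fixes s M \<epsilon> \<delta> D W \<sigma>\<^sub>2 \<sigma>\<^sub>3 \<alpha>\<^sub>1 \<alpha>\<^sub>2 :: real
  assumes s: "s > 3 / 2" and M: "M > 0" and coeffs: "zr_coeffs M D \<sigma>\<^sub>3 \<alpha>\<^sub>1 \<alpha>\<^sub>2"
begin

text \<open>The orders at which products or reconstructions take place: \<open>s\<close> for
  |\<psi>|^2 and the potential term, \<open>s - 1\<close> for the products with \<partial>x\<psi> in
  \<open>cur\<close>, and \<open>s + 1\<close> for \<phi>. The second one reflects the threshold
  3/2.\<close>

lemma s': "s > 1 / 2" "s - 1 > 1 / 2" "s + 1 > 1 / 2"
  using s by auto

definition sq :: "ell2 \<Rightarrow> ell2" where
  "sq a = mul s a (cj a)"

definition cur :: "ell2 \<Rightarrow> ell2" where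
  "cur a = mul (s - 1) (down 1 (cj a)) (dx a) - mul (s - 1) (down 1 a) (dx (cj a))"

definition pot :: "ell2 \<Rightarrow> ell2 \<Rightarrow> ell2 \<Rightarrow> ell2" where
  "pot a r f = \<sigma>\<^sub>2 *\<^sub>R sq a + W *\<^sub>R (r + D *\<^sub>R dx f)"

text \<open>Each \<open>down n\<close> brings its term to a common order: \<open>s - 2\<close> in
  \<open>rhs1\<close> and \<open>rhs2\<close>, \<open>s - 1\<close> in \<open>rhs3\<close>. The
  curves \<open>a\<close>, \<open>r\<close>, \<open>f\<close> have orders \<open>s\<close>,
  \<open>s\<close>, \<open>s + 1\<close>.\<close>

definition rhs1 :: "ell2 \<Rightarrow> ell2 \<Rightarrow> ell2 \<Rightarrow> ell2" where
  "rhs1 a r f = \<sigma>\<^sub>3 *\<^sub>R down 1 (dx a) + cmult (\<i> * \<epsilon> * \<delta>) (dx (dx a))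
    - cmult (\<i> * \<epsilon>) (down 2 (mul s (pot a r f) a))"

definition rhs2 :: "ell2 \<Rightarrow> ell2 \<Rightarrow> ell2 \<Rightarrow> ell2" where
  "rhs2 a r f = - down 1 (dx (dx f)) - D *\<^sub>R down 1 (dx (sq a))
    - \<epsilon> *\<^sub>R cmult (- \<i> * \<delta> * \<alpha>\<^sub>1) (dx (cur a))"

definition rhs3 :: "ell2 \<Rightarrow> ell2 \<Rightarrow> ell2 \<Rightarrow> ell2" where
  "rhs3 a r f = - (1 / M\<^sup>2) *\<^sub>R down 1 r - down 1 (sq a)
    - \<epsilon> *\<^sub>R cmult (- (\<i> / M) * \<delta> * \<alpha>\<^sub>2) (cur a)"

lemma cj_sq: "cj (sq a) = sq a"
  by (simp add: sq_def cj_mul[OF s'(1)] mul_commute)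

lemma cj_cur: "cj (cur a) = - cur a"
  by (simp add: cur_def cj_mul[OF s'(2)] cj_down cj_dx)

lemma cj_pot: "cj r = r \<Longrightarrow> cj f = f \<Longrightarrow> cj (pot a r f) = pot a r f"
  by (simp add: pot_def cj_sq cj_dx)

text \<open>The current is purely imaginary, and so is the coefficient in front of it; their product
  is real.\<close>

lemma cj_rhs2: "cj r = r \<Longrightarrow> cj f = f \<Longrightarrow> cj (rhs2 a r f) = rhs2 a r f"
  unfolding rhs2_def cj_linear cj_cmult cj_down[OF zero_le_one] cj_dx cj_sq cj_cur
  by (intro ell2_eqI) (simp add: comp_dx)

lemma cj_rhs3: "cj r = r \<Longrightarrow> cj f = f \<Longrightarrow> cj (rhs3 a r f) = rhs3 a r f"
  unfolding rhs3_def cj_linear cj_cmult cj_down[OF zero_le_one] cj_dx cj_sq cj_cur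
  by (intro ell2_eqI) simp

lemma continuous_on_mul:
  "r > 1 / 2 \<Longrightarrow> continuous_on S f \<Longrightarrow> continuous_on S g \<Longrightarrow> continuous_on S (\<lambda>t. mul r (f t) (g t))"
  by (rule bounded_bilinear.continuous_on[OF bounded_bilinear_mul])

lemmas continuous_on_linear_ops =
  bounded_linear.continuous_on[OF bounded_linear_dx]
  bounded_linear.continuous_on[OF bounded_linear_cj]
  bounded_linear.continuous_on[OF bounded_linear_cmult]
  bounded_linear.continuous_on[OF bounded_linear_down]

lemma continuous_on_rhs:
  assumes "continuous_on S a" "continuous_on S r" "continuous_on S f"
  shows "continuous_on S (\<lambda>t. rhs1 (a t) (r t) (f t))"
    "continuous_on S (\<lambda>t. rhs2 (a t) (r t) (f t))"
    "continuous_on S (\<lambda>t. rhs3 (a t) (r t) (f t))"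
  unfolding rhs1_def rhs2_def rhs3_def pot_def sq_def cur_def
  by (intro continuous_intros continuous_on_linear_ops continuous_on_mul s' assms; simp)+

section \<open>Solutions as curves in \<ell>^2\<close>

definition vf1 :: "pdist \<times> pdist \<times> pdist \<Rightarrow> pdist" where
  "vf1 = (\<lambda>(\<psi>, \<rho>, \<phi>). \<sigma>\<^sub>3 *\<^sub>R \<partial>\<^sub>x \<psi> + (\<i> * \<epsilon> * \<delta>) *\<^sub>C \<partial>\<^sub>x (\<partial>\<^sub>x \<psi>)
       - (\<i> * \<epsilon>) *\<^sub>C ((\<sigma>\<^sub>2 *\<^sub>R pd_abs2 \<psi> + W *\<^sub>R (\<rho> + D *\<^sub>R \<partial>\<^sub>x \<phi>)) \<odot> \<psi>))"

definition vf2 :: "pdist \<times> pdist \<times> pdist \<Rightarrow> pdist" where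
  "vf2 = (\<lambda>(\<psi>, \<rho>, \<phi>). - \<partial>\<^sub>x (\<partial>\<^sub>x \<phi>) - D *\<^sub>R \<partial>\<^sub>x (pd_abs2 \<psi>) - \<epsilon> *\<^sub>R zr_L1 \<delta> \<alpha>\<^sub>1 \<psi>)"

definition vf3 :: "pdist \<times> pdist \<times> pdist \<Rightarrow> pdist" where
  "vf3 = (\<lambda>(\<psi>, \<rho>, \<phi>). - (1 / M\<^sup>2) *\<^sub>R \<rho> - pd_abs2 \<psi> - \<epsilon> *\<^sub>R zr_L2 M \<delta> \<alpha>\<^sub>2 \<psi>)"

text \<open>The system is explicit in the time derivatives, so the derivative whose existence
  \<open>zr_solution\<close> asserts is forced.\<close>

lemma zr_system_iff:
  "zr_system M \<epsilon> \<delta> D W \<sigma>\<^sub>2 \<sigma>\<^sub>3 \<alpha>\<^sub>1 \<alpha>\<^sub>2 \<Psi> \<Psi>' \<longleftrightarrow> \<Psi>' = (vf1 \<Psi>, vf2 \<Psi>, vf3 \<Psi>)"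
proof -
  have 1: "a - b - c + d = 0 \<longleftrightarrow> a = b + c - d" for a b c d :: pdist
    by (metis add_diff_cancel_left' diff_add_cancel diff_diff_eq eq_iff_diff_eq_0 diff_diff_eq2 add.commute)
  have 2: "a + b + c + d = 0 \<longleftrightarrow> a = - b - c - d" for a b c d :: pdist
    by (auto simp: algebra_simps add_eq_0_iff2)
  show ?thesis
    by (cases \<Psi>; cases \<Psi>') (simp add: zr_system_def vf1_def vf2_def vf3_def 1 2)
qed

lemma emb_vf:
  assumes "\<Psi> \<in> Zspace s"
  shows "vf1 \<Psi> \<in> sobolev (s - 2)"
    "emb (s - 2) (vf1 \<Psi>) = rhs1 (emb1 s \<Psi>) (emb2 s \<Psi>) (emb3 s \<Psi>)"
    "vf2 \<Psi> \<in> sobolev (s - 2)"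
    "emb (s - 2) (vf2 \<Psi>) = rhs2 (emb1 s \<Psi>) (emb2 s \<Psi>) (emb3 s \<Psi>)"
    "vf3 \<Psi> \<in> sobolev (s - 1)"
    "emb (s - 1) (vf3 \<Psi>) = rhs3 (emb1 s \<Psi>) (emb2 s \<Psi>) (emb3 s \<Psi>)"
proof -
  obtain \<psi> \<rho> \<phi> where \<Psi>: "\<Psi> = (\<psi>, \<rho>, \<phi>)" by (cases \<Psi>)
  have S: "\<psi> \<in> sobolev s" "\<rho> \<in> sobolev s" "\<phi> \<in> sobolev (s + 1)"
    using Zspace_sobolev[OF assms] by (auto simp: \<Psi>)
  have E: "emb1 s \<Psi> = emb s \<psi>" "emb2 s \<Psi> = emb s \<rho>" "emb3 s \<Psi> = emb (s + 1) \<phi>"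
    by (auto simp: emb1_def emb2_def emb3_def \<Psi>)
  note cn = emb_cnj[OF S(1)]
  have q: "pd_abs2 \<psi> \<in> sobolev s" "emb s (pd_abs2 \<psi>) = sq (emb s \<psi>)"
    using emb_mult[OF S(1) cn(1) s'(1)] by (auto simp: pd_abs2_def sq_def cn)
  have d1: "\<partial>\<^sub>x \<psi> \<in> sobolev (s - 1)" "emb (s - 1) (\<partial>\<^sub>x \<psi>) = dx (emb s \<psi>)"
    by (rule emb_deriv[OF S(1)]; simp)+
  have d2: "\<partial>\<^sub>x (\<partial>\<^sub>x \<psi>) \<in> sobolev (s - 2)" "emb (s - 2) (\<partial>\<^sub>x (\<partial>\<^sub>x \<psi>)) = dx (dx (emb s \<psi>))"
    using emb_deriv[OF d1(1), of "s - 2"] by (auto simp: d1)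
  have d1': "\<partial>\<^sub>x \<psi> \<in> sobolev (s - 2)" "emb (s - 2) (\<partial>\<^sub>x \<psi>) = down 1 (dx (emb s \<psi>))"
    using emb_down[OF d1(1), of 1 "s - 2"] by (auto simp: d1)
  have dc: "\<partial>\<^sub>x (pd_cnj \<psi>) \<in> sobolev (s - 1)" "emb (s - 1) (\<partial>\<^sub>x (pd_cnj \<psi>)) = dx (cj (emb s \<psi>))"
    using emb_deriv[OF cn(1), of "s - 1"] by (auto simp: cn)
  have df: "\<partial>\<^sub>x \<phi> \<in> sobolev s" "emb s (\<partial>\<^sub>x \<phi>) = dx (emb (s + 1) \<phi>)"
    by (rule emb_deriv[OF S(3)]; simp)+
  have ddf: "\<partial>\<^sub>x (\<partial>\<^sub>x \<phi>) \<in> sobolev (s - 1)" "emb (s - 1) (\<partial>\<^sub>x (\<partial>\<^sub>x \<phi>)) = dx (dx (emb (s + 1) \<phi>))"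
    using emb_deriv[OF df(1), of "s - 1"] by (auto simp: df)
  have ddf': "\<partial>\<^sub>x (\<partial>\<^sub>x \<phi>) \<in> sobolev (s - 2)"
    "emb (s - 2) (\<partial>\<^sub>x (\<partial>\<^sub>x \<phi>)) = down 1 (dx (dx (emb (s + 1) \<phi>)))"
    using emb_down[OF ddf(1), of 1 "s - 2"] by (auto simp: ddf)
  have lo: "\<psi> \<in> sobolev (s - 1)" "emb (s - 1) \<psi> = down 1 (emb s \<psi>)"
    "pd_cnj \<psi> \<in> sobolev (s - 1)" "emb (s - 1) (pd_cnj \<psi>) = down 1 (cj (emb s \<psi>))"
    using emb_down[OF S(1), of 1 "s - 1"] emb_down[OF cn(1), of 1 "s - 1"] by (auto simp: cn)
  define c where "c = pd_cnj \<psi> \<odot> \<partial>\<^sub>x \<psi> - \<psi> \<odot> \<partial>\<^sub>x (pd_cnj \<psi>)"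
  have c: "c \<in> sobolev (s - 1)" "emb (s - 1) c = cur (emb s \<psi>)"
    using emb_diff[OF emb_mult(1)[OF lo(3) d1(1) s'(2)] emb_mult(1)[OF lo(1) dc(1) s'(2)]]
      emb_mult(2)[OF lo(3) d1(1) s'(2)] emb_mult(2)[OF lo(1) dc(1) s'(2)]
    by (auto simp: c_def cur_def lo d1 dc)
  have dcur: "\<partial>\<^sub>x c \<in> sobolev (s - 2)" "emb (s - 2) (\<partial>\<^sub>x c) = dx (cur (emb s \<psi>))"
    using emb_deriv[OF c(1), of "s - 2"] by (auto simp: c)
  define P where "P = \<sigma>\<^sub>2 *\<^sub>R pd_abs2 \<psi> + W *\<^sub>R (\<rho> + D *\<^sub>R \<partial>\<^sub>x \<phi>)"
  have P: "P \<in> sobolev s" "emb s P = pot (emb s \<psi>) (emb s \<rho>) (emb (s + 1) \<phi>)"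
    unfolding P_def pot_def by (simp_all add: emb_add emb_scaleR q df S)
  have N: "P \<odot> \<psi> \<in> sobolev (s - 2)" "emb (s - 2) (P \<odot> \<psi>) = down 2 (mul s (emb s P) (emb s \<psi>))"
    using emb_down[OF emb_mult(1)[OF P(1) S(1) s'(1)], of 2 "s - 2"]
    by (auto simp: emb_mult(2)[OF P(1) S(1) s'(1)])
  have dq: "\<partial>\<^sub>x (pd_abs2 \<psi>) \<in> sobolev (s - 1)" "emb (s - 1) (\<partial>\<^sub>x (pd_abs2 \<psi>)) = dx (sq (emb s \<psi>))"
    using emb_deriv[OF q(1), of "s - 1"] by (auto simp: q)
  have dq': "\<partial>\<^sub>x (pd_abs2 \<psi>) \<in> sobolev (s - 2)"
    "emb (s - 2) (\<partial>\<^sub>x (pd_abs2 \<psi>)) = down 1 (dx (sq (emb s \<psi>)))"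
    using emb_down[OF dq(1), of 1 "s - 2"] by (auto simp: dq)
  have q': "pd_abs2 \<psi> \<in> sobolev (s - 1)" "emb (s - 1) (pd_abs2 \<psi>) = down 1 (sq (emb s \<psi>))"
    using emb_down[OF q(1), of 1 "s - 1"] by (auto simp: q)
  have r': "\<rho> \<in> sobolev (s - 1)" "emb (s - 1) \<rho> = down 1 (emb s \<rho>)"
    using emb_down[OF S(2), of 1 "s - 1"] by auto
  have v1: "vf1 \<Psi> = \<sigma>\<^sub>3 *\<^sub>R \<partial>\<^sub>x \<psi> + (\<i> * \<epsilon> * \<delta>) *\<^sub>C \<partial>\<^sub>x (\<partial>\<^sub>x \<psi>) - (\<i> * \<epsilon>) *\<^sub>C (P \<odot> \<psi>)"
    by (simp add: vf1_def \<Psi> P_def)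
  show "vf1 \<Psi> \<in> sobolev (s - 2)" "emb (s - 2) (vf1 \<Psi>) = rhs1 (emb1 s \<Psi>) (emb2 s \<Psi>) (emb3 s \<Psi>)"
    unfolding v1 rhs1_def E by (simp_all add: emb_add emb_diff emb_scaleR emb_cscale d1' d2 N P)
  have v2: "vf2 \<Psi> = - \<partial>\<^sub>x (\<partial>\<^sub>x \<phi>) - D *\<^sub>R \<partial>\<^sub>x (pd_abs2 \<psi>) - \<epsilon> *\<^sub>R ((- \<i> * \<delta> * \<alpha>\<^sub>1) *\<^sub>C \<partial>\<^sub>x c)"
    by (simp add: vf2_def \<Psi> zr_L1_def c_def)
  show "vf2 \<Psi> \<in> sobolev (s - 2)" "emb (s - 2) (vf2 \<Psi>) = rhs2 (emb1 s \<Psi>) (emb2 s \<Psi>) (emb3 s \<Psi>)"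
    unfolding v2 rhs2_def E by (simp_all add: emb_diff emb_uminus emb_scaleR emb_cscale ddf' dq' dcur)
  have v3: "vf3 \<Psi> = - (1 / M\<^sup>2) *\<^sub>R \<rho> - pd_abs2 \<psi> - \<epsilon> *\<^sub>R ((- (\<i> / M) * \<delta> * \<alpha>\<^sub>2) *\<^sub>C c)"
    by (simp add: vf3_def \<Psi> zr_L2_def c_def)
  show "vf3 \<Psi> \<in> sobolev (s - 1)" "emb (s - 1) (vf3 \<Psi>) = rhs3 (emb1 s \<Psi>) (emb2 s \<Psi>) (emb3 s \<Psi>)"
    unfolding v3 rhs3_def E by (simp_all add: emb_diff emb_uminus emb_scaleR emb_cscale r' q' c)
qed

lemma Zspace_down:
  assumes "\<Psi> \<in> Zspace s"
  shows "\<Psi> \<in> Zspace (s - 2)" "emb1 (s - 2) \<Psi> = down 2 (emb1 s \<Psi>)"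
    "emb2 (s - 2) \<Psi> = down 2 (emb2 s \<Psi>)" "emb3 (s - 2) \<Psi> = down 2 (emb3 s \<Psi>)"
proof -
  have e: "fst \<Psi> \<in> sobolev (s - 2)" "emb1 (s - 2) \<Psi> = down 2 (emb1 s \<Psi>)"
    "fst (snd \<Psi>) \<in> sobolev (s - 2)" "emb2 (s - 2) \<Psi> = down 2 (emb2 s \<Psi>)"
    "snd (snd \<Psi>) \<in> sobolev (s - 2 + 1)" "emb3 (s - 2) \<Psi> = down 2 (emb3 s \<Psi>)"
    using emb_down[OF Zspace_sobolev(1)[OF assms], of 2 "s - 2"]
      emb_down[OF Zspace_sobolev(2)[OF assms], of 2 "s - 2"]
      emb_down[OF Zspace_sobolev(3)[OF assms], of 2 "s - 2 + 1"]
    by (auto simp: emb1_def emb2_def emb3_def)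
  moreover have "cj (emb2 s \<Psi>) = emb2 s \<Psi>" "cj (emb3 s \<Psi>) = emb3 s \<Psi>"
    using assms by (auto simp: Zspace_iff)
  ultimately show "\<Psi> \<in> Zspace (s - 2)" "emb1 (s - 2) \<Psi> = down 2 (emb1 s \<Psi>)"
    "emb2 (s - 2) \<Psi> = down 2 (emb2 s \<Psi>)" "emb3 (s - 2) \<Psi> = down 2 (emb3 s \<Psi>)"
    by (auto simp: Zspace_iff cj_down)
qed

abbreviation "solution \<equiv> zr_solution s M \<epsilon> \<delta> D W \<sigma>\<^sub>2 \<sigma>\<^sub>3 \<alpha>\<^sub>1 \<alpha>\<^sub>2"

text \<open>Continuity is at the orders of Z, whereas \<open>down 2\<close> places the derivative in
  the larger space.\<close>

definition csol :: "real \<Rightarrow> (real \<Rightarrow> ell2) \<Rightarrow> (real \<Rightarrow> ell2) \<Rightarrow> (real \<Rightarrow> ell2) \<Rightarrow> bool" where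
  "csol T a r f \<longleftrightarrow> continuous_on {0..T} a \<and> continuous_on {0..T} r \<and> continuous_on {0..T} f \<and>
    (\<forall>t\<in>{0..T}. cj (r t) = r t \<and> cj (f t) = f t \<and>
      ((\<lambda>t. down 2 (a t)) has_vector_derivative rhs1 (a t) (r t) (f t)) (at t within {0..T}) \<and>
      ((\<lambda>t. down 2 (r t)) has_vector_derivative rhs2 (a t) (r t) (f t)) (at t within {0..T}) \<and>
      ((\<lambda>t. down 2 (f t)) has_vector_derivative rhs3 (a t) (r t) (f t)) (at t within {0..T}))"

text \<open>The right-hand sides are continuous maps from Z to the larger space, so along a curve
  continuous in Z the forced derivative is continuous there. What remains of
  \<open>zr_solution\<close> is then read componentwise.\<close>

lemma solution_iff_csol:
  "solution T \<Psi>\<^sub>0 \<Psi> \<longleftrightarrow> \<Psi> 0 = \<Psi>\<^sub>0 \<and> (\<forall>t\<in>{0..T}. \<Psi> t \<in> Zspace s) \<and>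
    csol T (\<lambda>t. emb1 s (\<Psi> t)) (\<lambda>t. emb2 s (\<Psi> t)) (\<lambda>t. emb3 s (\<Psi> t))"
proof (cases "\<Psi> \<in> C_Z s T")
  case True
  let ?\<Psi>' = "\<lambda>t. (vf1 (\<Psi> t), vf2 (\<Psi> t), vf3 (\<Psi> t))"
  have Z: "\<Psi> t \<in> Zspace s" if "t \<in> {0..T}" for t
    using True that by (auto simp: C_Z_iff)
  have cont: "continuous_on {0..T} (\<lambda>t. emb1 s (\<Psi> t))" "continuous_on {0..T} (\<lambda>t. emb2 s (\<Psi> t))"
    "continuous_on {0..T} (\<lambda>t. emb3 s (\<Psi> t))"
    using True by (auto simp: C_Z_iff)
  have re: "cj (emb2 s (\<Psi> t)) = emb2 s (\<Psi> t)" "cj (emb3 s (\<Psi> t)) = emb3 s (\<Psi> t)"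
    if "t \<in> {0..T}" for t
    using Z[OF that] by (auto simp: Zspace_iff)
  have v: "?\<Psi>' t \<in> Zspace (s - 2)"
    "emb1 (s - 2) (?\<Psi>' t) = rhs1 (emb1 s (\<Psi> t)) (emb2 s (\<Psi> t)) (emb3 s (\<Psi> t))"
    "emb2 (s - 2) (?\<Psi>' t) = rhs2 (emb1 s (\<Psi> t)) (emb2 s (\<Psi> t)) (emb3 s (\<Psi> t))"
    "emb3 (s - 2) (?\<Psi>' t) = rhs3 (emb1 s (\<Psi> t)) (emb2 s (\<Psi> t)) (emb3 s (\<Psi> t))"
    if t: "t \<in> {0..T}" for t
  proof -
    have "s - 2 + 1 = s - 1" by simp
    then show "?\<Psi>' t \<in> Zspace (s - 2)"
      "emb1 (s - 2) (?\<Psi>' t) = rhs1 (emb1 s (\<Psi> t)) (emb2 s (\<Psi> t)) (emb3 s (\<Psi> t))"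
      "emb2 (s - 2) (?\<Psi>' t) = rhs2 (emb1 s (\<Psi> t)) (emb2 s (\<Psi> t)) (emb3 s (\<Psi> t))"
      "emb3 (s - 2) (?\<Psi>' t) = rhs3 (emb1 s (\<Psi> t)) (emb2 s (\<Psi> t)) (emb3 s (\<Psi> t))"
      using emb_vf[OF Z[OF t]] cj_rhs2[OF re[OF t]] cj_rhs3[OF re[OF t]]
      by (simp_all add: Zspace_iff emb1_def emb2_def emb3_def)
  qed
  have low: "\<Psi> \<in> C_Z (s - 2) T"
  proof -
    have c: "continuous_on {0..T} (\<lambda>t. down 2 (emb1 s (\<Psi> t)))"
      "continuous_on {0..T} (\<lambda>t. down 2 (emb2 s (\<Psi> t)))"
      "continuous_on {0..T} (\<lambda>t. down 2 (emb3 s (\<Psi> t)))"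
      by (intro continuous_on_linear_ops cont; simp)+
    show ?thesis
      unfolding C_Z_iff
      using Zspace_down(1)[OF Z] continuous_on_eq[OF c(1) Zspace_down(2)[OF Z, symmetric]]
        continuous_on_eq[OF c(2) Zspace_down(3)[OF Z, symmetric]]
        continuous_on_eq[OF c(3) Zspace_down(4)[OF Z, symmetric]] by blast
  qed
  have low': "?\<Psi>' \<in> C_Z (s - 2) T"
    unfolding C_Z_iff
    using v(1) continuous_on_eq[OF continuous_on_rhs(1)[OF cont] v(2)[symmetric]]
      continuous_on_eq[OF continuous_on_rhs(2)[OF cont] v(3)[symmetric]]
      continuous_on_eq[OF continuous_on_rhs(3)[OF cont] v(4)[symmetric]] by blast
  have "solution T \<Psi>\<^sub>0 \<Psi> \<longleftrightarrow> \<Psi> 0 = \<Psi>\<^sub>0 \<and> has_Z_derivative (s - 2) T \<Psi> ?\<Psi>'"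
  proof
    assume "solution T \<Psi>\<^sub>0 \<Psi>"
    then obtain \<Psi>' where *: "has_Z_derivative (s - 2) T \<Psi> \<Psi>'" "\<And>t. t \<in> {0..T} \<Longrightarrow> \<Psi>' t = ?\<Psi>' t" "\<Psi> 0 = \<Psi>\<^sub>0"
      unfolding zr_solution_def zr_system_iff by blast
    then show "\<Psi> 0 = \<Psi>\<^sub>0 \<and> has_Z_derivative (s - 2) T \<Psi> ?\<Psi>'"
      unfolding has_Z_derivative_def by simp
  next
    assume "\<Psi> 0 = \<Psi>\<^sub>0 \<and> has_Z_derivative (s - 2) T \<Psi> ?\<Psi>'"
    then show "solution T \<Psi>\<^sub>0 \<Psi>"
      unfolding zr_solution_def zr_system_iff using True low low' by blast
  qed
  also have "has_Z_derivative (s - 2) T \<Psi> ?\<Psi>' \<longleftrightarrow>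
      csol T (\<lambda>t. emb1 s (\<Psi> t)) (\<lambda>t. emb2 s (\<Psi> t)) (\<lambda>t. emb3 s (\<Psi> t))"
    unfolding csol_def
    by (subst has_Z_derivative_iff, erule Zspace_down(1)[OF Z], erule v(1),
        simp add: cont re cong: ball_cong del: atLeastAtMost_iff)
      (intro ball_cong refl conj_cong has_vector_derivative_cong_on v Zspace_down(2-4) Z)
  finally show ?thesis using Z by blast
next
  case False
  moreover have "\<Psi> \<in> C_Z s T" if "\<forall>t\<in>{0..T}. \<Psi> t \<in> Zspace s"
    "csol T (\<lambda>t. emb1 s (\<Psi> t)) (\<lambda>t. emb2 s (\<Psi> t)) (\<lambda>t. emb3 s (\<Psi> t))"
    using that by (simp add: C_Z_iff csol_def)
  ultimately show ?thesis by (auto simp: zr_solution_def)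
qed

end

lemma coef_diff [simp]: "coef r (a - b) k = coef r a k - coef r b k"
  and coef_cmult [simp]: "coef r (cmult c a) k = c * coef r a k"
  and coef_scaleR [simp]: "coef r (x *\<^sub>R a) k = of_real x * coef r a k"
  by (simp_all add: coef_def algebra_simps scaleR_conv_of_real)

lemma pair_has_sum:
  assumes "s > 3 / 2"
  shows "((\<lambda>j. coef s a j * coef (s - 2) b (k - j)) has_sum pair s k a b) UNIV"
    and "((\<lambda>j. coef (s - 2) b j * coef s a (k - j)) has_sum pair s k a b) UNIV"
proof -
  show *: "((\<lambda>j. coef s a j * coef (s - 2) b (k - j)) has_sum pair s k a b) UNIV"
    unfolding pair_def conv_def by (intro has_sum_infsum pair_summable' assms)
  show "((\<lambda>j. coef (s - 2) b j * coef s a (k - j)) has_sum pair s k a b) UNIV"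
    by (subst has_sum_reindex_bij_witness[where i="\<lambda>j. k - j" and j="\<lambda>j. k - j" and T=UNIV
          and h="\<lambda>j. coef s a j * coef (s - 2) b (k - j)" and s'="pair s k a b"])
      (use * in auto)
qed

lemma coef_mul_has_sum:
  "r > 1 / 2 \<Longrightarrow> ((\<lambda>j. coef r a j * coef r b (k - j)) has_sum coef r (mul r a b) k) UNIV"
  by (simp add: coef_mul conv_def coef_mul_summable has_sum_infsum)

lemma ell2_comp_has_vector_derivative:
  assumes "((\<lambda>t. down 2 (a t)) has_vector_derivative x) (at t within S)"
  shows "((\<lambda>t. a t $$ k) has_vector_derivative of_real (wt 2 k) * x $$ k) (at t within S)"
proof -
  have "((\<lambda>t. of_real (wt 2 k) * down 2 (a t) $$ k) has_vector_derivative of_real (wt 2 k) * x $$ k)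
      (at t within S)"
    by (intro has_vector_derivative_mult_right has_vector_derivative_comp_ell2 assms)
  then show ?thesis by (simp add: comp_down flip: mult.assoc of_real_mult)
qed

text \<open>The passage from components back to the norm rests on continuity of \<open>x\<close>:
  its primitive has the right components.\<close>

lemma ell2_down_has_vector_derivativeI:
  assumes "continuous_on {0..T} x"
    and "\<And>t k. t \<in> {0..T} \<Longrightarrow>
      ((\<lambda>t. a t $$ k) has_vector_derivative of_real (wt 2 k) * x t $$ k) (at t within {0..T})"
    and t: "t \<in> {0..T}"
  shows "((\<lambda>t. down 2 (a t)) has_vector_derivative x t) (at t within {0..T})"
proof (rule ell2_has_vector_derivative_componentwise[OF assms(1) _ t])
  fix t k assume t: "t \<in> {0..T}"
  have "((\<lambda>t. of_real (wt (- 2) k) * a t $$ k) has_vector_derivative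
      of_real (wt (- 2) k) * (of_real (wt 2 k) * x t $$ k)) (at t within {0..T})"
    by (intro has_vector_derivative_mult_right assms(2) t)
  then show "((\<lambda>t. down 2 (a t) $$ k) has_vector_derivative x t $$ k) (at t within {0..T})"
    by (simp add: comp_down flip: mult.assoc of_real_mult)
qed

section \<open>Propagators, primitives and the constant mode\<close>

definition phase :: "(int \<Rightarrow> real) \<Rightarrow> real \<Rightarrow> ell2 \<Rightarrow> ell2" where
  "phase \<omega> t = diag (\<lambda>k. exp (\<i> * of_real (\<omega> k * t)))"

lemma phase_symbol: "cmod (exp (\<i> * of_real (\<omega> * t))) \<le> 1"
  by (simp add: norm_exp_eq_Re)

lemma comp_phase: "phase \<omega> t a $$ k = exp (\<i> * of_real (\<omega> k * t)) * a $$ k"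
  unfolding phase_def by (rule comp_diag) (rule phase_symbol)

lemma phase_inverse [simp]:
  "phase \<omega> t (phase (\<lambda>k. - \<omega> k) t a) = a" "phase (\<lambda>k. - \<omega> k) t (phase \<omega> t a) = a"
  by (rule ell2_eqI; simp add: comp_phase flip: mult.assoc exp_add)+

lemma phase_0 [simp]: "phase \<omega> 0 a = a"
  by (rule ell2_eqI) (simp add: comp_phase)

text \<open>An odd frequency function gives a propagator preserving real-valued functions. This
  applies to the wave part, whose frequencies are linear in \<open>k\<close>.\<close>

lemma cj_phase: "(\<And>k. \<omega> (- k) = - \<omega> k) \<Longrightarrow> cj (phase \<omega> t a) = phase \<omega> t (cj a)"
  by (rule ell2_eqI) (simp add: comp_phase exp_cnj)

lemma cont_lip_phase: "cont_lip f \<Longrightarrow> cont_lip (\<lambda>t x. phase \<omega> t (f t x))"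
  unfolding phase_def
  by (rule cont_lip_diag[where C=1 and m="\<lambda>t k. exp (\<i> * of_real (\<omega> k * t))"])
    (auto intro!: continuous_intros simp: phase_symbol)

lemma continuous_on_phase: "continuous_on S a \<Longrightarrow> continuous_on S (\<lambda>t. phase \<omega> t (a t))"
  using cont_lip_curve[OF cont_lip_phase[OF cont_lip_id]] .

lemma phase_has_vector_derivative:
  assumes "(g has_vector_derivative g') (at t within S)"
  shows "((\<lambda>t. exp (\<i> * of_real (w * t)) * g t) has_vector_derivative
    exp (\<i> * of_real (w * t)) * (\<i> * of_real w * g t + g')) (at t within S)"
proof -
  have "((\<lambda>t. exp (\<i> * of_real (w * t))) has_vector_derivative \<i> * of_real w * exp (\<i> * of_real (w * t)))
      (at t within S)"
    by (rule has_vector_derivative_real_field[where f="\<lambda>z. exp (\<i> * (of_real w * z))", simplified of_real_mult[symmetric]])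
      (auto intro!: derivative_eq_intros)
  from has_vector_derivative_mult[OF this assms] show ?thesis by (simp add: algebra_simps)
qed

text \<open>Inverts \<open>dx\<close> on sequences that vanish at \<open>0\<close>.\<close>

definition prim :: "ell2 \<Rightarrow> ell2" where
  "prim = diag (\<lambda>k. if k = 0 then 0 else of_real (wt 1 k) / (\<i> * of_int k))"

lemma prim_symbol: "cmod (if k = 0 then 0 else of_real (wt 1 k) / (\<i> * of_int k)) \<le> 2"
proof (cases "k = 0")
  case False
  then have k: "\<bar>of_int k :: real\<bar> \<ge> 1" by linarith
  then have "1 \<le> (of_int k :: real)\<^sup>2" by (metis abs_le_square_iff abs_1 one_power2)
  then have "(wt 1 k)\<^sup>2 \<le> (2 * \<bar>of_int k\<bar>)\<^sup>2"
    using wt_base(2)[of k] by (simp add: wt_square power_mult_distrib)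
  then have "wt 1 k \<le> 2 * \<bar>of_int k\<bar>"
    by (rule power2_le_imp_le) simp
  then show ?thesis using False k by (simp add: norm_divide norm_mult divide_le_eq)
qed simp

lemma comp_prim: "prim a $$ k = (if k = 0 then 0 else of_real (wt 1 k) / (\<i> * of_int k)) * a $$ k"
  unfolding prim_def by (rule comp_diag) (rule prim_symbol)

lemma bounded_linear_prim: "bounded_linear prim"
  unfolding prim_def by (rule bounded_linear_diag) (rule prim_symbol)

lemma cj_prim: "cj (prim a) = prim (cj a)"
  by (rule ell2_eqI) (simp add: comp_prim)

text \<open>The constant function 1, which restores the mean lost under \<open>dx\<close>.\<close>

definition unit0 :: ell2 where
  "unit0 = mk_ell2 (\<lambda>k. if k = 0 then 1 else 0)"

lemma comp_unit0 [simp]: "unit0 $$ k = (if k = 0 then 1 else 0)"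
proof -
  have "in_ell2 (\<lambda>k. if k = 0 then 1 else 0)"
  proof (rule in_ell2I)
    fix F :: "int set" assume "finite F"
    have "L2_set (\<lambda>k. cmod (if k = 0 then 1 else 0)) F \<le> (\<Sum>k\<in>F. cmod (if k = (0::int) then 1 else 0))"
      by (rule L2_set_le_sum) simp
    also have "\<dots> = (\<Sum>k\<in>F. if k = 0 then 1 else 0)" by (intro sum.cong) auto
    also have "\<dots> \<le> (1::real)" using \<open>finite F\<close> by simp
    finally show "L2_set (\<lambda>k. cmod (if k = 0 then 1 else 0)) F \<le> 1" .
  qed
  then show ?thesis by (simp add: unit0_def)
qed

lemma dx_prim: "k \<noteq> 0 \<Longrightarrow> dx (prim a) $$ k = a $$ k"
proof -
  assume k: "k \<noteq> 0"
  have "complex_of_real (wt (- 1) k) * of_real (wt 1 k) = 1"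
    by (simp flip: of_real_mult)
  then show ?thesis using k by (simp add: comp_dx comp_prim field_simps)
qed

lemma prim_dx: "prim (dx f) $$ k = (if k = 0 then 0 else f $$ k)"
proof -
  have "complex_of_real (wt (- 1) k) * of_real (wt 1 k) = 1"
    by (simp flip: of_real_mult)
  then show ?thesis by (simp add: comp_dx comp_prim field_simps)
qed

section \<open>The conservation law for |\<psi>|^2\<close>

context zr_params
begin

text \<open>\<open>\<i> * th k\<close> is the symbol of \<sigma>3 \<partial>x + i \<epsilon>\<delta>
  \<partial>x^2, the linear part of the equation for \<psi>.\<close>

definition th :: "int \<Rightarrow> real" where
  "th k = \<sigma>\<^sub>3 * of_int k - \<epsilon> * \<delta> * (of_int k)\<^sup>2"

definition disp :: "ell2 \<Rightarrow> ell2" where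
  "disp a = \<sigma>\<^sub>3 *\<^sub>R down 1 (dx a) + cmult (\<i> * \<epsilon> * \<delta>) (dx (dx a))"

lemma coef_disp: "coef (s - 2) (disp a) k = \<i> * of_real (th k) * coef s a k"
proof -
  have "coef (s - 2) (down 1 (dx a)) k = \<i> * of_int k * coef s a k"
    using coef_down[of 1 "s - 1" "dx a" k] by (simp add: coef_dx)
  moreover have "coef (s - 2) (dx (dx a)) k = \<i> * of_int k * (\<i> * of_int k * coef s a k)"
    using coef_dx[of "s - 1" "dx a" k] by (simp add: coef_dx)
  ultimately show ?thesis
    by (simp add: disp_def th_def algebra_simps power2_eq_square)
qed

lemma rhs1_disp: "rhs1 a r f = disp a - cmult (\<i> * \<epsilon>) (down 2 (mul s (pot a r f) a))"
  by (simp add: rhs1_def disp_def)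

lemma coef_sq: "coef s (sq a) k = conv (coef s a) (coef s (cj a)) k"
  by (simp add: sq_def coef_mul[OF s'(1)])

text \<open>In frequency variables the left side carries the symbol
  \<open>th j - th (j - k)\<close>. It factors as \<open>k\<close> times \<sigma>3 -
  \<epsilon>\<delta> (2j - k): the factor \<open>k\<close> is the outer derivative, and 2j - k = j -
  (k - j) is the symbol of the current. The dispersive part is thus the derivative of a
  flux.\<close>

lemma pair_disp:
  "pair s k a (cj (disp a)) + pair s k (cj a) (disp a) =
    \<i> * of_int k * (\<sigma>\<^sub>3 * coef s (sq a) k + \<i> * \<epsilon> * \<delta> * coef (s - 1) (cur a) k)"
proof -
  define A B where "A = coef s a" and "B = coef s (cj a)"
  have th': "th j - th (j - k) = of_int k * (\<sigma>\<^sub>3 - \<epsilon> * \<delta> * (2 * of_int j - of_int k))" for j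
    by (simp add: th_def algebra_simps power2_eq_square)
  have "coef (s - 2) (cj (disp a)) l = - \<i> * of_real (th (- l)) * B l" for l
    by (simp add: coef_cj coef_disp B_def)
  then have 1: "((\<lambda>j. A j * (- \<i> * of_real (th (j - k)) * B (k - j))) has_sum pair s k a (cj (disp a))) UNIV"
    using pair_has_sum(1)[OF s, of a "cj (disp a)" k] by (simp add: A_def)
  have 2: "((\<lambda>j. (\<i> * of_real (th j) * A j) * B (k - j)) has_sum pair s k (cj a) (disp a)) UNIV"
    using pair_has_sum(2)[OF s, of "disp a" "cj a" k] by (simp add: A_def B_def coef_disp)
  have 3: "((\<lambda>j. A j * B (k - j)) has_sum coef s (sq a) k) UNIV"
    using coef_mul_has_sum[OF s'(1), of a "cj a" k] by (simp add: A_def B_def sq_def)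
  have 4: "((\<lambda>j. (\<i> * of_int j * A j) * B (k - j)) has_sum
      coef (s - 1) (mul (s - 1) (down 1 (cj a)) (dx a)) k) UNIV"
    using coef_mul_has_sum[OF s'(2), of "dx a" "down 1 (cj a)" k]
    by (simp add: A_def B_def coef_dx coef_down mul_commute)
  have 5: "((\<lambda>j. A j * (\<i> * of_int (k - j) * B (k - j))) has_sum
      coef (s - 1) (mul (s - 1) (down 1 a) (dx (cj a))) k) UNIV"
    using coef_mul_has_sum[OF s'(2), of "down 1 a" "dx (cj a)" k]
    by (simp add: A_def B_def coef_dx coef_down)
  have 6: "((\<lambda>j. (\<i> * of_int j * A j) * B (k - j) + - 1 * (A j * (\<i> * of_int (k - j) * B (k - j))))
      has_sum coef (s - 1) (cur a) k) UNIV"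
    using has_sum_add[OF 4 has_sum_cmult_right[OF 5, of "- 1"]] by (simp add: cur_def)
  have L: "((\<lambda>j. A j * (- \<i> * of_real (th (j - k)) * B (k - j)) + (\<i> * of_real (th j) * A j) * B (k - j))
      has_sum (pair s k a (cj (disp a)) + pair s k (cj a) (disp a))) UNIV"
    by (rule has_sum_add[OF 1 2])
  have R: "((\<lambda>j. \<i> * of_int k * (\<sigma>\<^sub>3 * (A j * B (k - j)) + \<i> * \<epsilon> * \<delta> *
        ((\<i> * of_int j * A j) * B (k - j) + - 1 * (A j * (\<i> * of_int (k - j) * B (k - j))))))
      has_sum \<i> * of_int k * (\<sigma>\<^sub>3 * coef s (sq a) k + \<i> * \<epsilon> * \<delta> * coef (s - 1) (cur a) k)) UNIV"
    by (intro has_sum_cmult_right has_sum_add 3 6)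
  have "A j * (- \<i> * of_real (th (j - k)) * B (k - j)) + (\<i> * of_real (th j) * A j) * B (k - j)
      = \<i> * of_int k * (\<sigma>\<^sub>3 * (A j * B (k - j)) + \<i> * \<epsilon> * \<delta> *
        ((\<i> * of_int j * A j) * B (k - j) + - 1 * (A j * (\<i> * of_int (k - j) * B (k - j)))))" for j
  proof -
    have "A j * (- \<i> * of_real (th (j - k)) * B (k - j)) + (\<i> * of_real (th j) * A j) * B (k - j)
        = \<i> * of_real (th j - th (j - k)) * (A j * B (k - j))"
      by (simp add: algebra_simps)
    also have "\<dots> = \<i> * (of_int k * (\<sigma>\<^sub>3 - \<epsilon> * \<delta> * (2 * of_int j - of_int k))) * (A j * B (k - j))"
      unfolding th' by simp
    also have "\<dots> = \<i> * of_int k * (\<sigma>\<^sub>3 * (A j * B (k - j)) + \<i> * \<epsilon> * \<delta> *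
        ((\<i> * of_int j * A j) * B (k - j) + - 1 * (A j * (\<i> * of_int (k - j) * B (k - j)))))"
      by (simp add: algebra_simps)
    finally show ?thesis .
  qed
  then show ?thesis using has_sum_unique[OF L] R by simp
qed

text \<open>
  The conservation law
  \<open>\<partial>\<^sub>t|\<psi>|\<^sup>2 = \<partial>\<^sub>x (\<sigma>\<^sub>3 |\<psi>|\<^sup>2 + \<i>\<epsilon>\<delta> (cnj \<psi> \<partial>\<^sub>x\<psi> - \<psi> \<partial>\<^sub>x cnj \<psi>))\<close>; a real potential does not contribute.
\<close>

lemma sq_has_vector_derivative:
  assumes a: "continuous_on S a"
    and d: "((\<lambda>t. down 2 (a t)) has_vector_derivative rhs1 (a t) r f) (at t within S)"
    and P: "cj (pot (a t) r f) = pot (a t) r f" and t: "t \<in> S"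
  shows "((\<lambda>t. sq (a t) $$ k) has_vector_derivative
    \<i> * of_int k * (\<sigma>\<^sub>3 * sq (a t) $$ k + \<i> * \<epsilon> * \<delta> * (of_real (wt 1 k) * cur (a t) $$ k))) (at t within S)"
proof -
  interpret bounded_bilinear "pair s k" by (rule bounded_bilinear_pair[OF s])
  let ?P = "pot (a t) r f" and ?a = "a t"
  have "((\<lambda>t. cj (down 2 (a t))) has_vector_derivative cj (rhs1 (a t) r f)) (at t within S)"
    by (rule bounded_linear.has_vector_derivative[OF bounded_linear_cj d])
  then have dc: "((\<lambda>t. down 2 (cj (a t))) has_vector_derivative cj (rhs1 (a t) r f)) (at t within S)"
    by (simp add: cj_down)
  \<comment> \<open>Since the potential is real, conjugation only flips the sign of the factor i in
    front of it.\<close>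
  have cj_rhs1: "cj (rhs1 ?a r f) = cj (disp ?a) + cmult (\<i> * \<epsilon>) (down 2 (mul s ?P (cj ?a)))"
  proof -
    have "cj (down 2 (mul s ?P ?a)) = down 2 (mul s ?P (cj ?a))"
      by (simp add: cj_down cj_mul[OF s'(1)] P)
    then show ?thesis
      unfolding rhs1_disp cj_linear cj_cmult by (intro ell2_eqI) simp
  qed
  have "((\<lambda>t. conv (coef s (a t)) (coef s (cj (a t))) k) has_vector_derivative
      pair s k ?a (cj (rhs1 ?a r f)) + pair s k (cj ?a) (rhs1 ?a r f)) (at t within S)"
    by (rule conv_has_vector_derivative[OF s a d dc t])
  also have "pair s k ?a (cj (rhs1 ?a r f)) + pair s k (cj ?a) (rhs1 ?a r f)
      = pair s k ?a (cj (disp ?a)) + pair s k (cj ?a) (disp ?a)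
      + \<i> * \<epsilon> * (conv (coef s ?a) (coef s (mul s ?P (cj ?a))) k
        - conv (coef s (cj ?a)) (coef s (mul s ?P ?a)) k)"
    unfolding cj_rhs1 unfolding rhs1_disp
    by (simp add: add_right diff_right pair_cmult pair_down algebra_simps)
  \<comment> \<open>Both sides are coefficients of the potential times |\<psi>|^2, so the two
    contributions of opposite sign cancel.\<close>
  also have "conv (coef s ?a) (coef s (mul s ?P (cj ?a))) k
      = conv (coef s (cj ?a)) (coef s (mul s ?P ?a)) k"
  proof -
    have "mul s ?a (mul s ?P (cj ?a)) = mul s (cj ?a) (mul s ?P ?a)"
      by (metis mul_assoc[OF s'(1)] mul_commute)
    then show ?thesis by (metis coef_mul[OF s'(1)])
  qed
  finally have "((\<lambda>t. coef s (sq (a t)) k) has_vector_derivative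
      \<i> * of_int k * (\<sigma>\<^sub>3 * coef s (sq ?a) k + \<i> * \<epsilon> * \<delta> * coef (s - 1) (cur ?a) k)) (at t within S)"
    by (simp add: pair_disp coef_sq)
  then have "((\<lambda>t. of_real (wt s k) * coef s (sq (a t)) k) has_vector_derivative
      of_real (wt s k) * (\<i> * of_int k * (\<sigma>\<^sub>3 * coef s (sq ?a) k + \<i> * \<epsilon> * \<delta> * coef (s - 1) (cur ?a) k)))
      (at t within S)"
    by (rule has_vector_derivative_mult_right)
  moreover have ws: "of_real (wt s k) * coef s x k = x $$ k" for x
    by (simp add: coef_def flip: mult.assoc of_real_mult)
  moreover have "of_real (wt s k) * coef (s - 1) x k = of_real (wt 1 k) * x $$ k" for x
  proof -
    have "wt s k * wt (- (s - 1)) k = wt 1 k" by (simp add: wt_mult)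
    then show ?thesis by (simp add: coef_def flip: mult.assoc of_real_mult)
  qed
  ultimately show ?thesis
    by (simp add: distrib_left mult.left_commute[of "of_real (wt s k)"])
qed

end

section \<open>Reduction to an ordinary differential equation\<close>

lemma cont_lip_scaleR: 
  fixes f :: "real \<Rightarrow> 'a::real_normed_vector \<Rightarrow> 'b::real_normed_vector"
  shows "cont_lip f \<Longrightarrow> cont_lip (\<lambda>t x. c *\<^sub>R f t x)"
  by (rule cont_lip_linear[OF bounded_linear_scaleR_right])

lemma cont_lip_diff:
  fixes f g :: "real \<Rightarrow> 'a::real_normed_vector \<Rightarrow> 'b::real_normed_vector"
  shows "cont_lip f \<Longrightarrow> cont_lip g \<Longrightarrow> cont_lip (\<lambda>t x. f t x - g t x)"
  using cont_lip_add[OF _ cont_lip_scaleR, of f g "- 1"] by simp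

lemmas cont_lip_ops =
  cont_lip_scaleR cont_lip_diff cont_lip_add cont_lip_phase cont_lip_const
  cont_lip_linear[OF bounded_linear_dx] cont_lip_linear[OF bounded_linear_cj]
  cont_lip_linear[OF bounded_linear_cmult] cont_lip_linear[OF bounded_linear_prim]
  cont_lip_linear[OF bounded_linear_down[OF zero_le_one]]
  cont_lip_bilinear[OF bounded_bilinear_mul]

type_synonym state = "ell2 \<times> ell2 \<times> ell2 \<times> real"

lemma cont_lip_fst: "cont_lip (\<lambda>t. fst)"
  by (rule cont_lip_linear[OF bounded_linear_fst cont_lip_id])

lemma cont_lip_snd: "cont_lip (\<lambda>t. snd)"
  by (rule cont_lip_linear[OF bounded_linear_snd cont_lip_id])

lemmas cont_lip_proj =
  cont_lip_fst
  cont_lip_linear[OF bounded_linear_fst cont_lip_snd]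
  cont_lip_linear[OF bounded_linear_fst cont_lip_linear[OF bounded_linear_snd cont_lip_snd]]
  cont_lip_linear[OF bounded_linear_snd cont_lip_linear[OF bounded_linear_snd cont_lip_snd]]

section \<open>The wave variables and the interaction picture\<close>

context zr_params
begin

lemma wt_complex:
  "complex_of_real (wt 1 k) * of_real (wt (- 1) k) = 1"
  "complex_of_real (wt 2 k) = of_real (wt 1 k) * of_real (wt 1 k)"
  by (simp_all add: wt_mult flip: of_real_mult)

text \<open>The last bracket is the time derivative of |\<psi>|^2. Its current term accounts for L1;
  comparing the multiples of \<partial>x|\<psi>|^2 leaves \<alpha>2/M + \<sigma>3 \<alpha>1 = -D,
  the first equation for the coefficients.\<close>

lemma rhs2_alg:
  "of_real (wt 2 k) * rhs2 a r f $$ k = - \<i> * of_int k * (dx f $$ k - of_real (\<alpha>\<^sub>2 / M) * sq a $$ k)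
    + \<alpha>\<^sub>1 * (\<i> * of_int k * (\<sigma>\<^sub>3 * sq a $$ k + \<i> * \<epsilon> * \<delta> * (of_real (wt 1 k) * cur a $$ k)))"
proof -
  have "of_real (\<alpha>\<^sub>2 / M + D) = complex_of_real (- \<sigma>\<^sub>3 * \<alpha>\<^sub>1)"
    using coeffs by (simp add: zr_coeffs_def)
  then have c: "of_real (\<alpha>\<^sub>2 / M) + complex_of_real D = - (of_real \<sigma>\<^sub>3 * of_real \<alpha>\<^sub>1)"
    by simp
  have "rhs2 a r f $$ k = - (of_real (wt (- 1) k) * (\<i> * of_int k * of_real (wt (- 1) k) * dx f $$ k))
      - D * (of_real (wt (- 1) k) * (\<i> * of_int k * of_real (wt (- 1) k) * sq a $$ k))
      + \<epsilon> * (\<i> * \<delta> * \<alpha>\<^sub>1) * (\<i> * of_int k * of_real (wt (- 1) k) * cur a $$ k)"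
    by (simp add: rhs2_def comp_down comp_dx[of "dx f"] comp_dx[of "sq a"] comp_dx[of "cur a"]
        scaleR_conv_of_real algebra_simps)
  then show ?thesis
    using c wt_complex[of k] by algebra
qed

text \<open>The same comparison for the x-derivative of the third equation. The multiples of
  \<partial>x|\<psi>|^2 agree when \<sigma>3 \<alpha>2/M = -1 - \<alpha>1/M^2, which is the second
  equation for the coefficients divided by M.\<close>

lemma rhs3_alg:
  "\<i> * of_int k * of_real (wt (- 1) k) * (of_real (wt 2 k) * rhs3 a r f $$ k) =
    - \<i> * of_int k / (of_real M)\<^sup>2 * (r $$ k - \<alpha>\<^sub>1 * sq a $$ k)
    + of_real (\<alpha>\<^sub>2 / M) * (\<i> * of_int k * (\<sigma>\<^sub>3 * sq a $$ k + \<i> * \<epsilon> * \<delta> * (of_real (wt 1 k) * cur a $$ k)))"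
proof -
  define m where "m = complex_of_real (1 / M\<^sup>2)"
  have "\<sigma>\<^sub>3 * (\<alpha>\<^sub>2 / M) = - 1 - \<alpha>\<^sub>1 * (1 / M\<^sup>2)"
    using coeffs M by (simp add: zr_coeffs_def field_simps power2_eq_square)
  then have "complex_of_real (\<sigma>\<^sub>3 * (\<alpha>\<^sub>2 / M)) = of_real (- 1 - \<alpha>\<^sub>1 * (1 / M\<^sup>2))" by (rule arg_cong)
  then have c: "of_real \<sigma>\<^sub>3 * of_real (\<alpha>\<^sub>2 / M) = - 1 - of_real \<alpha>\<^sub>1 * m"
    by (simp add: m_def)
  have "rhs3 a r f $$ k = - m * (of_real (wt (- 1) k) * r $$ k) - of_real (wt (- 1) k) * sq a $$ k
      + \<i> * \<epsilon> * \<delta> * of_real (\<alpha>\<^sub>2 / M) * cur a $$ k"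
    by (simp add: rhs3_def m_def comp_down scaleR_conv_of_real)
  then have "\<i> * of_int k * of_real (wt (- 1) k) * (of_real (wt 2 k) * rhs3 a r f $$ k) =
    - \<i> * of_int k * m * (r $$ k - \<alpha>\<^sub>1 * sq a $$ k)
    + of_real (\<alpha>\<^sub>2 / M) * (\<i> * of_int k * (\<sigma>\<^sub>3 * sq a $$ k + \<i> * \<epsilon> * \<delta> * (of_real (wt 1 k) * cur a $$ k)))"
    using c wt_complex[of k] by algebra
  then show ?thesis by (simp add: m_def)
qed

lemma rhs1_comp:
  "of_real (wt 2 k) * rhs1 a r f $$ k = \<i> * of_real (th k) * a $$ k - \<i> * \<epsilon> * mul s (pot a r f) a $$ k"
proof -
  have "coef (s - 2) (rhs1 a r f) k = \<i> * of_real (th k) * coef s a k - \<i> * \<epsilon> * coef s (mul s (pot a r f) a) k"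
    unfolding rhs1_disp by (simp add: coef_disp coef_down)
  then have "of_real (wt s k) * coef (s - 2) (rhs1 a r f) k
      = of_real (wt s k) * (\<i> * of_real (th k) * coef s a k - \<i> * \<epsilon> * coef s (mul s (pot a r f) a) k)"
    by simp
  moreover have "of_real (wt s k) * coef s x k = x $$ k" for x
    by (simp add: coef_def flip: mult.assoc of_real_mult)
  moreover have "of_real (wt s k) * coef (s - 2) x k = of_real (wt 2 k) * x $$ k" for x
  proof -
    have "wt s k * wt (- (s - 2)) k = wt 2 k" by (simp add: wt_mult)
    then show ?thesis by (simp add: coef_def flip: mult.assoc of_real_mult)
  qed
  ultimately show ?thesis
    by (simp add: right_diff_distrib mult.left_commute[of "of_real (wt s k)"])
qed

text \<open>
  The normal form: \<open>wave1\<close> stands for \<open>\<rho> - \<alpha>\<^sub>1|\<psi>|\<^sup>2\<close> and \<open>wave2\<close> for \<open>\<partial>\<^sub>x\<phi> - (\<alpha>\<^sub>2/M)|\<psi>|\<^sup>2\<close>, which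
  satisfy a free wave equation.
\<close>

definition wave1 :: "ell2 \<Rightarrow> ell2 \<Rightarrow> ell2" where
  "wave1 a r = r - \<alpha>\<^sub>1 *\<^sub>R sq a"

definition wave2 :: "ell2 \<Rightarrow> ell2 \<Rightarrow> ell2" where
  "wave2 a f = dx f - (\<alpha>\<^sub>2 / M) *\<^sub>R sq a"

text \<open>In \<open>rhs2_alg\<close> and \<open>rhs3_alg\<close> the brackets are the derivative
  of |\<psi>|^2, and subtracting the corresponding multiples of the conservation law removes
  them.\<close>

lemma csol_wave:
  assumes "csol T a r f" and t: "t \<in> {0..T}"
  shows "((\<lambda>t. wave1 (a t) (r t) $$ k) has_vector_derivative
      - \<i> * of_int k * wave2 (a t) (f t) $$ k) (at t within {0..T})"
    and "((\<lambda>t. wave2 (a t) (f t) $$ k) has_vector_derivative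
      - \<i> * of_int k / (of_real M)\<^sup>2 * wave1 (a t) (r t) $$ k) (at t within {0..T})"
proof -
  let ?q = "\<i> * of_int k * (\<sigma>\<^sub>3 * sq (a t) $$ k + \<i> * \<epsilon> * \<delta> * (of_real (wt 1 k) * cur (a t) $$ k))"
  have d: "((\<lambda>t. down 2 (a t)) has_vector_derivative rhs1 (a t) (r t) (f t)) (at t within {0..T})"
      "((\<lambda>t. down 2 (r t)) has_vector_derivative rhs2 (a t) (r t) (f t)) (at t within {0..T})"
      "((\<lambda>t. down 2 (f t)) has_vector_derivative rhs3 (a t) (r t) (f t)) (at t within {0..T})"
    and a: "continuous_on {0..T} a" and re: "cj (r t) = r t" "cj (f t) = f t"
    using assms unfolding csol_def by auto
  have q: "((\<lambda>t. sq (a t) $$ k) has_vector_derivative ?q) (at t within {0..T})"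
    by (rule sq_has_vector_derivative[OF a d(1) cj_pot[OF re] t])
  have "((\<lambda>t. r t $$ k - of_real \<alpha>\<^sub>1 * sq (a t) $$ k) has_vector_derivative
      of_real (wt 2 k) * rhs2 (a t) (r t) (f t) $$ k - of_real \<alpha>\<^sub>1 * ?q) (at t within {0..T})"
    by (intro has_vector_derivative_diff has_vector_derivative_mult_right q
        ell2_comp_has_vector_derivative d)
  then show "((\<lambda>t. wave1 (a t) (r t) $$ k) has_vector_derivative
      - \<i> * of_int k * wave2 (a t) (f t) $$ k) (at t within {0..T})"
    unfolding rhs2_alg by (simp add: wave1_def wave2_def scaleR_conv_of_real)
  have "((\<lambda>t. \<i> * of_int k * of_real (wt (- 1) k) * f t $$ k - of_real (\<alpha>\<^sub>2 / M) * sq (a t) $$ k)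
      has_vector_derivative \<i> * of_int k * of_real (wt (- 1) k) * (of_real (wt 2 k) * rhs3 (a t) (r t) (f t) $$ k)
        - of_real (\<alpha>\<^sub>2 / M) * ?q) (at t within {0..T})"
    by (intro has_vector_derivative_diff has_vector_derivative_mult_right q
        ell2_comp_has_vector_derivative d)
  then show "((\<lambda>t. wave2 (a t) (f t) $$ k) has_vector_derivative
      - \<i> * of_int k / (of_real M)\<^sup>2 * wave1 (a t) (r t) $$ k) (at t within {0..T})"
    unfolding rhs3_alg by (simp add: wave1_def wave2_def scaleR_conv_of_real comp_dx)
qed

text \<open>The free wave system has speed 1/M: \<open>wave1 + M * wave2\<close> is transported by
  exp (-i k t / M), its partner with the opposite sign.\<close>

definition om :: "int \<Rightarrow> real" where
  "om k = of_int k / M"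

text \<open>
  In the interaction picture the state consists of the propagated \<open>\<psi>\<close>, the two Riemann
  invariants \<open>wave1 \<plusminus> M wave2\<close> and the mean of \<open>\<phi>\<close>.
\<close>

definition to_state :: "real \<Rightarrow> ell2 \<Rightarrow> ell2 \<Rightarrow> ell2 \<Rightarrow> state" where
  "to_state t a r f = (phase (\<lambda>k. - th k) t a,
     phase om t (wave1 a r + M *\<^sub>R wave2 a f),
     phase (\<lambda>k. - om k) t (wave1 a r - M *\<^sub>R wave2 a f),
     Re (f $$ 0))"

text \<open>The \<open>st_\<close> maps undo \<open>to_state\<close> at time \<open>t\<close>;
  \<open>st_p\<close> and \<open>st_m\<close> are the two Riemann invariants with their propagators
  restored.\<close>

definition st_a :: "real \<Rightarrow> state \<Rightarrow> ell2" where
  "st_a t y = phase th t (fst y)"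

definition st_p :: "real \<Rightarrow> state \<Rightarrow> ell2" where
  "st_p t y = phase (\<lambda>k. - om k) t (fst (snd y))"

definition st_m :: "real \<Rightarrow> state \<Rightarrow> ell2" where
  "st_m t y = phase om t (fst (snd (snd y)))"

definition st_wave1 :: "real \<Rightarrow> state \<Rightarrow> ell2" where
  "st_wave1 t y = (1 / 2) *\<^sub>R (st_p t y + st_m t y)"

definition st_wave2 :: "real \<Rightarrow> state \<Rightarrow> ell2" where
  "st_wave2 t y = (1 / (2 * M)) *\<^sub>R (st_p t y - st_m t y)"

definition st_r :: "real \<Rightarrow> state \<Rightarrow> ell2" where
  "st_r t y = st_wave1 t y + \<alpha>\<^sub>1 *\<^sub>R sq (st_a t y)"

text \<open>\<phi> is rebuilt from its derivative and its mean. \<open>prim\<close> discards mode 0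
  of its argument, so this is defined on every state, also where that mode is nonzero and no \<phi>
  has this derivative.\<close>

definition st_f :: "real \<Rightarrow> state \<Rightarrow> ell2" where
  "st_f t y = prim (st_wave2 t y + (\<alpha>\<^sub>2 / M) *\<^sub>R sq (st_a t y)) + snd (snd (snd y)) *\<^sub>R unit0"

text \<open>The Riemann invariants are frozen once their propagators are removed, whence the zeros.
  For \<psi> only the potential term survives, and the current enters only through its mean, so no
  derivative is lost.\<close>

definition field :: "real \<Rightarrow> state \<Rightarrow> state" where
  "field t y =
    (phase (\<lambda>k. - th k) t (cmult (- \<i> * \<epsilon>) (mul s (pot (st_a t y) (st_r t y) (st_f t y)) (st_a t y))),
     0, 0, Re (rhs3 (st_a t y) (st_r t y) (st_f t y) $$ 0))"

lemma cont_lip_sq: "cont_lip g \<Longrightarrow> cont_lip (\<lambda>t x. sq (g t x))"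
  unfolding sq_def by (intro cont_lip_ops s')

lemma cont_lip_cur: "cont_lip g \<Longrightarrow> cont_lip (\<lambda>t x. cur (g t x))"
  unfolding cur_def by (intro cont_lip_ops s')

lemma cont_lip_st:
  "cont_lip st_a" "cont_lip st_wave1" "cont_lip st_wave2" "cont_lip st_r" "cont_lip st_f"
proof -
  show a: "cont_lip st_a" unfolding st_a_def[abs_def] by (intro cont_lip_ops cont_lip_proj)
  have pm: "cont_lip st_p" "cont_lip st_m"
    unfolding st_p_def[abs_def] st_m_def[abs_def] by (intro cont_lip_ops cont_lip_proj)+
  show w: "cont_lip st_wave1" "cont_lip st_wave2"
    unfolding st_wave1_def[abs_def] st_wave2_def[abs_def] by (intro cont_lip_ops pm)+
  show "cont_lip st_r" unfolding st_r_def[abs_def] by (intro cont_lip_ops cont_lip_sq w a)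
  show "cont_lip st_f"
    unfolding st_f_def[abs_def]
    by (intro cont_lip_ops cont_lip_sq w a cont_lip_linear[OF bounded_linear_scaleR_left] cont_lip_proj)
qed

text \<open>The products are taken in algebras, the propagators are bounded uniformly in time, and
  the potential sees \<open>st_f\<close> only through \<open>dx\<close>, which maps H^(s+1) to
  H^s.\<close>

lemma cont_lip_field: "cont_lip field"
proof -
  have "bounded_linear (\<lambda>a. Re (a $$ 0))"
    by (rule bounded_linear_compose[OF bounded_linear_Re bounded_linear_comp_ell2])
  then show ?thesis
    unfolding field_def[abs_def] pot_def rhs3_def
    by (intro cont_lip_Pair cont_lip_linear[of "\<lambda>a. Re (a $$ 0)"] cont_lip_ops cont_lip_st cont_lip_sq
        cont_lip_cur s')
qed

text \<open>Reality of \<open>f\<close> makes its mode 0 a real number, so a real last coordinate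
  recovers it.\<close>

lemma st_to_state:
  assumes "cj f = f"
  shows "st_a t (to_state t a r f) = a" "st_wave1 t (to_state t a r f) = wave1 a r"
    "st_wave2 t (to_state t a r f) = wave2 a f" "st_r t (to_state t a r f) = r"
    "st_f t (to_state t a r f) = f"
proof -
  show a: "st_a t (to_state t a r f) = a" by (simp add: st_a_def to_state_def)
  have pm: "st_p t (to_state t a r f) = wave1 a r + M *\<^sub>R wave2 a f"
    "st_m t (to_state t a r f) = wave1 a r - M *\<^sub>R wave2 a f"
    using phase_inverse[of "\<lambda>k. - om k"] phase_inverse[of om]
    by (simp_all add: st_p_def st_m_def to_state_def)
  show w1: "st_wave1 t (to_state t a r f) = wave1 a r"
    by (simp add: st_wave1_def pm flip: scaleR_2)
  show w2: "st_wave2 t (to_state t a r f) = wave2 a f"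
    using M by (simp add: st_wave2_def pm flip: scaleR_2)
  show "st_r t (to_state t a r f) = r" by (simp add: st_r_def a w1 wave1_def)
  have "cnj (f $$ 0) = f $$ 0" using arg_cong[OF assms, of "\<lambda>f. f $$ 0"] by simp
  then have "of_real (Re (f $$ 0)) = f $$ 0" by (simp add: complex_eq_iff)
  moreover have "st_f t (to_state t a r f) = prim (dx f) + Re (f $$ 0) *\<^sub>R unit0"
    unfolding st_f_def w2 a by (simp add: wave2_def to_state_def)
  ultimately show "st_f t (to_state t a r f) = f"
    by (intro ell2_eqI) (simp add: prim_dx scaleR_conv_of_real)
qed

text \<open>For each frequency the propagator cancels the unbounded linear term. What is left is
  continuous in \<ell>^2, so the propagated \<psi> is differentiable at order \<open>s\<close>,
  although \<psi> itself is differentiable only at order \<open>s - 2\<close>.\<close>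

lemma csol_imp_ode:
  assumes c: "csol T a r f"
  shows "ode_solution field T (\<lambda>t. to_state t (a t) (r t) (f t))"
proof -
  have cont: "continuous_on {0..T} a" "continuous_on {0..T} r" "continuous_on {0..T} f"
    using c unfolding csol_def by auto
  have re: "cj (r t) = r t" "cj (f t) = f t" if "t \<in> {0..T}" for t
    using c that unfolding csol_def by auto
  have d: "((\<lambda>t. down 2 (a t)) has_vector_derivative rhs1 (a t) (r t) (f t)) (at t within {0..T})"
      "((\<lambda>t. down 2 (r t)) has_vector_derivative rhs2 (a t) (r t) (f t)) (at t within {0..T})"
      "((\<lambda>t. down 2 (f t)) has_vector_derivative rhs3 (a t) (r t) (f t)) (at t within {0..T})"
    if "t \<in> {0..T}" for t
    using c that unfolding csol_def by auto
  have 1: "((\<lambda>t. phase (\<lambda>k. - th k) t (a t)) has_vector_derivative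
      phase (\<lambda>k. - th k) t (cmult (- \<i> * \<epsilon>) (mul s (pot (a t) (r t) (f t)) (a t)))) (at t within {0..T})"
    if t: "t \<in> {0..T}" for t
  proof (rule ell2_has_vector_derivative_componentwise[OF _ _ t])
    show "continuous_on {0..T} (\<lambda>t. phase (\<lambda>k. - th k) t (cmult (- \<i> * \<epsilon>) (mul s (pot (a t) (r t) (f t)) (a t))))"
      unfolding pot_def sq_def
      by (intro continuous_on_phase continuous_intros continuous_on_linear_ops continuous_on_mul s' cont)
    fix t k assume t: "t \<in> {0..T}"
    from phase_has_vector_derivative[OF ell2_comp_has_vector_derivative[OF d(1)[OF t], of k], of "- th k"]
    show "((\<lambda>t. phase (\<lambda>k. - th k) t (a t) $$ k) has_vector_derivative
      phase (\<lambda>k. - th k) t (cmult (- \<i> * \<epsilon>) (mul s (pot (a t) (r t) (f t)) (a t))) $$ k) (at t within {0..T})"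
      unfolding rhs1_comp by (simp add: comp_phase)
  qed
  \<comment> \<open>The sign \<open>e\<close> treats both invariants at once.\<close>
  have riemann: "((\<lambda>t. phase (\<lambda>k. e * om k) t (wave1 (a t) (r t) + (e * M) *\<^sub>R wave2 (a t) (f t)))
      has_vector_derivative 0) (at t within {0..T})" if e: "e * e = 1" and t: "t \<in> {0..T}" for e t
  proof (rule ell2_has_vector_derivative_componentwise[OF _ _ t])
    have e': "of_real e * (of_real e * x) = (x::complex)" for x
      using e by (simp flip: mult.assoc of_real_mult)
    fix t k assume t: "t \<in> {0..T}"
    let ?w1 = "wave1 (a t) (r t) $$ k" and ?w2 = "wave2 (a t) (f t) $$ k"
    have "((\<lambda>t. wave1 (a t) (r t) $$ k + of_real (e * M) * wave2 (a t) (f t) $$ k) has_vector_derivative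
      - \<i> * of_int k * ?w2 + of_real (e * M) * (- \<i> * of_int k / (of_real M)\<^sup>2 * ?w1)) (at t within {0..T})"
      by (intro has_vector_derivative_add has_vector_derivative_mult_right csol_wave[OF c t])
    note phase_has_vector_derivative[OF this, of "e * om k"]
    moreover have "\<i> * of_real (e * om k) * (?w1 + of_real (e * M) * ?w2)
        + (- \<i> * of_int k * ?w2 + of_real (e * M) * (- \<i> * of_int k / (of_real M)\<^sup>2 * ?w1)) = 0"
      using M by (simp add: om_def algebra_simps power2_eq_square e')
    ultimately show "((\<lambda>t. phase (\<lambda>k. e * om k) t (wave1 (a t) (r t) + (e * M) *\<^sub>R wave2 (a t) (f t)) $$ k)
        has_vector_derivative 0 $$ k) (at t within {0..T})"
      by (simp only: comp_phase comp_ell2_simps scaleR_conv_of_real mult_zero_right)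
  qed simp
  have 2: "((\<lambda>t. phase om t (wave1 (a t) (r t) + M *\<^sub>R wave2 (a t) (f t))) has_vector_derivative 0)
      (at t within {0..T})"
    and 3: "((\<lambda>t. phase (\<lambda>k. - om k) t (wave1 (a t) (r t) - M *\<^sub>R wave2 (a t) (f t))) has_vector_derivative 0)
      (at t within {0..T})" if t: "t \<in> {0..T}" for t
    using riemann[of 1, OF _ t] riemann[of "- 1", OF _ t] by simp_all
  have 4: "((\<lambda>t. Re (f t $$ 0)) has_vector_derivative Re (rhs3 (a t) (r t) (f t) $$ 0)) (at t within {0..T})"
    if t: "t \<in> {0..T}" for t
    using bounded_linear.has_vector_derivative[OF bounded_linear_Re
      ell2_comp_has_vector_derivative[OF d(3)[OF t], of 0]] by simp
  show ?thesis
    unfolding ode_solution_def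
  proof
    fix t assume t: "t \<in> {0..T}"
    show "((\<lambda>t. to_state t (a t) (r t) (f t)) has_vector_derivative
        field t (to_state t (a t) (r t) (f t))) (at t within {0..T})"
      unfolding field_def st_to_state[OF re(2)[OF t]] unfolding to_state_def
      by (intro has_vector_derivative_Pair 1 2 3 4 t)
  qed
qed

text \<open>The equation for \<psi> has to be recovered before the others: it gives the conservation
  law, hence the derivative of |\<psi>|^2 that enters \<rho> and \<phi>. Reality is assumed at time
  0 only, since the Riemann invariants are constant and their propagators preserve it.\<close>

lemma ode_imp_csol:
  assumes y: "ode_solution field T y"
    and re0: "cj (fst (snd (y 0))) = fst (snd (y 0))" "cj (fst (snd (snd (y 0)))) = fst (snd (snd (y 0)))"
  shows "csol T (\<lambda>t. st_a t (y t)) (\<lambda>t. st_r t (y t)) (\<lambda>t. st_f t (y t))"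
proof -
  let ?a = "\<lambda>t. st_a t (y t)" and ?r = "\<lambda>t. st_r t (y t)" and ?f = "\<lambda>t. st_f t (y t)"
  have yc: "continuous_on {0..T} y" by (rule ode_solution_continuous[OF y])
  have cont: "continuous_on {0..T} ?a" "continuous_on {0..T} ?r" "continuous_on {0..T} ?f"
    using cont_lip_curve[OF cont_lip_st(1) yc] cont_lip_curve[OF cont_lip_st(4) yc]
      cont_lip_curve[OF cont_lip_st(5) yc] .
  have dy: "(y has_vector_derivative field t (y t)) (at t within {0..T})" if "t \<in> {0..T}" for t
    using y that by (simp add: ode_solution_def)
  note d_snd = bounded_linear.has_vector_derivative[OF bounded_linear_snd]
    and d_fst = bounded_linear.has_vector_derivative[OF bounded_linear_fst]
  have db: "((\<lambda>t. fst (y t)) has_vector_derivative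
      phase (\<lambda>k. - th k) t (cmult (- \<i> * \<epsilon>) (mul s (pot (?a t) (?r t) (?f t)) (?a t)))) (at t within {0..T})"
    and dp: "((\<lambda>t. fst (snd (y t))) has_vector_derivative 0) (at t within {0..T})"
    and dm: "((\<lambda>t. fst (snd (snd (y t)))) has_vector_derivative 0) (at t within {0..T})"
    and dz: "((\<lambda>t. snd (snd (snd (y t)))) has_vector_derivative
      Re (rhs3 (?a t) (?r t) (?f t) $$ 0)) (at t within {0..T})"
    if t: "t \<in> {0..T}" for t
    using d_fst[OF dy[OF t]] d_fst[OF d_snd[OF dy[OF t]]] d_fst[OF d_snd[OF d_snd[OF dy[OF t]]]]
      d_snd[OF d_snd[OF d_snd[OF dy[OF t]]]]
    by (simp_all add: field_def)
  have p: "fst (snd (y t)) = fst (snd (y 0))" and m: "fst (snd (snd (y t))) = fst (snd (snd (y 0)))"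
    if t: "t \<in> {0..T}" for t
  proof -
    have "0 \<in> {0..T}" using t by simp
    obtain c where "\<And>t. t \<in> {0..T} \<Longrightarrow> fst (snd (y t)) = c"
      using has_vector_derivative_zero_constant[OF convex_closed_interval dp] by blast
    then show "fst (snd (y t)) = fst (snd (y 0))" using t \<open>0 \<in> {0..T}\<close> by metis
    obtain c where "\<And>t. t \<in> {0..T} \<Longrightarrow> fst (snd (snd (y t))) = c"
      using has_vector_derivative_zero_constant[OF convex_closed_interval dm] by blast
    then show "fst (snd (snd (y t))) = fst (snd (snd (y 0)))" using t \<open>0 \<in> {0..T}\<close> by metis
  qed
  have "cj (st_p t (y t)) = st_p t (y t)" "cj (st_m t (y t)) = st_m t (y t)" if t: "t \<in> {0..T}" for t
    using re0 p[OF t] m[OF t] by (simp_all add: st_p_def st_m_def cj_phase om_def)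
  then have w: "cj (st_wave1 t (y t)) = st_wave1 t (y t)" "cj (st_wave2 t (y t)) = st_wave2 t (y t)"
    if "t \<in> {0..T}" for t
    using that by (simp_all add: st_wave1_def st_wave2_def)
  have u0: "cj unit0 = unit0" by (rule ell2_eqI) simp
  have re: "cj (?r t) = ?r t" "cj (?f t) = ?f t" if t: "t \<in> {0..T}" for t
    by (simp_all add: st_r_def st_f_def w[OF t] cj_sq cj_prim u0)
  have d1: "((\<lambda>t. down 2 (?a t)) has_vector_derivative rhs1 (?a t) (?r t) (?f t)) (at t within {0..T})"
    if t: "t \<in> {0..T}" for t
  proof (rule ell2_down_has_vector_derivativeI[OF continuous_on_rhs(1)[OF cont] _ t])
    fix t k assume t: "t \<in> {0..T}"
    have e: "exp (\<i> * of_real (th k * t)) * (exp (\<i> * of_real (- th k * t)) * x) = x" for x :: complex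
      by (simp flip: mult.assoc exp_add)
    from phase_has_vector_derivative[OF has_vector_derivative_comp_ell2[OF db[OF t], of k], of "th k"]
    show "((\<lambda>t. ?a t $$ k) has_vector_derivative
        of_real (wt 2 k) * rhs1 (?a t) (?r t) (?f t) $$ k) (at t within {0..T})"
      unfolding rhs1_comp comp_phase distrib_left e by (simp add: comp_phase st_a_def mult_ac)
  qed
  define q' where "q' t k = \<i> * of_int k * (\<sigma>\<^sub>3 * sq (?a t) $$ k
      + \<i> * \<epsilon> * \<delta> * (of_real (wt 1 k) * cur (?a t) $$ k))" for t k
  have dq: "((\<lambda>t. sq (?a t) $$ k) has_vector_derivative q' t k) (at t within {0..T})"
    if t: "t \<in> {0..T}" for t k
    unfolding q'_def by (rule sq_has_vector_derivative[OF cont(1) d1[OF t] cj_pot[OF re[OF t]] t])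
  have dpm: "((\<lambda>t. st_p t (y t) $$ k) has_vector_derivative - \<i> * of_real (om k) * st_p t (y t) $$ k)
      (at t within {0..T})"
    "((\<lambda>t. st_m t (y t) $$ k) has_vector_derivative \<i> * of_real (om k) * st_m t (y t) $$ k)
      (at t within {0..T})" if t: "t \<in> {0..T}" for t k
    using phase_has_vector_derivative[OF has_vector_derivative_comp_ell2[OF dp[OF t], of k], of "- om k"]
      phase_has_vector_derivative[OF has_vector_derivative_comp_ell2[OF dm[OF t], of k], of "om k"]
    by (simp_all add: st_p_def st_m_def comp_phase mult_ac)
  have M0: "of_real M \<noteq> (0::complex)" using M by simp
  have dw1: "((\<lambda>t. st_wave1 t (y t) $$ k) has_vector_derivative
      - \<i> * of_int k * st_wave2 t (y t) $$ k) (at t within {0..T})" if t: "t \<in> {0..T}" for t k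
  proof -
    have "((\<lambda>t. 1 / 2 * (st_p t (y t) $$ k + st_m t (y t) $$ k)) has_vector_derivative
        1 / 2 * (- \<i> * of_real (om k) * st_p t (y t) $$ k + \<i> * of_real (om k) * st_m t (y t) $$ k))
        (at t within {0..T})"
      by (intro has_vector_derivative_mult_right has_vector_derivative_add dpm t)
    moreover have "1 / 2 * (- \<i> * of_real (om k) * st_p t (y t) $$ k + \<i> * of_real (om k) * st_m t (y t) $$ k)
        = - \<i> * of_int k * st_wave2 t (y t) $$ k"
      using M0 by (simp add: st_wave2_def om_def scaleR_conv_of_real field_simps)
    moreover have "st_wave1 \<tau> (y \<tau>) $$ k = 1 / 2 * (st_p \<tau> (y \<tau>) $$ k + st_m \<tau> (y \<tau>) $$ k)" for \<tau>
      by (simp add: st_wave1_def scaleR_conv_of_real)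
    ultimately show ?thesis by (simp only:)
  qed
  have dw2: "((\<lambda>t. st_wave2 t (y t) $$ k) has_vector_derivative
      - \<i> * of_int k / (of_real M)\<^sup>2 * st_wave1 t (y t) $$ k) (at t within {0..T})" if t: "t \<in> {0..T}" for t k
  proof -
    have "((\<lambda>t. 1 / (2 * of_real M) * (st_p t (y t) $$ k - st_m t (y t) $$ k)) has_vector_derivative
        1 / (2 * of_real M) * (- \<i> * of_real (om k) * st_p t (y t) $$ k - \<i> * of_real (om k) * st_m t (y t) $$ k))
        (at t within {0..T})"
      by (intro has_vector_derivative_mult_right has_vector_derivative_diff dpm t)
    moreover have "1 / (2 * of_real M) * (- \<i> * of_real (om k) * st_p t (y t) $$ k - \<i> * of_real (om k) * st_m t (y t) $$ k)
        = - \<i> * of_int k / (of_real M)\<^sup>2 * st_wave1 t (y t) $$ k"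
      using M0 by (simp add: st_wave1_def om_def scaleR_conv_of_real field_simps power2_eq_square)
    moreover have "st_wave2 \<tau> (y \<tau>) $$ k = 1 / (2 * of_real M) * (st_p \<tau> (y \<tau>) $$ k - st_m \<tau> (y \<tau>) $$ k)" for \<tau>
      by (simp add: st_wave2_def scaleR_conv_of_real)
    ultimately show ?thesis by (simp only:)
  qed
  \<comment> \<open>At mode 0 \<open>prim\<close> does not invert \<open>dx\<close>, but every use
    carries the factor \<open>k\<close>.\<close>
  have kdx: "of_int k * (dx (?f t) $$ k - of_real (\<alpha>\<^sub>2 / M) * sq (?a t) $$ k) = of_int k * st_wave2 t (y t) $$ k"
    for t k
  proof (cases "k = 0")
    case False
    have "dx (?f t) $$ k = dx (prim (st_wave2 t (y t) + (\<alpha>\<^sub>2 / M) *\<^sub>R sq (?a t))) $$ k"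
      using False by (simp add: st_f_def comp_dx)
    then show ?thesis using False by (simp add: dx_prim scaleR_conv_of_real)
  qed simp
  have d2: "((\<lambda>t. down 2 (?r t)) has_vector_derivative rhs2 (?a t) (?r t) (?f t)) (at t within {0..T})"
    if t: "t \<in> {0..T}" for t
  proof (rule ell2_down_has_vector_derivativeI[OF continuous_on_rhs(2)[OF cont] _ t])
    fix t k assume t: "t \<in> {0..T}"
    have "((\<lambda>t. st_wave1 t (y t) $$ k + of_real \<alpha>\<^sub>1 * sq (?a t) $$ k) has_vector_derivative
        - \<i> * of_int k * st_wave2 t (y t) $$ k + of_real \<alpha>\<^sub>1 * q' t k) (at t within {0..T})"
      by (intro has_vector_derivative_add has_vector_derivative_mult_right dw1 dq t)
    moreover have "- \<i> * of_int k * st_wave2 t (y t) $$ k + of_real \<alpha>\<^sub>1 * q' t k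
        = of_real (wt 2 k) * rhs2 (?a t) (?r t) (?f t) $$ k"
      unfolding rhs2_alg q'_def mult.assoc[of "- \<i>"] kdx by simp
    moreover have "?r \<tau> $$ k = st_wave1 \<tau> (y \<tau>) $$ k + of_real \<alpha>\<^sub>1 * sq (?a \<tau>) $$ k" for \<tau>
      by (simp add: st_r_def scaleR_conv_of_real)
    ultimately show "((\<lambda>t. ?r t $$ k) has_vector_derivative
        of_real (wt 2 k) * rhs2 (?a t) (?r t) (?f t) $$ k) (at t within {0..T})" by simp
  qed
  have d3: "((\<lambda>t. down 2 (?f t)) has_vector_derivative rhs3 (?a t) (?r t) (?f t)) (at t within {0..T})"
    if t: "t \<in> {0..T}" for t
  proof (rule ell2_down_has_vector_derivativeI[OF continuous_on_rhs(3)[OF cont] _ t])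
    fix t k assume t: "t \<in> {0..T}"
    show "((\<lambda>t. ?f t $$ k) has_vector_derivative
        of_real (wt 2 k) * rhs3 (?a t) (?r t) (?f t) $$ k) (at t within {0..T})"
    proof (cases "k = 0")
      \<comment> \<open>The mean of \<open>f\<close> is the last coordinate. Its equation keeps only
        a real part, which loses nothing because \<open>rhs3\<close> is real.\<close>
      case True
      have "cnj (rhs3 (?a t) (?r t) (?f t) $$ 0) = rhs3 (?a t) (?r t) (?f t) $$ 0"
        using arg_cong[OF cj_rhs3[OF re[OF t]], of "\<lambda>x. x $$ 0"] by simp
      then have r: "of_real (Re (rhs3 (?a t) (?r t) (?f t) $$ 0)) = rhs3 (?a t) (?r t) (?f t) $$ 0"
        by (simp add: complex_eq_iff)
      have "((\<lambda>t. of_real (snd (snd (snd (y t)))) :: complex) has_vector_derivative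
          of_real (Re (rhs3 (?a t) (?r t) (?f t) $$ 0))) (at t within {0..T})"
        by (rule bounded_linear.has_vector_derivative[OF bounded_linear_of_real dz[OF t]])
      then show ?thesis
        unfolding r using True by (simp add: st_f_def comp_prim scaleR_conv_of_real)
    next
      case False
      let ?c = "of_real (wt 1 k) / (\<i> * of_int k) :: complex"
      have "((\<lambda>t. ?c * (st_wave2 t (y t) $$ k + of_real (\<alpha>\<^sub>2 / M) * sq (?a t) $$ k)) has_vector_derivative
        ?c * (- \<i> * of_int k / (of_real M)\<^sup>2 * st_wave1 t (y t) $$ k + of_real (\<alpha>\<^sub>2 / M) * q' t k)) (at t within {0..T})"
        by (intro has_vector_derivative_add has_vector_derivative_mult_right dw2 dq t)
      moreover have "st_wave1 t (y t) $$ k = ?r t $$ k - \<alpha>\<^sub>1 * sq (?a t) $$ k"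
        by (simp add: st_r_def scaleR_conv_of_real)
      then have "?c * (- \<i> * of_int k / (of_real M)\<^sup>2 * st_wave1 t (y t) $$ k + of_real (\<alpha>\<^sub>2 / M) * q' t k)
          = ?c * (\<i> * of_int k * of_real (wt (- 1) k) * (of_real (wt 2 k) * rhs3 (?a t) (?r t) (?f t) $$ k))"
        unfolding rhs3_alg q'_def by simp
      moreover have "\<dots> = of_real (wt 2 k) * rhs3 (?a t) (?r t) (?f t) $$ k"
      proof -
        have "?c * (\<i> * of_int k * of_real (wt (- 1) k) * x) = (of_real (wt 1 k) * of_real (wt (- 1) k)) * x" for x
          using False by (simp add: field_simps)
        then show ?thesis by (simp flip: of_real_mult)
      qed
      moreover have "?f \<tau> $$ k = ?c * (st_wave2 \<tau> (y \<tau>) $$ k + of_real (\<alpha>\<^sub>2 / M) * sq (?a \<tau>) $$ k)" for \<tau>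
        using False by (simp add: st_f_def comp_prim scaleR_conv_of_real)
      ultimately show ?thesis by simp
    qed
  qed
  show ?thesis unfolding csol_def using cont re d1 d2 d3 by blast
qed

end

section \<open>Well-posedness\<close>

context zr_params
begin

definition state_of :: "real \<Rightarrow> pdist \<times> pdist \<times> pdist \<Rightarrow> state" where
  "state_of t \<Psi> = to_state t (emb1 s \<Psi>) (emb2 s \<Psi>) (emb3 s \<Psi>)"

definition of_state :: "real \<Rightarrow> state \<Rightarrow> pdist \<times> pdist \<times> pdist" where
  "of_state t y = (dist_of s (st_a t y), dist_of s (st_r t y), dist_of (s + 1) (st_f t y))"

lemma emb_of_state [simp]:
  "emb1 s (of_state t y) = st_a t y" "emb2 s (of_state t y) = st_r t y" "emb3 s (of_state t y) = st_f t y"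
  by (simp_all add: emb1_def emb2_def emb3_def of_state_def dist_of(2)[OF s'(1)] dist_of(2)[OF s'(3)])

lemma of_state_Zspace:
  "cj (st_r t y) = st_r t y \<Longrightarrow> cj (st_f t y) = st_f t y \<Longrightarrow> of_state t y \<in> Zspace s"
  using emb_of_state[of t y]
  by (simp add: Zspace_iff) (simp add: of_state_def dist_of(1)[OF s'(1)] dist_of(1)[OF s'(3)])

lemma Zspace_eqI:
  assumes "\<Psi> \<in> Zspace s" "\<Phi> \<in> Zspace s"
    and "emb1 s \<Psi> = emb1 s \<Phi>" "emb2 s \<Psi> = emb2 s \<Phi>" "emb3 s \<Psi> = emb3 s \<Phi>"
  shows "\<Psi> = \<Phi>"
  using assms emb_eq_iff Zspace_sobolev by (auto simp: emb1_def emb2_def emb3_def prod_eq_iff)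

lemma st_state_of:
  assumes "\<Psi> \<in> Zspace s"
  shows "st_a t (state_of t \<Psi>) = emb1 s \<Psi>" "st_r t (state_of t \<Psi>) = emb2 s \<Psi>"
    "st_f t (state_of t \<Psi>) = emb3 s \<Psi>"
  using assms by (simp_all add: state_of_def st_to_state Zspace_iff)

lemma solution_of_ode:
  assumes y: "ode_solution field T y" and T: "T \<ge> 0" and \<Psi>\<^sub>0: "\<Psi>\<^sub>0 \<in> Zspace s" and y0: "y 0 = state_of 0 \<Psi>\<^sub>0"
  shows "solution T \<Psi>\<^sub>0 (\<lambda>t. of_state t (y t))"
proof -
  have re: "cj (emb2 s \<Psi>\<^sub>0) = emb2 s \<Psi>\<^sub>0" "cj (emb3 s \<Psi>\<^sub>0) = emb3 s \<Psi>\<^sub>0"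
    using \<Psi>\<^sub>0 by (auto simp: Zspace_iff)
  have c: "csol T (\<lambda>t. st_a t (y t)) (\<lambda>t. st_r t (y t)) (\<lambda>t. st_f t (y t))"
    by (rule ode_imp_csol[OF y])
      (simp_all add: y0 state_of_def to_state_def wave1_def wave2_def cj_dx cj_sq re)
  have Z: "of_state t (y t) \<in> Zspace s" if "t \<in> {0..T}" for t
    using c that by (intro of_state_Zspace) (auto simp: csol_def)
  have "of_state 0 (y 0) = \<Psi>\<^sub>0"
    using Z[of 0] T \<Psi>\<^sub>0 by (intro Zspace_eqI) (simp_all add: y0 st_state_of)
  then show ?thesis
    unfolding solution_iff_csol using Z c by simp
qed

lemma ode_of_solution: "solution T \<Psi>\<^sub>0 \<Psi> \<Longrightarrow> ode_solution field T (\<lambda>t. state_of t (\<Psi> t))"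
  unfolding solution_iff_csol state_of_def by (intro csol_imp_ode) auto

lemma ode_bounded:
  assumes "ode_solution field T y"
  obtains R where "\<And>t. t \<in> {0..T} \<Longrightarrow> norm (y t) \<le> R"
proof -
  have "bounded (y ` {0..T})"
    by (intro compact_imp_bounded compact_continuous_image ode_solution_continuous[OF assms]) simp
  then obtain R where "\<forall>t\<in>{0..T}. norm (y t) \<le> R" by (auto simp: bounded_iff)
  then show ?thesis using that by blast
qed

text \<open>An arbitrary solution becomes a trajectory of \<open>field\<close>, bounded on the
  compact interval, so two solutions lie in a common ball and the dependence estimate applies with
  equal initial states.\<close>

lemma solution_unique:
  assumes \<Phi>: "solution T \<Psi>\<^sub>0 \<Phi>" and \<Psi>: "solution T \<Psi>\<^sub>0 \<Psi>" and t: "t \<in> {0..T}"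
  shows "\<Phi> t = \<Psi> t"
proof -
  let ?y = "\<lambda>t. state_of t (\<Phi> t)" and ?z = "\<lambda>t. state_of t (\<Psi> t)"
  note ode = ode_of_solution[OF \<Phi>] ode_of_solution[OF \<Psi>]
  obtain R1 where R1: "\<And>t. t \<in> {0..T} \<Longrightarrow> norm (?y t) \<le> R1" using ode_bounded[OF ode(1)] by blast
  obtain R2 where R2: "\<And>t. t \<in> {0..T} \<Longrightarrow> norm (?z t) \<le> R2" using ode_bounded[OF ode(2)] by blast
  define R where "R = max R1 R2"
  obtain C where C: "C \<ge> 0" "\<And>y z t. ode_solution field T y \<Longrightarrow> ode_solution field T z \<Longrightarrow>
    (\<And>t. t \<in> {0..T} \<Longrightarrow> norm (y t) \<le> R) \<Longrightarrow> (\<And>t. t \<in> {0..T} \<Longrightarrow> norm (z t) \<le> R) \<Longrightarrow>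
    t \<in> {0..T} \<Longrightarrow> norm (y t - z t) \<le> C * norm (y 0 - z 0)"
    using ode_solution_dependence[OF cont_lip_field] by blast
  have "norm (?y t - ?z t) \<le> C * norm (?y 0 - ?z 0)"
    by (rule C(2)[OF ode _ _ t]) (use R1 R2 in \<open>auto simp: R_def le_max_iff_disj\<close>)
  moreover have "\<Phi> 0 = \<Psi> 0" using \<Phi> \<Psi> by (simp add: zr_solution_def)
  ultimately have eq: "state_of t (\<Phi> t) = state_of t (\<Psi> t)" by simp
  have Z: "\<Phi> t \<in> Zspace s" "\<Psi> t \<in> Zspace s"
    using \<Phi> \<Psi> t unfolding solution_iff_csol by auto
  show ?thesis
    by (rule Zspace_eqI[OF Z]) (use st_state_of[OF Z(1), of t] st_state_of[OF Z(2), of t] eq in auto)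
qed

lemma unique_solution_of_ode:
  assumes "ode_solution field T y" "T \<ge> 0" "\<Psi>\<^sub>0 \<in> Zspace s" "y 0 = state_of 0 \<Psi>\<^sub>0"
  shows "zr_unique_solution s M \<epsilon> \<delta> D W \<sigma>\<^sub>2 \<sigma>\<^sub>3 \<alpha>\<^sub>1 \<alpha>\<^sub>2 T \<Psi>\<^sub>0 (\<lambda>t. of_state t (y t))"
  unfolding zr_unique_solution_def
  using solution_of_ode[OF assms] solution_unique by blast

text \<open>Uniformity in \<open>t\<close> turns the ODE estimate into one for the supremum over
  time. The lower bound is recorded because that supremum is later compared with 0.\<close>

lemma Znorm_of_state_lipschitz:
  obtains K where "K \<ge> 0" "\<And>t y z. norm y \<le> R \<Longrightarrow> norm z \<le> R \<Longrightarrow> of_state t y \<in> Zspace s \<Longrightarrow>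
    of_state t z \<in> Zspace s \<Longrightarrow>
    0 \<le> Znorm s (of_state t y - of_state t z) \<and> Znorm s (of_state t y - of_state t z) \<le> K * norm (y - z)"
proof -
  obtain L1 where L1: "L1 \<ge> 0" "\<And>t y z. norm y \<le> R \<Longrightarrow> norm z \<le> R \<Longrightarrow>
    norm (st_a t y - st_a t z) \<le> L1 * norm (y - z)" using cont_lip_lipschitz[OF cont_lip_st(1)] by blast
  obtain L2 where L2: "L2 \<ge> 0" "\<And>t y z. norm y \<le> R \<Longrightarrow> norm z \<le> R \<Longrightarrow>
    norm (st_r t y - st_r t z) \<le> L2 * norm (y - z)" using cont_lip_lipschitz[OF cont_lip_st(4)] by blast
  obtain L3 where L3: "L3 \<ge> 0" "\<And>t y z. norm y \<le> R \<Longrightarrow> norm z \<le> R \<Longrightarrow>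
    norm (st_f t y - st_f t z) \<le> L3 * norm (y - z)" using cont_lip_lipschitz[OF cont_lip_st(5)] by blast
  show ?thesis
  proof (rule that[of "sqrt (2 * pi) * L1 + sqrt (2 * pi) * L2 + sqrt (2 * pi) * L3"])
    fix t y z
    assume R: "norm y \<le> R" "norm z \<le> R" and Z: "of_state t y \<in> Zspace s" "of_state t z \<in> Zspace s"
    have eq: "Znorm s (of_state t y - of_state t z) = sqrt (2 * pi) * norm (st_a t y - st_a t z)
        + sqrt (2 * pi) * norm (st_r t y - st_r t z) + sqrt (2 * pi) * norm (st_f t y - st_f t z)"
      by (simp add: Znorm_diff[OF Z])
    also have "\<dots> \<le> sqrt (2 * pi) * (L1 * norm (y - z)) + sqrt (2 * pi) * (L2 * norm (y - z))
        + sqrt (2 * pi) * (L3 * norm (y - z))"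
      by (intro add_mono mult_left_mono L1(2) L2(2) L3(2) R) auto
    finally show "0 \<le> Znorm s (of_state t y - of_state t z) \<and> Znorm s (of_state t y - of_state t z)
        \<le> (sqrt (2 * pi) * L1 + sqrt (2 * pi) * L2 + sqrt (2 * pi) * L3) * norm (y - z)"
      by (simp add: eq algebra_simps)
  qed (use L1 L2 L3 in auto)
qed

lemma state_of_tendsto:
  assumes Z: "\<And>n. X n \<in> Zspace s" "\<Psi> \<in> Zspace s" and lim: "(\<lambda>n. Znorm s (X n - \<Psi>)) \<longlonglongrightarrow> 0"
  shows "(\<lambda>n. state_of 0 (X n)) \<longlonglongrightarrow> state_of 0 \<Psi>"
proof -
  \<comment> \<open>\<open>sqrt (2 * pi)\<close> is at least 1, so each component norm is below the
    norm of Z.\<close>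
  have ge: "x \<le> sqrt (2 * pi) * x" if "x \<ge> 0" for x
  proof -
    have "1 \<le> sqrt (2 * pi)" using pi_gt3 by simp
    then have "1 * x \<le> sqrt (2 * pi) * x" using that by (rule mult_right_mono)
    then show ?thesis by simp
  qed
  have le: "norm (emb1 s (X n) - emb1 s \<Psi>) \<le> Znorm s (X n - \<Psi>)"
    "norm (emb2 s (X n) - emb2 s \<Psi>) \<le> Znorm s (X n - \<Psi>)"
    "norm (emb3 s (X n) - emb3 s \<Psi>) \<le> Znorm s (X n - \<Psi>)" for n
    using ge[OF norm_ge_zero, of "emb1 s (X n) - emb1 s \<Psi>"] ge[OF norm_ge_zero, of "emb2 s (X n) - emb2 s \<Psi>"]
      ge[OF norm_ge_zero, of "emb3 s (X n) - emb3 s \<Psi>"]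
      norm_ge_zero[of "emb1 s (X n) - emb1 s \<Psi>"] norm_ge_zero[of "emb2 s (X n) - emb2 s \<Psi>"]
      norm_ge_zero[of "emb3 s (X n) - emb3 s \<Psi>"]
    unfolding Znorm_diff[OF Z] by linarith+
  have e: "(\<lambda>n. emb1 s (X n)) \<longlonglongrightarrow> emb1 s \<Psi>" "(\<lambda>n. emb2 s (X n)) \<longlonglongrightarrow> emb2 s \<Psi>"
    "(\<lambda>n. emb3 s (X n)) \<longlonglongrightarrow> emb3 s \<Psi>"
    by (rule LIM_zero_cancel, rule Lim_null_comparison[OF _ lim], simp add: le)+
  note lin = bounded_linear.tendsto[OF bounded_linear_cj] bounded_linear.tendsto[OF bounded_linear_dx]
    bounded_bilinear.tendsto[OF bounded_bilinear_mul[OF s'(1)]]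
  show ?thesis
    unfolding state_of_def to_state_def phase_0 wave1_def wave2_def sq_def
    by (intro tendsto_intros lin e)
qed

end

theorem theorem1p13:
  fixes s M \<epsilon> \<delta> D W \<sigma>\<^sub>2 \<sigma>\<^sub>3 \<alpha>\<^sub>1 \<alpha>\<^sub>2 :: real
    and \<Psi>\<^sub>0 :: "pdist \<times> pdist \<times> pdist"
  assumes "s > 3 / 2" and "M > 0" and "M \<noteq> 1" and "\<epsilon> > 0"
    and "\<sigma>\<^sub>2 \<in> {1, -1}" and "\<sigma>\<^sub>3 \<in> {1, -1}" and "W > 0"
    and "zr_coeffs M D \<sigma>\<^sub>3 \<alpha>\<^sub>1 \<alpha>\<^sub>2"
    and "\<Psi>\<^sub>0 \<in> Zspace s"
  shows "\<exists>T>0. \<exists>\<Psi>.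
    zr_unique_solution s M \<epsilon> \<delta> D W \<sigma>\<^sub>2 \<sigma>\<^sub>3 \<alpha>\<^sub>1 \<alpha>\<^sub>2 T \<Psi>\<^sub>0 \<Psi> \<and>
    (\<forall>\<Psi>\<^sub>0\<^sub>n :: nat \<Rightarrow> pdist \<times> pdist \<times> pdist.
       (\<forall>n. \<Psi>\<^sub>0\<^sub>n n \<in> Zspace s) \<longrightarrow>
       (\<lambda>n. Znorm s (\<Psi>\<^sub>0\<^sub>n n - \<Psi>\<^sub>0)) \<longlonglongrightarrow> 0 \<longrightarrow>
       (\<forall>T'\<in>{0<..<T}. \<exists>N. \<exists>\<Psi>\<^sub>n :: nat \<Rightarrow> real \<Rightarrow> pdist \<times> pdist \<times> pdist.
          (\<forall>n>N. zr_unique_solution s M \<epsilon> \<delta> D W \<sigma>\<^sub>2 \<sigma>\<^sub>3 \<alpha>\<^sub>1 \<alpha>\<^sub>2 T' (\<Psi>\<^sub>0\<^sub>n n) (\<Psi>\<^sub>n n)) \<and>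
          (\<lambda>n. SUP t\<in>{0..T'}. Znorm s (\<Psi>\<^sub>n n t - \<Psi> t)) \<longlonglongrightarrow> 0))"
proof -
  interpret zr_params s M \<epsilon> \<delta> D W \<sigma>\<^sub>2 \<sigma>\<^sub>3 \<alpha>\<^sub>1 \<alpha>\<^sub>2
    by unfold_locales (use assms in auto)
  note \<Psi>\<^sub>0 = \<open>\<Psi>\<^sub>0 \<in> Zspace s\<close>
  \<comment> \<open>The margin 1 makes the ball contain all states close to the given one, so the
    Picard interval for \<open>R\<close> is common to the limit and to almost all members of the
    sequence.\<close>
  define R where "R = norm (state_of 0 \<Psi>\<^sub>0) + 1"
  obtain T where T: "T > 0" "\<And>x0. norm x0 \<le> R \<Longrightarrow>
    \<exists>y. y 0 = x0 \<and> ode_solution field T y \<and> (\<forall>t\<in>{0..T}. norm (y t) \<le> R + 1)"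
    using picard_local[OF cont_lip_field, of R] by (auto simp: R_def)
  obtain y where y: "y 0 = state_of 0 \<Psi>\<^sub>0" "ode_solution field T y" "\<And>t. t \<in> {0..T} \<Longrightarrow> norm (y t) \<le> R + 1"
    using T(2)[of "state_of 0 \<Psi>\<^sub>0"] by (auto simp: R_def)
  obtain C where C: "C \<ge> 0" "\<And>y z t. ode_solution field T y \<Longrightarrow> ode_solution field T z \<Longrightarrow>
    (\<And>t. t \<in> {0..T} \<Longrightarrow> norm (y t) \<le> R + 1) \<Longrightarrow> (\<And>t. t \<in> {0..T} \<Longrightarrow> norm (z t) \<le> R + 1) \<Longrightarrow>
    t \<in> {0..T} \<Longrightarrow> norm (y t - z t) \<le> C * norm (y 0 - z 0)"
    using ode_solution_dependence[OF cont_lip_field] by blast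
  obtain K where K: "K \<ge> 0" "\<And>t y z. norm y \<le> R + 1 \<Longrightarrow> norm z \<le> R + 1 \<Longrightarrow> of_state t y \<in> Zspace s \<Longrightarrow>
    of_state t z \<in> Zspace s \<Longrightarrow>
    0 \<le> Znorm s (of_state t y - of_state t z) \<and> Znorm s (of_state t y - of_state t z) \<le> K * norm (y - z)"
    using Znorm_of_state_lipschitz by blast
  have inZ: "of_state t (z t) \<in> Zspace s"
    if "ode_solution field T z" "X \<in> Zspace s" "z 0 = state_of 0 X" "t \<in> {0..T}" for z X t
    using solution_of_ode[OF that(1) less_imp_le[OF T(1)] that(2,3)] that(4)
    unfolding solution_iff_csol by auto
  let ?\<Psi> = "\<lambda>t. of_state t (y t)"
  show ?thesis
  proof (intro exI[of _ T] conjI exI[of _ ?\<Psi>] allI impI ballI)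
    show "zr_unique_solution s M \<epsilon> \<delta> D W \<sigma>\<^sub>2 \<sigma>\<^sub>3 \<alpha>\<^sub>1 \<alpha>\<^sub>2 T \<Psi>\<^sub>0 ?\<Psi>"
      using unique_solution_of_ode[OF y(2) _ \<Psi>\<^sub>0 y(1)] T(1) by simp
  next
    fix X :: "nat \<Rightarrow> pdist \<times> pdist \<times> pdist" and T'
    assume X: "\<forall>n. X n \<in> Zspace s" and lim: "(\<lambda>n. Znorm s (X n - \<Psi>\<^sub>0)) \<longlonglongrightarrow> 0"
      and T': "T' \<in> {0<..<T}"
    have st: "(\<lambda>n. state_of 0 (X n)) \<longlonglongrightarrow> state_of 0 \<Psi>\<^sub>0"
      using X by (intro state_of_tendsto \<Psi>\<^sub>0 lim) auto
    then have "\<forall>\<^sub>F n in sequentially. norm (state_of 0 (X n)) < R"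
      by (intro order_tendstoD(2)[OF tendsto_norm]) (auto simp: R_def)
    then obtain N where N: "\<And>n. n \<ge> N \<Longrightarrow> norm (state_of 0 (X n)) \<le> R"
      by (auto simp: eventually_sequentially intro: less_imp_le)
    \<comment> \<open>Below \<open>N\<close> the curve is left arbitrary; neither the conclusion for
      \<open>n > N\<close> nor the limit depends on it.\<close>
    have "\<forall>n. \<exists>z. n \<ge> N \<longrightarrow> z 0 = state_of 0 (X n) \<and> ode_solution field T z \<and> (\<forall>t\<in>{0..T}. norm (z t) \<le> R + 1)"
      using T(2)[OF N] by blast
    then obtain z where z: "\<And>n. n \<ge> N \<Longrightarrow> z n 0 = state_of 0 (X n)" "\<And>n. n \<ge> N \<Longrightarrow> ode_solution field T (z n)"
      "\<And>n t. n \<ge> N \<Longrightarrow> t \<in> {0..T} \<Longrightarrow> norm (z n t) \<le> R + 1" by metis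
    let ?X = "\<lambda>n t. of_state t (z n t)"
    \<comment> \<open>The trajectories exist on all of \<open>{0..T}\<close>; restricting them to
      \<open>{0..T'}\<close> gives the required solutions.\<close>
    have uniq: "zr_unique_solution s M \<epsilon> \<delta> D W \<sigma>\<^sub>2 \<sigma>\<^sub>3 \<alpha>\<^sub>1 \<alpha>\<^sub>2 T' (X n) (?X n)" if "n > N" for n
      using T' X z(1)[of n] that
      by (intro unique_solution_of_ode ode_solution_subset[OF z(2), of _ T']) auto
    have bound: "0 \<le> Znorm s (?X n t - ?\<Psi> t) \<and>
        Znorm s (?X n t - ?\<Psi> t) \<le> K * (C * norm (state_of 0 (X n) - state_of 0 \<Psi>\<^sub>0))"
      if n: "n \<ge> N" and t: "t \<in> {0..T'}" for n t
    proof -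
      have t': "t \<in> {0..T}" using t T' by auto
      have nonneg: "0 \<le> Znorm s (?X n t - ?\<Psi> t)"
        and "Znorm s (?X n t - ?\<Psi> t) \<le> K * norm (z n t - y t)"
        using K(2)[OF z(3)[OF n t'] y(3)[OF t'] inZ[OF z(2)[OF n] _ z(1)[OF n] t'] inZ[OF y(2) \<Psi>\<^sub>0 y(1) t']] X
        by auto
      moreover have "norm (z n t - y t) \<le> C * norm (z n 0 - y 0)"
        by (rule C(2)[OF z(2)[OF n] y(2) _ _ t']) (use z(3)[OF n] y(3) in auto)
      ultimately show ?thesis
        using K(1) unfolding z(1)[OF n] y(1) by (meson mult_left_mono order_trans)
    qed
    have "(\<lambda>n. SUP t\<in>{0..T'}. Znorm s (?X n t - ?\<Psi> t)) \<longlonglongrightarrow> 0"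
    proof (rule Lim_null_comparison)
      have "(\<lambda>n. K * (C * norm (state_of 0 (X n) - state_of 0 \<Psi>\<^sub>0)))
          \<longlonglongrightarrow> K * (C * norm (state_of 0 \<Psi>\<^sub>0 - state_of 0 \<Psi>\<^sub>0))"
        by (intro tendsto_intros st)
      then show "(\<lambda>n. K * (C * norm (state_of 0 (X n) - state_of 0 \<Psi>\<^sub>0))) \<longlonglongrightarrow> 0" by simp
      show "\<forall>\<^sub>F n in sequentially. norm (SUP t\<in>{0..T'}. Znorm s (?X n t - ?\<Psi> t))
          \<le> K * (C * norm (state_of 0 (X n) - state_of 0 \<Psi>\<^sub>0))"
        unfolding eventually_sequentially
      proof (intro exI[of _ N] allI impI)
        fix n assume n: "N \<le> n"
        let ?g = "\<lambda>t. Znorm s (?X n t - ?\<Psi> t)"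
        \<comment> \<open>The value at time 0 shows that the supremum is nonnegative, so its norm is
          the supremum itself.\<close>
        have 0: "0 \<in> {0..T'}" using T' by simp
        have "bdd_above (?g ` {0..T'})" using bound[OF n] by (intro bdd_aboveI2) blast
        then have "?g 0 \<le> (SUP t\<in>{0..T'}. ?g t)" by (rule cSUP_upper[OF 0])
        moreover have "(SUP t\<in>{0..T'}. ?g t) \<le> K * (C * norm (state_of 0 (X n) - state_of 0 \<Psi>\<^sub>0))"
          using 0 bound[OF n] by (intro cSUP_least) auto
        ultimately show "norm (SUP t\<in>{0..T'}. ?g t) \<le> K * (C * norm (state_of 0 (X n) - state_of 0 \<Psi>\<^sub>0))"
          using bound[OF n 0] by simp
      qed
    qed
    then show "\<exists>N. \<exists>\<Psi>\<^sub>n :: nat \<Rightarrow> real \<Rightarrow> pdist \<times> pdist \<times> pdist.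
          (\<forall>n>N. zr_unique_solution s M \<epsilon> \<delta> D W \<sigma>\<^sub>2 \<sigma>\<^sub>3 \<alpha>\<^sub>1 \<alpha>\<^sub>2 T' (X n) (\<Psi>\<^sub>n n)) \<and>
          (\<lambda>n. SUP t\<in>{0..T'}. Znorm s (\<Psi>\<^sub>n n t - ?\<Psi> t)) \<longlonglongrightarrow> 0"
      by (intro exI[of _ N] exI[of _ ?X] conjI allI impI uniq)
  qed (rule T(1))
qed

end
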